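(* Let $(\mathcal{D},\mathrm{E})$ be a simplicial descent category with simplicial descent structure $(\mathbf{s},\mu,\lambda)$, let $c:\mathcal{D}\to\Delta^{op}\mathcal{D}$ be the constant functor, let $\Delta^{op}\mathrm{E}$ be the class of maps $f$ in $\Delta^{op}\mathcal{D}$ with $f_n\in\mathrm{E}$ for all $n\ge0$, and let $\mathcal{S}=\mathbf{s}^{-1}\mathrm{E}$ be the class of maps $f$ in $\Delta^{op}\mathcal{D}$ with $\mathbf{s}(f)\in\mathrm{E}$. (i) The simple functor $\mathbf{s}:(\Delta^{op}\mathcal{D})[(\Delta^{op}\mathrm{E})^{-1}]\to\mathcal{D}[\mathrm{E}^{-1}]$ is left adjoint to $c:\mathcal{D}[\mathrm{E}^{-1}]\to(\Delta^{op}\mathcal{D})[(\Delta^{op}\mathrm{E})^{-1}]$. (ii) The pair $\mathbf{s}:\Delta^{op}\mathcal{D}\rightleftarrows\mathcal{D}:c$ is a homotopical equivalence between $(\Delta^{op}\mathcal{D},\mathcal{S})$ and $(\mathcal{D},\mathrm{E})$. In particular, $\mathbf{s}:(\Delta^{op}\mathcal{D})[\mathcal{S}^{-1}]\to\mathcal{D}[\mathrm{E}^{-1}]$ is an equivalence of categories.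
   Context: **Homotopical equivalences.** A homotopical equivalence between relative categories $(\mathcal{C},\mathcal{W})$ and $(\mathcal{D},\mathrm{E})$ consists of functors $F:\mathcal{C}\to\mathcal{D}$, $G:\mathcal{D}\to\mathcal{C}$ with $F(\mathcal{W})\subset\mathrm{E}$, $G(\mathrm{E})\subset\mathcal{W}$, and zigzags of natural weak equivalences $FG\dashrightarrow1_{\mathcal{D}}$ and $GF\dashrightarrow1_{\mathcal{C}}$. **Simplicial descent categories.** $\Delta$ is the category of ordered sets $[n]=\{0,\dots,n\}$ and order preserving maps. $\Delta^{op}\mathcal{D}$ is the category of simplicial objects in $\mathcal{D}$; $c(A)$ is the constant simplicial object on $A$; $\mathrm{D}(Z)_n=Z_{n,n}$ is the diagonal of a bisimplicial object. If $\mathcal D$ has finite coproducts and $K$ is a simplicial finite set, $(X\boxtimes K)_n=\coprod_{K_n}X_n$; the map $d^0:[0]\to[1]$ induces $d_0^X:X\to X\boxtimes\Delta[1]$, and we write $A$ for $c(A)$. A class $\mathrm{E}$ of morphisms of $\mathcal{D}$ is saturated if it consists of exactly the morphisms that become invertible in $\mathcal{D}[\mathrm{E}^{-1}]$ (localizations are not assumed to have small hom-sets). A relative category $(\mathcal{D},\mathrm{E})$ is a category with a saturated class of morphisms (weak equivalences); it is closed by finite coproducts if $\mathcal{D}$ has an initial object and finite coproducts, and $f\sqcup g\in\mathrm{E}$ whenever $f,g\in\mathrm{E}$. A zigzag of natural weak equivalences $F\dashrightarrow G$ is a finite chain of natural transformations, in either direction, connecting $F$ to $G$, each objectwise in $\mathrm{E}$;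 $Fun(\mathcal{C},\mathcal{D})[\mathrm{E}^{-1}]$ is the localization at the objectwise weak equivalences. A simplicial descent structure on a relative category $(\mathcal{D},\mathrm{E})$ closed by finite coproducts is a triple $(\mathbf{s},\mu,\lambda)$ with: (S1) $\mathbf{s}:\Delta^{op}\mathcal{D}\to\mathcal{D}$ is a functor (the simple functor) such that $\mathbf{s}(X)\sqcup\mathbf{s}(Y)\to\mathbf{s}(X\sqcup Y)$ is in $\mathrm{E}$ for all $X,Y$. (S2) $\mu:\mathbf{s}\circ\mathrm{D}\dashrightarrow\mathbf{s}\circ\mathbf{s}$ is a zigzag of natural weak equivalences, where $\mathbf{s}\mathbf{s}(Z)=\mathbf{s}(n\mapsto\mathbf{s}(m\mapsto Z_{n,m}))$. (S3) $\lambda:\mathbf{s}\circ c\dashrightarrow 1_{\mathcal{D}}$ is a zigzag of natural weak equivalences compatible with $\mu$: with $(X\times\Delta)_{n,m}=X_n$, $(\Delta\times X)_{n,m}=X_m$, the composites $\mathbf{s}(X)\xrightarrow{\mu_{\Delta\times X}}\mathbf{s}c\mathbf{s}(X)\xrightarrow{\lambda_{\mathbf{s}(X)}}\mathbf{s}(X)$ and $\mathbf{s}(X)\xrightarrow{\mu_{X\times\Delta}}\mathbf{s}(n\mapsto\mathbf{s}c(X_n))\xrightarrow{\mathbf{s}(\lambda_X)}\mathbf{s}(X)$ are the identity in $Fun(\Delta^{op}\mathcal{D},\mathcal{D})[\mathrm{E}^{-1}]$. (S4) If $f:X\to Y$ in $\Delta^{op}\mathcal{D}$ has $f_n\in\mathrm{E}$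 for all $n$, then $\mathbf{s}(f)\in\mathrm{E}$. (S5) $\mathbf{s}(d_0^A:A\to A\boxtimes\Delta[1])\in\mathrm{E}$ for each object $A$ of $\mathcal{D}$. A simplicial descent category is a relative category closed by finite coproducts endowed with a simplicial descent structure. The functors on localizations in the claim are those induced by $\mathbf{s}$ and $c$. *)

theory Defs
  imports Main "HOL-Library.FuncSet"
begin

section \<open>Categories, functors and natural transformations\<close>

record ('o, 'a) cat =
  Obj :: "'o set"
  Arr :: "'a set"
  Dom :: "'a \<Rightarrow> 'o"
  Cod :: "'a \<Rightarrow> 'o"
  Ident :: "'o \<Rightarrow> 'a"
  Cmp :: "'a \<Rightarrow> 'a \<Rightarrow> 'a"  (* Cmp C g f is g after f *)

definition hom :: "('o, 'a) cat \<Rightarrow> 'o \<Rightarrow> 'o \<Rightarrow> 'a set" where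
  "hom C x y = {f \<in> Arr C. Dom C f = x \<and> Cod C f = y}"

locale category =
  fixes C :: "('o, 'a) cat"
  assumes dom_obj: "f \<in> Arr C \<Longrightarrow> Dom C f \<in> Obj C"
    and cod_obj: "f \<in> Arr C \<Longrightarrow> Cod C f \<in> Obj C"
    and ident_hom: "x \<in> Obj C \<Longrightarrow> Ident C x \<in> hom C x x"
    and cmp_hom: "f \<in> hom C x y \<Longrightarrow> g \<in> hom C y z \<Longrightarrow> Cmp C g f \<in> hom C x z"
    and cmp_assoc: "f \<in> hom C w x \<Longrightarrow> g \<in> hom C x y \<Longrightarrow> h \<in> hom C y z \<Longrightarrow>
          Cmp C h (Cmp C g f) = Cmp C (Cmp C h g) f"
    and ident_left: "f \<in> hom C x y \<Longrightarrow> Cmp C (Ident C y) f = f"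
    and ident_right: "f \<in> hom C x y \<Longrightarrow> Cmp C f (Ident C x) = f"

definition is_iso :: "('o, 'a) cat \<Rightarrow> 'a \<Rightarrow> bool" where
  "is_iso C f \<longleftrightarrow> f \<in> Arr C \<and>
     (\<exists>g \<in> hom C (Cod C f) (Dom C f).
        Cmp C g f = Ident C (Dom C f) \<and> Cmp C f g = Ident C (Cod C f))"

definition isomorphic :: "('o, 'a) cat \<Rightarrow> 'o \<Rightarrow> 'o \<Rightarrow> bool" where
  "isomorphic C x y \<longleftrightarrow> (\<exists>f \<in> hom C x y. is_iso C f)"

definition op_cat :: "('o, 'a) cat \<Rightarrow> ('o, 'a) cat" where
  "op_cat C = \<lparr>Obj = Obj C, Arr = Arr C, Dom = Cod C, Cod = Dom C,
     Ident = Ident C, Cmp = (\<lambda>g f. Cmp C f g)\<rparr>"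

record ('o, 'a, 'p, 'b) fctr =
  fob :: "'o \<Rightarrow> 'p"
  far :: "'a \<Rightarrow> 'b"

text \<open>Functors are required to be undefined off the source category (as are the components of
  natural transformations below), so that HOL equality of functors is equality of functors.\<close>

definition is_functor :: "('o, 'a) cat \<Rightarrow> ('p, 'b) cat \<Rightarrow> ('o, 'a, 'p, 'b) fctr \<Rightarrow> bool" where
  "is_functor C D F \<longleftrightarrow>
     fob F \<in> extensional (Obj C) \<and> far F \<in> extensional (Arr C) \<and>
     (\<forall>x \<in> Obj C. fob F x \<in> Obj D) \<and>
     (\<forall>f \<in> Arr C. far F f \<in> hom D (fob F (Dom C f)) (fob F (Cod C f))) \<and>
     (\<forall>x \<in> Obj C. far F (Ident C x) = Ident D (fob F x)) \<and>
     (\<forall>f \<in> Arr C. \<forall>g \<in> Arr C. Cod C f = Dom C g \<longrightarrow>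
        far F (Cmp C g f) = Cmp D (far F g) (far F f))"

definition id_fun :: "('o, 'a) cat \<Rightarrow> ('o, 'a, 'o, 'a) fctr" where
  "id_fun C = \<lparr>fob = (\<lambda>x \<in> Obj C. x), far = (\<lambda>f \<in> Arr C. f)\<rparr>"

text \<open>The first argument of \<open>comp_fun B G F\<close> is the source category of \<open>F\<close>; similarly for the
  whiskering operations.\<close>

definition comp_fun ::
  "('o, 'a) cat \<Rightarrow> ('p, 'b, 'q, 'c) fctr \<Rightarrow> ('o, 'a, 'p, 'b) fctr \<Rightarrow> ('o, 'a, 'q, 'c) fctr" where
  "comp_fun B G F = \<lparr>fob = (\<lambda>x \<in> Obj B. fob G (fob F x)), far = (\<lambda>f \<in> Arr B. far G (far F f))\<rparr>"

record ('o, 'a, 'p, 'b) ntrans =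
  nsrc :: "('o, 'a, 'p, 'b) fctr"
  ntgt :: "('o, 'a, 'p, 'b) fctr"
  ncomp :: "'o \<Rightarrow> 'b"

definition is_ntrans :: "('o, 'a) cat \<Rightarrow> ('p, 'b) cat \<Rightarrow> ('o, 'a, 'p, 'b) ntrans \<Rightarrow> bool" where
  "is_ntrans C D \<alpha> \<longleftrightarrow>
     is_functor C D (nsrc \<alpha>) \<and> is_functor C D (ntgt \<alpha>) \<and> ncomp \<alpha> \<in> extensional (Obj C) \<and>
     (\<forall>x \<in> Obj C. ncomp \<alpha> x \<in> hom D (fob (nsrc \<alpha>) x) (fob (ntgt \<alpha>) x)) \<and>
     (\<forall>f \<in> Arr C. Cmp D (ncomp \<alpha> (Cod C f)) (far (nsrc \<alpha>) f) =
                   Cmp D (far (ntgt \<alpha>) f) (ncomp \<alpha> (Dom C f)))"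

definition Fun :: "('o, 'a) cat \<Rightarrow> ('p, 'b) cat \<Rightarrow>
    (('o, 'a, 'p, 'b) fctr, ('o, 'a, 'p, 'b) ntrans) cat" where
  "Fun C D = \<lparr>Obj = {F. is_functor C D F}, Arr = {\<alpha>. is_ntrans C D \<alpha>}, Dom = nsrc, Cod = ntgt,
     Ident = (\<lambda>F. \<lparr>nsrc = F, ntgt = F, ncomp = (\<lambda>x \<in> Obj C. Ident D (fob F x))\<rparr>),
     Cmp = (\<lambda>\<beta> \<alpha>. \<lparr>nsrc = nsrc \<alpha>, ntgt = ntgt \<beta>,
                    ncomp = (\<lambda>x \<in> Obj C. Cmp D (ncomp \<beta> x) (ncomp \<alpha> x))\<rparr>)\<rparr>"

definition whisker_left ::  (* K \<circ> \<alpha>, for \<alpha> between functors out of C *)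
  "('o, 'a) cat \<Rightarrow> ('p, 'b, 'q, 'c) fctr \<Rightarrow> ('o, 'a, 'p, 'b) ntrans \<Rightarrow> ('o, 'a, 'q, 'c) ntrans" where
  "whisker_left C K \<alpha> = \<lparr>nsrc = comp_fun C K (nsrc \<alpha>), ntgt = comp_fun C K (ntgt \<alpha>),
     ncomp = (\<lambda>x \<in> Obj C. far K (ncomp \<alpha> x))\<rparr>"

definition whisker_right ::  (* \<alpha> \<circ> H, for a functor H out of B *)
  "('o, 'a) cat \<Rightarrow> ('p, 'b, 'q, 'c) ntrans \<Rightarrow> ('o, 'a, 'p, 'b) fctr \<Rightarrow> ('o, 'a, 'q, 'c) ntrans" where
  "whisker_right B \<alpha> H = \<lparr>nsrc = comp_fun B (nsrc \<alpha>) H, ntgt = comp_fun B (ntgt \<alpha>) H,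
     ncomp = (\<lambda>x \<in> Obj B. ncomp \<alpha> (fob H x))\<rparr>"

definition const_fun :: "('j, 'k) cat \<Rightarrow> ('o, 'a) cat \<Rightarrow>
    ('o, 'a, ('j, 'k, 'o, 'a) fctr, ('j, 'k, 'o, 'a) ntrans) fctr" where
  "const_fun J D =
     (let c = (\<lambda>A. \<lparr>fob = (\<lambda>i \<in> Obj J. A), far = (\<lambda>k \<in> Arr J. Ident D A)\<rparr>)
      in \<lparr>fob = (\<lambda>A \<in> Obj D. c A),
          far = (\<lambda>f \<in> Arr D. \<lparr>nsrc = c (Dom D f), ntgt = c (Cod D f), ncomp = (\<lambda>i \<in> Obj J. f)\<rparr>)\<rparr>)"

text \<open>Postcomposition with \<open>F : C \<rightarrow> D\<close>, as a functor \<open>Fun J C \<rightarrow> Fun J D\<close>, and its action on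
  natural transformations.\<close>

definition post_fun :: "('j, 'k) cat \<Rightarrow> ('o, 'a) cat \<Rightarrow> ('o, 'a, 'p, 'b) fctr \<Rightarrow>
    (('j, 'k, 'o, 'a) fctr, ('j, 'k, 'o, 'a) ntrans,
     ('j, 'k, 'p, 'b) fctr, ('j, 'k, 'p, 'b) ntrans) fctr" where
  "post_fun J C F = \<lparr>fob = (\<lambda>X \<in> Obj (Fun J C). comp_fun J F X),
                     far = (\<lambda>\<xi> \<in> Arr (Fun J C). whisker_left J F \<xi>)\<rparr>"

definition post_ntrans :: "('j, 'k) cat \<Rightarrow> ('o, 'a) cat \<Rightarrow> ('o, 'a, 'p, 'b) ntrans \<Rightarrow>
    (('j, 'k, 'o, 'a) fctr, ('j, 'k, 'o, 'a) ntrans,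
     ('j, 'k, 'p, 'b) fctr, ('j, 'k, 'p, 'b) ntrans) ntrans" where
  "post_ntrans J C \<alpha> = \<lparr>nsrc = post_fun J C (nsrc \<alpha>), ntgt = post_fun J C (ntgt \<alpha>),
     ncomp = (\<lambda>X \<in> Obj (Fun J C). whisker_right J \<alpha> X)\<rparr>"

definition left_adjoint :: "('o, 'a) cat \<Rightarrow> ('p, 'b) cat \<Rightarrow>
    ('o, 'a, 'p, 'b) fctr \<Rightarrow> ('p, 'b, 'o, 'a) fctr \<Rightarrow> bool" where
  "left_adjoint C D F G \<longleftrightarrow> is_functor C D F \<and> is_functor D C G \<and>
     (\<exists>\<eta> \<in> hom (Fun C C) (id_fun C) (comp_fun C G F).
      \<exists>\<epsilon> \<in> hom (Fun D D) (comp_fun D F G) (id_fun D).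
        (\<forall>x \<in> Obj C. Cmp D (ncomp \<epsilon> (fob F x)) (far F (ncomp \<eta> x)) = Ident D (fob F x)) \<and>
        (\<forall>y \<in> Obj D. Cmp C (far G (ncomp \<epsilon> y)) (ncomp \<eta> (fob G y)) = Ident C (fob G y)))"

definition is_equivalence :: "('o, 'a) cat \<Rightarrow> ('p, 'b) cat \<Rightarrow> ('o, 'a, 'p, 'b) fctr \<Rightarrow> bool" where
  "is_equivalence C D F \<longleftrightarrow> is_functor C D F \<and>
     (\<exists>G. is_functor D C G \<and>
          isomorphic (Fun C C) (comp_fun C G F) (id_fun C) \<and>
          isomorphic (Fun D D) (comp_fun D F G) (id_fun D))"


section \<open>Coproducts\<close>

definition is_coproduct :: "('o, 'a) cat \<Rightarrow> 'i set \<Rightarrow> ('i \<Rightarrow> 'o) \<Rightarrow> 'o \<Rightarrow> ('i \<Rightarrow> 'a) \<Rightarrow> bool" where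
  "is_coproduct C I A P inc \<longleftrightarrow> P \<in> Obj C \<and> (\<forall>i \<in> I. A i \<in> Obj C \<and> inc i \<in> hom C (A i) P) \<and>
     (\<forall>Q f. Q \<in> Obj C \<and> (\<forall>i \<in> I. f i \<in> hom C (A i) Q) \<longrightarrow>
        (\<exists>!u. u \<in> hom C P Q \<and> (\<forall>i \<in> I. Cmp C u (inc i) = f i)))"

text \<open>Index sets in \<open>nat\<close> represent all finite index sets; \<open>I = {}\<close> gives an initial object.\<close>

definition has_finite_coproducts :: "('o, 'a) cat \<Rightarrow> bool" where
  "has_finite_coproducts C \<longleftrightarrow>
     (\<forall>(I :: nat set) A. finite I \<and> A ` I \<subseteq> Obj C \<longrightarrow> (\<exists>P inc. is_coproduct C I A P inc))"

definition is_coproduct2 :: "('o, 'a) cat \<Rightarrow> 'o \<Rightarrow> 'o \<Rightarrow> 'o \<Rightarrow> 'a \<Rightarrow> 'a \<Rightarrow> bool" where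
  "is_coproduct2 C A B P i j \<longleftrightarrow> is_coproduct C UNIV (case_bool A B) P (case_bool i j)"


section \<open>Localization and relative categories\<close>

text \<open>The localization \<open>C[W\<^sup>-\<^sup>1]\<close> is constructed in the usual way: arrows are zigzags of arrows of
  \<open>C\<close>, traversed from left to right, whose backward arrows lie in \<open>W\<close>, modulo the congruence
  \<open>zz_eq\<close> generated by composition and identities of \<open>C\<close> and by the inverses of \<open>W\<close>.\<close>

datatype 'a step = Fwd 'a | Bwd 'a

fun zigzag :: "('o, 'a) cat \<Rightarrow> 'a set \<Rightarrow> 'o \<Rightarrow> 'a step list \<Rightarrow> 'o \<Rightarrow> bool" where
  "zigzag C W x [] y \<longleftrightarrow> x \<in> Obj C \<and> x = y"
| "zigzag C W x (Fwd f # p) y \<longleftrightarrow> f \<in> Arr C \<and> Dom C f = x \<and> zigzag C W (Cod C f) p y"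
| "zigzag C W x (Bwd w # p) y \<longleftrightarrow> w \<in> Arr C \<inter> W \<and> Cod C w = x \<and> zigzag C W (Dom C w) p y"

inductive zz_eq :: "('o, 'a) cat \<Rightarrow> 'a set \<Rightarrow> 'o \<Rightarrow> 'o \<Rightarrow> 'a step list \<Rightarrow> 'a step list \<Rightarrow> bool"
  for C W where
  refl: "zigzag C W x p y \<Longrightarrow> zz_eq C W x y p p"
| sym: "zz_eq C W x y p q \<Longrightarrow> zz_eq C W x y q p"
| trans: "zz_eq C W x y p q \<Longrightarrow> zz_eq C W x y q r \<Longrightarrow> zz_eq C W x y p r"
| append: "zz_eq C W x y p p' \<Longrightarrow> zz_eq C W y z q q' \<Longrightarrow> zz_eq C W x z (p @ q) (p' @ q')"
| cmp: "f \<in> hom C x y \<Longrightarrow> g \<in> hom C y z \<Longrightarrow> zz_eq C W x z [Fwd f, Fwd g] [Fwd (Cmp C g f)]"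
| ident: "x \<in> Obj C \<Longrightarrow> zz_eq C W x x [Fwd (Ident C x)] []"
| inv_right: "w \<in> hom C x y \<inter> W \<Longrightarrow> zz_eq C W x x [Fwd w, Bwd w] []"
| inv_left: "w \<in> hom C x y \<inter> W \<Longrightarrow> zz_eq C W y y [Bwd w, Fwd w] []"

type_synonym ('o, 'a) loc_arr = "'o \<times> 'a step list set \<times> 'o"

definition loc_class :: "('o, 'a) cat \<Rightarrow> 'a set \<Rightarrow> 'o \<Rightarrow> 'a step list \<Rightarrow> 'o \<Rightarrow> ('o, 'a) loc_arr" where
  "loc_class C W x p y = (x, {q. zz_eq C W x y p q}, y)"

definition Loc :: "('o, 'a) cat \<Rightarrow> 'a set \<Rightarrow> ('o, ('o, 'a) loc_arr) cat" where
  "Loc C W = \<lparr>Obj = Obj C, Arr = {loc_class C W x p y | x p y. zigzag C W x p y},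
     Dom = (\<lambda>(x, P, y). x), Cod = (\<lambda>(x, P, y). y),
     Ident = (\<lambda>x. loc_class C W x [] x),
     Cmp = (\<lambda>(y', Q, z) (x, P, y). (x, {r. \<exists>p \<in> P. \<exists>q \<in> Q. zz_eq C W x z (p @ q) r}, z))\<rparr>"

text \<open>The functor \<open>C[W\<^sup>-\<^sup>1] \<rightarrow> D[E\<^sup>-\<^sup>1]\<close> induced by a functor \<open>F : C \<rightarrow> D\<close> with \<open>F(W) \<subseteq> E\<close>.\<close>

definition Loc_fun :: "('o, 'a) cat \<Rightarrow> 'a set \<Rightarrow> ('p, 'b) cat \<Rightarrow> 'b set \<Rightarrow> ('o, 'a, 'p, 'b) fctr \<Rightarrow>
    ('o, ('o, 'a) loc_arr, 'p, ('p, 'b) loc_arr) fctr" where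
  "Loc_fun C W D E F = \<lparr>fob = (\<lambda>x \<in> Obj C. fob F x),
     far = (\<lambda>(x, P, y) \<in> Arr (Loc C W).
       (fob F x, {q. \<exists>p \<in> P. zz_eq D E (fob F x) (fob F y) (map (map_step (far F)) p) q}, fob F y))\<rparr>"

definition saturated :: "('o, 'a) cat \<Rightarrow> 'a set \<Rightarrow> bool" where
  "saturated C W \<longleftrightarrow>
     W = {f \<in> Arr C. is_iso (Loc C W) (loc_class C W (Dom C f) [Fwd f] (Cod C f))}"

definition relative_category :: "('o, 'a) cat \<Rightarrow> 'a set \<Rightarrow> bool" where
  "relative_category C W \<longleftrightarrow> category C \<and> saturated C W"

text \<open>Coproducts are not chosen: \<open>f \<squnion> g \<in> E\<close> is required with respect to all coproduct cocones.\<close>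

definition closed_by_finite_coproducts :: "('o, 'a) cat \<Rightarrow> 'a set \<Rightarrow> bool" where
  "closed_by_finite_coproducts D E \<longleftrightarrow> has_finite_coproducts D \<and>
     (\<forall>f g P i j Q i' j' u. f \<in> E \<and> g \<in> E \<and>
        is_coproduct2 D (Dom D f) (Dom D g) P i j \<and> is_coproduct2 D (Cod D f) (Cod D g) Q i' j' \<and>
        u \<in> hom D P Q \<and> Cmp D u i = Cmp D i' f \<and> Cmp D u j = Cmp D j' g \<longrightarrow> u \<in> E)"

definition nat_weqs :: "('o, 'a) cat \<Rightarrow> ('p, 'b) cat \<Rightarrow> 'b set \<Rightarrow> ('o, 'a, 'p, 'b) ntrans set" where
  "nat_weqs C D E = {\<alpha> \<in> Arr (Fun C D). \<forall>x \<in> Obj C. ncomp \<alpha> x \<in> E}"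

definition weq_zigzag :: "('o, 'a) cat \<Rightarrow> ('p, 'b) cat \<Rightarrow> 'b set \<Rightarrow> ('o, 'a, 'p, 'b) fctr \<Rightarrow>
    ('o, 'a, 'p, 'b) ntrans step list \<Rightarrow> ('o, 'a, 'p, 'b) fctr \<Rightarrow> bool" where
  "weq_zigzag C D E F p G \<longleftrightarrow> zigzag (Fun C D) (nat_weqs C D E) F p G \<and>
     (\<forall>t \<in> set p. set_step t \<subseteq> nat_weqs C D E)"

definition homotopical_equivalence :: "('o, 'a) cat \<Rightarrow> 'a set \<Rightarrow> ('p, 'b) cat \<Rightarrow> 'b set \<Rightarrow>
    ('o, 'a, 'p, 'b) fctr \<Rightarrow> ('p, 'b, 'o, 'a) fctr \<Rightarrow> bool" where
  "homotopical_equivalence C W D E F G \<longleftrightarrow>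
     relative_category C W \<and> relative_category D E \<and>
     is_functor C D F \<and> is_functor D C G \<and> far F ` W \<subseteq> E \<and> far G ` E \<subseteq> W \<and>
     (\<exists>p. weq_zigzag D D E (comp_fun D F G) p (id_fun D)) \<and>
     (\<exists>q. weq_zigzag C C W (comp_fun C G F) q (id_fun C))"


section \<open>Simplicial objects\<close>

text \<open>The object \<open>n\<close> is \<open>[n] = {0,\<dots>,n}\<close>; the arrow \<open>(m, n, f)\<close> is \<open>f : [m] \<rightarrow> [n]\<close>.\<close>

type_synonym delta_arr = "nat \<times> nat \<times> (nat \<Rightarrow> nat)"

definition Delta :: "(nat, delta_arr) cat" where
  "Delta = \<lparr>Obj = UNIV,
     Arr = {(m, n, f). f \<in> {0..m} \<rightarrow>\<^sub>E {0..n} \<and> mono_on {0..m} f},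
     Dom = (\<lambda>(m, n, f). m), Cod = (\<lambda>(m, n, f). n),
     Ident = (\<lambda>n. (n, n, \<lambda>i \<in> {0..n}. i)),
     Cmp = (\<lambda>(m', n, g) (l, m, f). (l, n, \<lambda>i \<in> {0..l}. g (f i)))\<rparr>"

type_synonym ('o, 'a) sobj = "(nat, delta_arr, 'o, 'a) fctr"
type_synonym ('o, 'a) sarr = "(nat, delta_arr, 'o, 'a) ntrans"

abbreviation Simp :: "('o, 'a) cat \<Rightarrow> (('o, 'a) sobj, ('o, 'a) sarr) cat" where
  "Simp D \<equiv> Fun (op_cat Delta) D"

abbreviation const_simp :: "('o, 'a) cat \<Rightarrow> ('o, 'a, ('o, 'a) sobj, ('o, 'a) sarr) fctr" where
  "const_simp D \<equiv> const_fun (op_cat Delta) D"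

abbreviation post_simp :: "('o, 'a) cat \<Rightarrow> ('o, 'a, 'p, 'b) fctr \<Rightarrow>
    (('o, 'a) sobj, ('o, 'a) sarr, ('p, 'b) sobj, ('p, 'b) sarr) fctr" where
  "post_simp C F \<equiv> post_fun (op_cat Delta) C F"

text \<open>A bisimplicial object is a simplicial object \<open>Z\<close> in \<open>Simp D\<close>, with \<open>Z\<^sub>n\<^sub>,\<^sub>m = (Z\<^sub>n)\<^sub>m\<close>. Thus the
  functors \<open>X \<mapsto> X \<times> \<Delta>\<close> and \<open>X \<mapsto> \<Delta> \<times> X\<close> (with \<open>(X \<times> \<Delta>)\<^sub>n\<^sub>,\<^sub>m = X\<^sub>n\<close> and \<open>(\<Delta> \<times> X)\<^sub>n\<^sub>,\<^sub>m = X\<^sub>m\<close>) are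
  levelwise \<open>c\<close> and the functor \<open>c\<close> of \<open>Simp D\<close>, and \<open>s s\<close> is \<open>s\<close> after levelwise \<open>s\<close>.\<close>

abbreviation times_Delta :: "('o, 'a) cat \<Rightarrow> (('o, 'a) sobj, ('o, 'a) sarr,
    (('o, 'a) sobj, ('o, 'a) sarr) sobj, (('o, 'a) sobj, ('o, 'a) sarr) sarr) fctr" where
  "times_Delta D \<equiv> post_simp D (const_simp D)"

abbreviation Delta_times :: "('o, 'a) cat \<Rightarrow> (('o, 'a) sobj, ('o, 'a) sarr,
    (('o, 'a) sobj, ('o, 'a) sarr) sobj, (('o, 'a) sobj, ('o, 'a) sarr) sarr) fctr" where
  "Delta_times D \<equiv> const_simp (Simp D)"

definition diag_obj :: "('o, 'a) cat \<Rightarrow> (('o, 'a) sobj, ('o, 'a) sarr) sobj \<Rightarrow> ('o, 'a) sobj" where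
  "diag_obj D Z = \<lparr>fob = (\<lambda>n. fob (fob Z n) n),
     far = (\<lambda>\<theta> \<in> Arr Delta. Cmp D (ncomp (far Z \<theta>) (Dom Delta \<theta>)) (far (fob Z (Cod Delta \<theta>)) \<theta>))\<rparr>"

definition diag :: "('o, 'a) cat \<Rightarrow> ((('o, 'a) sobj, ('o, 'a) sarr) sobj,
    (('o, 'a) sobj, ('o, 'a) sarr) sarr, ('o, 'a) sobj, ('o, 'a) sarr) fctr" where
  "diag D = \<lparr>fob = (\<lambda>Z \<in> Obj (Simp (Simp D)). diag_obj D Z),
     far = (\<lambda>\<phi> \<in> Arr (Simp (Simp D)). \<lparr>nsrc = diag_obj D (nsrc \<phi>), ntgt = diag_obj D (ntgt \<phi>),
              ncomp = (\<lambda>n. ncomp (ncomp \<phi> n) n)\<rparr>)\<rparr>"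

definition double_simple :: "('o, 'a) cat \<Rightarrow> (('o, 'a) sobj, ('o, 'a) sarr, 'o, 'a) fctr \<Rightarrow>
    ((('o, 'a) sobj, ('o, 'a) sarr) sobj, (('o, 'a) sobj, ('o, 'a) sarr) sarr, 'o, 'a) fctr" where
  "double_simple D s = comp_fun (Simp (Simp D)) s (post_simp (Simp D) s)"

text \<open>A simplicial set is given by its sets of simplices and the action of the arrows of
  \<open>\<Delta>\<close>. The predicate \<open>is_tensor D X K T inc\<close> says that \<open>T\<close> is \<open>X \<boxtimes> K\<close>: the \<open>inc n k\<close> exhibit \<open>T\<^sub>n\<close>
  as the coproduct of copies of \<open>X\<^sub>n\<close> over \<open>k \<in> K\<^sub>n\<close>, and \<open>\<theta> : [m] \<rightarrow> [n]\<close> sends the summand of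
  \<open>k \<in> K\<^sub>n\<close> to that of \<open>\<theta>\<^sup>*k \<in> K\<^sub>m\<close> by \<open>X(\<theta>)\<close>.\<close>

type_synonym 'k sset = "(nat, delta_arr, 'k set, 'k \<Rightarrow> 'k) fctr"

definition std_simplex :: "nat \<Rightarrow> delta_arr sset" where
  "std_simplex p = \<lparr>fob = (\<lambda>n. hom Delta n p), far = (\<lambda>\<theta> k. Cmp Delta k \<theta>)\<rparr>"

definition is_tensor :: "('o, 'a) cat \<Rightarrow> ('o, 'a) sobj \<Rightarrow> 'k sset \<Rightarrow> ('o, 'a) sobj \<Rightarrow>
    (nat \<Rightarrow> 'k \<Rightarrow> 'a) \<Rightarrow> bool" where
  "is_tensor D X K T inc \<longleftrightarrow> X \<in> Obj (Simp D) \<and> T \<in> Obj (Simp D) \<and>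
     (\<forall>n. is_coproduct D (fob K n) (\<lambda>_. fob X n) (fob T n) (inc n)) \<and>
     (\<forall>m n \<theta> k. \<theta> \<in> hom Delta m n \<and> k \<in> fob K n \<longrightarrow>
        Cmp D (far T \<theta>) (inc n k) = Cmp D (inc m (far K \<theta> k)) (far X \<theta>))"

text \<open>The map \<open>d\<^sub>0\<^sup>X : X = X \<boxtimes> \<Delta>[0] \<rightarrow> X \<boxtimes> \<Delta>[1]\<close> induced by the coface \<open>d\<^sup>0 : [0] \<rightarrow> [1]\<close>, \<open>0 \<mapsto> 1\<close>: in
  degree \<open>n\<close> it is the inclusion of the summand indexed by \<open>[n] \<rightarrow> [0] \<rightarrow> [1]\<close>.\<close>

definition coface0 :: delta_arr where
  "coface0 = (0, 1, \<lambda>i \<in> {0..0}. 1)"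

definition face_map :: "('o, 'a) sobj \<Rightarrow> ('o, 'a) sobj \<Rightarrow> (nat \<Rightarrow> delta_arr \<Rightarrow> 'a) \<Rightarrow> ('o, 'a) sarr" where
  "face_map X T inc = \<lparr>nsrc = X, ntgt = T,
     ncomp = (\<lambda>n. inc n (Cmp Delta coface0 (n, 0, \<lambda>i \<in> {0..n}. 0)))\<rparr>"


section \<open>Simplicial descent categories\<close>

abbreviation Simp_weqs :: "('o, 'a) cat \<Rightarrow> 'a set \<Rightarrow> ('o, 'a) sarr set" where
  "Simp_weqs D E \<equiv> nat_weqs (op_cat Delta) D E"

text \<open>Again coproducts and tensors are not chosen, and the axioms involving them are stated for all
  of them. The two equations in \<open>S3\<close> are the two composites of \<open>\<mu>\<close> and \<open>\<lambda>\<close>, as arrows of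
  \<open>Fun (Simp D) D\<close> localized at the objectwise weak equivalences.\<close>

locale simplicial_descent =
  fixes D :: "('o, 'a) cat"
    and E :: "'a set"
    and s :: "(('o, 'a) sobj, ('o, 'a) sarr, 'o, 'a) fctr"
    and mu :: "((('o, 'a) sobj, ('o, 'a) sarr) sobj, (('o, 'a) sobj, ('o, 'a) sarr) sarr,
                'o, 'a) ntrans step list"
    and lam :: "('o, 'a, 'o, 'a) ntrans step list"
  assumes relative: "relative_category D E"
    and closed: "closed_by_finite_coproducts D E"
    and S1_functor: "is_functor (Simp D) D s"
    and S1_coproduct: "is_coproduct2 (Simp D) X Y P i j \<Longrightarrow>
          is_coproduct2 D (fob s X) (fob s Y) Q i' j' \<Longrightarrow> u \<in> hom D Q (fob s P) \<Longrightarrow>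
          Cmp D u i' = far s i \<Longrightarrow> Cmp D u j' = far s j \<Longrightarrow> u \<in> E"
    and S2: "weq_zigzag (Simp (Simp D)) D E
          (comp_fun (Simp (Simp D)) s (diag D)) mu (double_simple D s)"
    and S3: "weq_zigzag D D E (comp_fun D s (const_simp D)) lam (id_fun D)"
    and S3_left: "loc_class (Fun (Simp D) D) (nat_weqs (Simp D) D E) s
          (map (map_step (\<lambda>\<alpha>. whisker_right (Simp D) \<alpha> (Delta_times D))) mu @
           map (map_step (\<lambda>\<alpha>. whisker_right (Simp D) \<alpha> s)) lam) s =
        Ident (Loc (Fun (Simp D) D) (nat_weqs (Simp D) D E)) s"
    and S3_right: "loc_class (Fun (Simp D) D) (nat_weqs (Simp D) D E) s
          (map (map_step (\<lambda>\<alpha>. whisker_right (Simp D) \<alpha> (times_Delta D))) mu @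
           map (map_step (\<lambda>\<alpha>. whisker_left (Simp D) s (post_ntrans (op_cat Delta) D \<alpha>))) lam) s =
        Ident (Loc (Fun (Simp D) D) (nat_weqs (Simp D) D E)) s"
    and S4: "f \<in> Simp_weqs D E \<Longrightarrow> far s f \<in> E"
    and S5: "A \<in> Obj D \<Longrightarrow> is_tensor D (fob (const_simp D) A) (std_simplex 1) T inc \<Longrightarrow>
          far s (face_map (fob (const_simp D) A) T inc) \<in> E"

definition simple_weqs :: "('o, 'a) cat \<Rightarrow> 'a set \<Rightarrow>
    (('o, 'a) sobj, ('o, 'a) sarr, 'o, 'a) fctr \<Rightarrow> ('o, 'a) sarr set" where
  "simple_weqs D E s = {f \<in> Arr (Simp D). far s f \<in> E}"

end

theory Submission
  imports Defs
begin

text \<open>Write \<open>W\<close> for the levelwise weak equivalences and \<open>S\<close> for \<open>s\<^sup>-\<^sup>1 E\<close>. The zigzag \<open>\<lambda>\<close> makes \<open>s c\<close>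
  naturally isomorphic to the identity of \<open>D[E\<^sup>-\<^sup>1]\<close>, so the matter is the unit \<open>X \<rightarrow> c s X\<close>. It comes
  from the join of ordinals: the bisimplicial object \<open>Z\<^sub>n\<^sub>,\<^sub>m = X\<^sub>n\<^sub>+\<^sub>m\<^sub>+\<^sub>1\<close> (here \<open>joinL.bisimp\<close>) projects
  to \<open>X \<times> \<Delta>\<close> and to \<open>\<Delta> \<times> X\<close>, by restriction to the two summands of \<open>[n + m + 1]\<close>. Applying \<open>s\<close> in
  each degree \<open>n\<close> gives the span \<open>(n \<mapsto> s c (X\<^sub>n)) \<leftarrow> (n \<mapsto> s(Z\<^sub>n)) \<rightarrow> c s X\<close>, whose left end is linked
  to \<open>X\<close> by \<open>\<lambda>\<close>; the resulting zigzag from \<open>X\<close> to \<open>c s X\<close> is \<open>unit_zz\<close>.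

  The arrow to the left lies in \<open>W\<close> (\<open>pr1_weq\<close>): in each row, \<open>m \<mapsto> X\<^sub>n\<^sub>+\<^sub>m\<^sub>+\<^sub>1\<close> retracts onto the constant
  object \<open>X\<^sub>n\<close> by a simplicial homotopy equivalence, and \<open>s\<close> sends such maps to \<open>E\<close>
  (\<open>homotopy_equiv_weq\<close>). For the latter, \<open>V \<boxtimes> \<Delta>[1]\<close> is the diagonal of \<open>n \<mapsto> V\<^sub>n \<boxtimes> \<Delta>[1]\<close>, so
  \<open>\<mu>\<close> reduces the end inclusion \<open>V \<rightarrow> V \<boxtimes> \<Delta>[1]\<close> to the case of the objects \<open>V\<^sub>n\<close>, which is an axiom;
  both ends are sections of the projection, hence agree after \<open>s\<close> in \<open>D[E\<^sup>-\<^sup>1]\<close>.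

  The arrow to the right lies in \<open>S\<close> (\<open>pr2_weq\<close>): by \<open>\<mu>\<close> this concerns only the map of diagonals, and
  that map is unchanged when the two simplicial directions are exchanged, which turns the second
  projection into one with contractible rows. When \<open>X\<close> is constant this arrow even lies in \<open>W\<close>. So
  \<open>\<eta> : 1 \<rightarrow> c s\<close> is a natural map with \<open>s \<eta>\<close> and \<open>\<eta> c\<close> invertible, and \<open>s c\<close> is isomorphic to the
  identity. These facts alone give an adjunction (\<open>left_adjointI_iso\<close>), after composing \<open>\<eta>\<close> with an
  automorphism. Read in \<open>(\<Delta>\<^sup>o\<^sup>pD, S)\<close>, all steps of the zigzag are weak equivalences, which gives the
  homotopical equivalence; natural transformations induced by zigzags (\<open>loc_nt\<close>) turn it into the
  equivalence of the localizations.\<close>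

section \<open>Homs, functors and natural transformations\<close>

lemma homI: "f \<in> Arr C \<Longrightarrow> Dom C f = x \<Longrightarrow> Cod C f = y \<Longrightarrow> f \<in> hom C x y"
  by (simp add: hom_def)

lemma hom_Arr: "f \<in> hom C x y \<Longrightarrow> f \<in> Arr C"
  and hom_Dom: "f \<in> hom C x y \<Longrightarrow> Dom C f = x"
  and hom_Cod: "f \<in> hom C x y \<Longrightarrow> Cod C f = y"
  by (simp_all add: hom_def)

lemma Arr_hom: "f \<in> Arr C \<Longrightarrow> f \<in> hom C (Dom C f) (Cod C f)"
  by (simp add: hom_def)

lemma (in category) hom_obj: "f \<in> hom C x y \<Longrightarrow> x \<in> Obj C \<and> y \<in> Obj C"
  using dom_obj cod_obj by (auto simp: hom_def)

lemmas cat_hom_obj = category.hom_obj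
lemmas cat_cmp = category.cmp_hom
lemmas cat_id = category.ident_hom
lemmas cat_assoc = category.cmp_assoc
lemmas cat_idl = category.ident_left
lemmas cat_idr = category.ident_right

lemma op_cat_simps [simp]:
  "Obj (op_cat C) = Obj C" "Arr (op_cat C) = Arr C" "Dom (op_cat C) = Cod C" "Cod (op_cat C) = Dom C"
  "Ident (op_cat C) = Ident C" "Cmp (op_cat C) g f = Cmp C f g" "hom (op_cat C) x y = hom C y x"
  by (auto simp: op_cat_def hom_def)

lemma category_op: "category C \<Longrightarrow> category (op_cat C)"
  by unfold_locales
    (simp_all add: category.dom_obj category.cod_obj cat_id cat_cmp cat_idl cat_idr cat_assoc[symmetric])

lemma is_functorI:
  assumes "fob F \<in> extensional (Obj C)" "far F \<in> extensional (Arr C)"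
    and "\<And>x. x \<in> Obj C \<Longrightarrow> fob F x \<in> Obj D"
    and "\<And>f x y. f \<in> hom C x y \<Longrightarrow> far F f \<in> hom D (fob F x) (fob F y)"
    and "\<And>x. x \<in> Obj C \<Longrightarrow> far F (Ident C x) = Ident D (fob F x)"
    and "\<And>f g x y z. f \<in> hom C x y \<Longrightarrow> g \<in> hom C y z \<Longrightarrow> far F (Cmp C g f) = Cmp D (far F g) (far F f)"
  shows "is_functor C D F"
  using assms unfolding is_functor_def by (fastforce simp: hom_def)

lemma functor_obj: "is_functor C D F \<Longrightarrow> x \<in> Obj C \<Longrightarrow> fob F x \<in> Obj D"
  and functor_hom: "is_functor C D F \<Longrightarrow> f \<in> hom C x y \<Longrightarrow> far F f \<in> hom D (fob F x) (fob F y)"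
  and functor_Arr: "is_functor C D F \<Longrightarrow> f \<in> Arr C \<Longrightarrow> far F f \<in> Arr D"
  and functor_id: "is_functor C D F \<Longrightarrow> x \<in> Obj C \<Longrightarrow> far F (Ident C x) = Ident D (fob F x)"
  and functor_cmp: "is_functor C D F \<Longrightarrow> f \<in> hom C x y \<Longrightarrow> g \<in> hom C y z \<Longrightarrow>
        far F (Cmp C g f) = Cmp D (far F g) (far F f)"
  unfolding is_functor_def by (auto simp: hom_def)

lemma functor_eqI:
  fixes F G :: "('o, 'a, 'p, 'b) fctr"
  assumes "is_functor C D F" "is_functor C D G"
    and "\<And>x. x \<in> Obj C \<Longrightarrow> fob F x = fob G x"
    and "\<And>f x y. f \<in> hom C x y \<Longrightarrow> far F f = far G f"
  shows "F = G"
proof (rule fctr.equality)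
  show "fob F = fob G"
    using assms unfolding is_functor_def by (meson extensionalityI)
  show "far F = far G"
    by (rule extensionalityI[of _ "Arr C"])
      (use assms in \<open>auto simp: is_functor_def hom_def\<close>)
qed simp

lemma id_fun_simps [simp]:
  "x \<in> Obj C \<Longrightarrow> fob (id_fun C) x = x" "f \<in> Arr C \<Longrightarrow> far (id_fun C) f = f"
  by (simp_all add: id_fun_def)

lemma comp_fun_simps [simp]:
  "x \<in> Obj B \<Longrightarrow> fob (comp_fun B G F) x = fob G (fob F x)"
  "f \<in> Arr B \<Longrightarrow> far (comp_fun B G F) f = far G (far F f)"
  by (simp_all add: comp_fun_def)

lemma id_functor: "category C \<Longrightarrow> is_functor C C (id_fun C)"
  by (rule is_functorI)
    (auto simp: id_fun_def hom_def category_def category.ident_hom category.cmp_hom)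

lemma comp_functor:
  assumes "category B" "is_functor B C F" "is_functor C D G"
  shows "is_functor B D (comp_fun B G F)"
proof (rule is_functorI)
  show "fob (comp_fun B G F) \<in> extensional (Obj B)" "far (comp_fun B G F) \<in> extensional (Arr B)"
    by (simp_all add: comp_fun_def)
next
  fix f g x y z assume f: "f \<in> hom B x y" and g: "g \<in> hom B y z"
  note h = cat_cmp[OF assms(1) f g]
  show "far (comp_fun B G F) (Cmp B g f) = Cmp D (far (comp_fun B G F) g) (far (comp_fun B G F) f)"
    using f g h assms(2,3) by (simp add: hom_Arr functor_cmp[OF assms(2) f g]
        functor_cmp[OF assms(3) functor_hom[OF assms(2) f] functor_hom[OF assms(2) g]])
next
  fix x assume x: "x \<in> Obj B"
  show "far (comp_fun B G F) (Ident B x) = Ident D (fob (comp_fun B G F) x)"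
    using x cat_id[OF assms(1) x] assms(2,3) by (simp add: hom_Arr functor_id functor_obj)
next
  fix f x y assume f: "f \<in> hom B x y"
  show "far (comp_fun B G F) f \<in> hom D (fob (comp_fun B G F) x) (fob (comp_fun B G F) y)"
    using f cat_hom_obj[OF assms(1) f] assms(2,3) by (simp add: hom_Arr functor_hom)
qed (use assms in \<open>auto intro: functor_obj\<close>)

subsection \<open>Functor categories\<close>

text \<open>The natural transformation \<open>F \<rightarrow> G\<close> with components \<open>a\<close>, made undefined off the objects of \<open>C\<close>.\<close>

definition mk_nt :: "('o, 'a) cat \<Rightarrow> ('o, 'a, 'p, 'b) fctr \<Rightarrow> ('o, 'a, 'p, 'b) fctr \<Rightarrow> ('o \<Rightarrow> 'b) \<Rightarrow>
    ('o, 'a, 'p, 'b) ntrans" where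
  "mk_nt C F G a = \<lparr>nsrc = F, ntgt = G, ncomp = (\<lambda>x \<in> Obj C. a x)\<rparr>"

lemma mk_nt_simps [simp]:
  "nsrc (mk_nt C F G a) = F" "ntgt (mk_nt C F G a) = G" "x \<in> Obj C \<Longrightarrow> ncomp (mk_nt C F G a) x = a x"
  by (simp_all add: mk_nt_def)

lemma mk_nt_cong: "(\<And>x. x \<in> Obj C \<Longrightarrow> a x = b x) \<Longrightarrow> F = F' \<Longrightarrow> G = G' \<Longrightarrow> mk_nt C F G a = mk_nt C F' G' b"
  by (auto simp: mk_nt_def)

lemma Obj_Fun [simp]: "F \<in> Obj (Fun C D) \<longleftrightarrow> is_functor C D F"
  by (simp add: Fun_def)

lemma Fun_Arr [simp]: "\<alpha> \<in> Arr (Fun C D) \<longleftrightarrow> is_ntrans C D \<alpha>"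
  and Fun_Dom [simp]: "Dom (Fun C D) = nsrc"
  and Fun_Cod [simp]: "Cod (Fun C D) = ntgt"
  by (simp_all add: Fun_def)

lemma Ident_Fun: "Ident (Fun C D) F = mk_nt C F F (\<lambda>x. Ident D (fob F x))"
  and Cmp_Fun: "Cmp (Fun C D) \<beta> \<alpha> = mk_nt C (nsrc \<alpha>) (ntgt \<beta>) (\<lambda>x. Cmp D (ncomp \<beta> x) (ncomp \<alpha> x))"
  by (simp_all add: Fun_def mk_nt_def)

lemma ncomp_Ident [simp]: "x \<in> Obj C \<Longrightarrow> ncomp (Ident (Fun C D) F) x = Ident D (fob F x)"
  and ncomp_Cmp [simp]: "x \<in> Obj C \<Longrightarrow> ncomp (Cmp (Fun C D) \<beta> \<alpha>) x = Cmp D (ncomp \<beta> x) (ncomp \<alpha> x)"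
  by (simp_all add: Ident_Fun Cmp_Fun)

lemma Fun_homD:
  assumes "\<alpha> \<in> hom (Fun C D) F G"
  shows "is_functor C D F" "is_functor C D G" "nsrc \<alpha> = F" "ntgt \<alpha> = G" "is_ntrans C D \<alpha>"
  using assms by (auto simp: hom_def is_ntrans_def)

lemma Fun_hom_comp: "\<alpha> \<in> hom (Fun C D) F G \<Longrightarrow> x \<in> Obj C \<Longrightarrow> ncomp \<alpha> x \<in> hom D (fob F x) (fob G x)"
  by (auto simp: hom_def[of "Fun C D"] is_ntrans_def)

lemma Fun_hom_nat: "\<alpha> \<in> hom (Fun C D) F G \<Longrightarrow> f \<in> hom C x y \<Longrightarrow>
    Cmp D (ncomp \<alpha> y) (far F f) = Cmp D (far G f) (ncomp \<alpha> x)"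
  by (auto simp: hom_def is_ntrans_def)

lemma Fun_hom_eqI:
  fixes \<alpha> \<beta> :: "('o, 'a, 'p, 'b) ntrans"
  assumes "\<alpha> \<in> hom (Fun C D) F G" "\<beta> \<in> hom (Fun C D) F G" "\<And>x. x \<in> Obj C \<Longrightarrow> ncomp \<alpha> x = ncomp \<beta> x"
  shows "\<alpha> = \<beta>"
proof (rule ntrans.equality)
  show "ncomp \<alpha> = ncomp \<beta>"
    by (rule extensionalityI[of _ "Obj C"]) (use assms in \<open>auto simp: hom_def is_ntrans_def\<close>)
qed (use assms in \<open>auto simp: hom_def\<close>)

lemma mk_nt_hom:
  assumes "category C" "is_functor C D F" "is_functor C D G"
    and "\<And>x. x \<in> Obj C \<Longrightarrow> a x \<in> hom D (fob F x) (fob G x)"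
    and "\<And>f x y. f \<in> hom C x y \<Longrightarrow> Cmp D (a y) (far F f) = Cmp D (far G f) (a x)"
  shows "mk_nt C F G a \<in> hom (Fun C D) F G"
proof (rule homI)
  have "is_ntrans C D (mk_nt C F G a)"
    unfolding is_ntrans_def
    using assms(2-4) assms(5)[OF Arr_hom] category.dom_obj[OF assms(1)] category.cod_obj[OF assms(1)]
    by (auto simp: mk_nt_def)
  then show "mk_nt C F G a \<in> Arr (Fun C D)" by simp
qed simp_all

lemma hom_mk_nt:
  assumes "\<alpha> \<in> hom (Fun C D) F G"
  shows "\<alpha> = mk_nt C F G (ncomp \<alpha>)"
  by (rule ntrans.equality)
    (use assms in \<open>auto simp: hom_def is_ntrans_def mk_nt_def intro!: extensionalityI[of _ "Obj C"]\<close>)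

lemma category_Fun:
  assumes C: "category C" and D: "category D"
  shows "category (Fun C D)"
proof
  fix \<alpha> assume "\<alpha> \<in> Arr (Fun C D)"
  then show "Dom (Fun C D) \<alpha> \<in> Obj (Fun C D)" "Cod (Fun C D) \<alpha> \<in> Obj (Fun C D)"
    by (simp_all add: is_ntrans_def)
next
  fix F assume F: "F \<in> Obj (Fun C D)"
  show "Ident (Fun C D) F \<in> hom (Fun C D) F F"
    unfolding Ident_Fun
    by (rule mk_nt_hom)
      (use F C D in \<open>auto intro!: cat_id[OF D] functor_obj simp: cat_idl[OF D functor_hom] cat_idr[OF D functor_hom]\<close>)
next
  fix \<alpha> \<beta> F G H assume a: "\<alpha> \<in> hom (Fun C D) F G" and b: "\<beta> \<in> hom (Fun C D) G H"
  have 1: "nsrc \<alpha> = F" "ntgt \<beta> = H" using a b by (simp_all add: Fun_homD)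
  show "Cmp (Fun C D) \<beta> \<alpha> \<in> hom (Fun C D) F H"
    unfolding Cmp_Fun 1
  proof (rule mk_nt_hom[OF C])
    fix f x y assume f: "f \<in> hom C x y"
    have xy: "x \<in> Obj C" "y \<in> Obj C" using cat_hom_obj[OF C f] by auto
    note t = Fun_hom_comp[OF a xy(1)] Fun_hom_comp[OF a xy(2)] Fun_hom_comp[OF b xy(1)] Fun_hom_comp[OF b xy(2)]
      functor_hom[OF Fun_homD(1)[OF a] f] functor_hom[OF Fun_homD(1)[OF b] f] functor_hom[OF Fun_homD(2)[OF b] f]
    show "Cmp D (Cmp D (ncomp \<beta> y) (ncomp \<alpha> y)) (far F f) = Cmp D (far H f) (Cmp D (ncomp \<beta> x) (ncomp \<alpha> x))"
      using Fun_hom_nat[OF a f] Fun_hom_nat[OF b f]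
        cat_assoc[OF D t(5) t(2) t(4)] cat_assoc[OF D t(1) t(6) t(4)] cat_assoc[OF D t(1) t(3) t(7)] by simp
  qed (use a b in \<open>auto intro: Fun_homD cat_cmp[OF D] Fun_hom_comp\<close>)
next
  show "Cmp (Fun C D) \<gamma> (Cmp (Fun C D) \<beta> \<alpha>) = Cmp (Fun C D) (Cmp (Fun C D) \<gamma> \<beta>) \<alpha>"
    if "\<alpha> \<in> hom (Fun C D) F G" "\<beta> \<in> hom (Fun C D) G H" "\<gamma> \<in> hom (Fun C D) H K" for \<alpha> \<beta> \<gamma> F G H K
    unfolding Cmp_Fun using that
    by (auto simp: mk_nt_def intro!: restrict_ext cat_assoc[OF D] Fun_hom_comp)
next
  fix \<alpha> F G assume a: "\<alpha> \<in> hom (Fun C D) F G"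
  show "Cmp (Fun C D) (Ident (Fun C D) G) \<alpha> = \<alpha>"
    by (subst (2) hom_mk_nt[OF a])
      (auto simp: Cmp_Fun Fun_homD(3,4)[OF a] Ident_Fun intro!: mk_nt_cong cat_idl[OF D Fun_hom_comp[OF a]])
  show "Cmp (Fun C D) \<alpha> (Ident (Fun C D) F) = \<alpha>"
    by (subst (2) hom_mk_nt[OF a])
      (auto simp: Cmp_Fun Fun_homD(3,4)[OF a] Ident_Fun intro!: mk_nt_cong cat_idr[OF D Fun_hom_comp[OF a]])
qed

subsection \<open>Whiskering, postcomposition and constant diagrams\<close>

lemma whisker_left_mk: "whisker_left C K \<alpha> = mk_nt C (comp_fun C K (nsrc \<alpha>)) (comp_fun C K (ntgt \<alpha>)) (\<lambda>x. far K (ncomp \<alpha> x))"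
  by (simp add: whisker_left_def mk_nt_def)

lemma whisker_right_mk: "whisker_right B \<alpha> H = mk_nt B (comp_fun B (nsrc \<alpha>) H) (comp_fun B (ntgt \<alpha>) H) (\<lambda>x. ncomp \<alpha> (fob H x))"
  by (simp add: whisker_right_def mk_nt_def)

lemma ncomp_whisker_left [simp]: "x \<in> Obj C \<Longrightarrow> ncomp (whisker_left C K \<alpha>) x = far K (ncomp \<alpha> x)"
  by (simp add: whisker_left_mk)

lemma ncomp_whisker_right [simp]: "x \<in> Obj B \<Longrightarrow> ncomp (whisker_right B \<alpha> H) x = ncomp \<alpha> (fob H x)"
  by (simp add: whisker_right_mk)

lemma whisker_left_hom:
  assumes C: "category C" and K: "is_functor D X K" and a: "\<alpha> \<in> hom (Fun C D) F G"
  shows "whisker_left C K \<alpha> \<in> hom (Fun C X) (comp_fun C K F) (comp_fun C K G)"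
  unfolding whisker_left_mk Fun_homD(3,4)[OF a]
proof (rule mk_nt_hom[OF C])
  show "is_functor C X (comp_fun C K F)" "is_functor C X (comp_fun C K G)"
    using C K a by (auto intro: comp_functor Fun_homD)
  show "far K (ncomp \<alpha> x) \<in> hom X (fob (comp_fun C K F) x) (fob (comp_fun C K G) x)" if "x \<in> Obj C" for x
    using that by (auto intro!: functor_hom[OF K] Fun_hom_comp[OF a])
  fix f x y assume f: "f \<in> hom C x y"
  have xy: "x \<in> Obj C" "y \<in> Obj C" using cat_hom_obj[OF C f] by auto
  show "Cmp X (far K (ncomp \<alpha> y)) (far (comp_fun C K F) f) = Cmp X (far (comp_fun C K G) f) (far K (ncomp \<alpha> x))"
    using f Fun_hom_nat[OF a f]
     functor_cmp[OF K functor_hom[OF Fun_homD(1)[OF a] f] Fun_hom_comp[OF a xy(2)]]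
     functor_cmp[OF K Fun_hom_comp[OF a xy(1)] functor_hom[OF Fun_homD(2)[OF a] f]]
    by (simp add: hom_Arr)
qed

lemma whisker_right_hom:
  assumes B: "category B" and H: "is_functor B C H" and a: "\<alpha> \<in> hom (Fun C D) F G"
  shows "whisker_right B \<alpha> H \<in> hom (Fun B D) (comp_fun B F H) (comp_fun B G H)"
  unfolding whisker_right_mk Fun_homD(3,4)[OF a]
proof (rule mk_nt_hom[OF B])
  show "is_functor B D (comp_fun B F H)" "is_functor B D (comp_fun B G H)"
    using B H a by (auto intro: comp_functor Fun_homD)
  show "ncomp \<alpha> (fob H x) \<in> hom D (fob (comp_fun B F H) x) (fob (comp_fun B G H) x)" if "x \<in> Obj B" for x
    using that by (auto intro!: functor_obj[OF H] Fun_hom_comp[OF a])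
  show "Cmp D (ncomp \<alpha> (fob H y)) (far (comp_fun B F H) f) = Cmp D (far (comp_fun B G H) f) (ncomp \<alpha> (fob H x))"
    if f: "f \<in> hom B x y" for f x y
    using f Fun_hom_nat[OF a functor_hom[OF H f]] by (simp add: hom_Arr)
qed

lemma post_fun_simps [simp]:
  "is_functor J C X \<Longrightarrow> fob (post_fun J C F) X = comp_fun J F X"
  "is_ntrans J C \<xi> \<Longrightarrow> far (post_fun J C F) \<xi> = whisker_left J F \<xi>"
  by (simp_all add: post_fun_def)

lemma post_functor:
  assumes J: "category J" and C: "category C" and F: "is_functor C D F"
  shows "is_functor (Fun J C) (Fun J D) (post_fun J C F)"
proof (rule is_functorI)
  show "fob (post_fun J C F) \<in> extensional (Obj (Fun J C))" "far (post_fun J C F) \<in> extensional (Arr (Fun J C))"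
    by (auto simp: post_fun_def)
next
  fix X assume "X \<in> Obj (Fun J C)"
  then have X: "is_functor J C X" by simp
  show "fob (post_fun J C F) X \<in> Obj (Fun J D)" using X J F by (auto intro: comp_functor)
  show "far (post_fun J C F) (Ident (Fun J C) X) = Ident (Fun J D) (fob (post_fun J C F) X)"
    using X Fun_homD(5)[OF cat_id[OF category_Fun[OF J C], of X]]
    by (auto simp: whisker_left_mk Ident_Fun intro!: mk_nt_cong functor_id[OF F] functor_obj[OF X])
next
  fix \<xi> X Y assume x: "\<xi> \<in> hom (Fun J C) X Y"
  show "far (post_fun J C F) \<xi> \<in> hom (Fun J D) (fob (post_fun J C F) X) (fob (post_fun J C F) Y)"
    using whisker_left_hom[OF J F x] Fun_homD[OF x] by simp
next
  fix \<xi> \<zeta> X Y Z assume x: "\<xi> \<in> hom (Fun J C) X Y" and z: "\<zeta> \<in> hom (Fun J C) Y Z"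
  show "far (post_fun J C F) (Cmp (Fun J C) \<zeta> \<xi>) = Cmp (Fun J D) (far (post_fun J C F) \<zeta>) (far (post_fun J C F) \<xi>)"
    using Fun_homD(5)[OF cat_cmp[OF category_Fun[OF J C] x z]]
    by (simp add: Cmp_Fun whisker_left_mk Fun_homD(3-5)[OF x] Fun_homD(3-5)[OF z])
      (rule mk_nt_cong; simp add: functor_cmp[OF F Fun_hom_comp[OF x] Fun_hom_comp[OF z]])
qed

lemma post_ntrans_hom:
  assumes J: "category J" and C: "category C" and D: "category D" and a: "\<alpha> \<in> hom (Fun C D) F G"
  shows "post_ntrans J C \<alpha> \<in> hom (Fun (Fun J C) (Fun J D)) (post_fun J C F) (post_fun J C G)"
proof -
  note JC = category_Fun[OF J C]
  have "mk_nt (Fun J C) (post_fun J C F) (post_fun J C G) (whisker_right J \<alpha>) \<in>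
     hom (Fun (Fun J C) (Fun J D)) (post_fun J C F) (post_fun J C G)"
  proof (rule mk_nt_hom[OF JC])
    show "is_functor (Fun J C) (Fun J D) (post_fun J C F)" "is_functor (Fun J C) (Fun J D) (post_fun J C G)"
      by (intro post_functor J C Fun_homD(1,2)[OF a])+
    show "whisker_right J \<alpha> X \<in> hom (Fun J D) (fob (post_fun J C F) X) (fob (post_fun J C G) X)"
      if "X \<in> Obj (Fun J C)" for X using that whisker_right_hom[OF J _ a] by simp
    fix \<xi> X Y assume x: "\<xi> \<in> hom (Fun J C) X Y"
    note X = Fun_homD[OF x]
    have "Cmp D (ncomp \<alpha> (fob Y j)) (far F (ncomp \<xi> j)) = Cmp D (far G (ncomp \<xi> j)) (ncomp \<alpha> (fob X j))" if "j \<in> Obj J" for j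
      using Fun_hom_nat[OF a Fun_hom_comp[OF x that]] .
    then show "Cmp (Fun J D) (whisker_right J \<alpha> Y) (far (post_fun J C F) \<xi>) =
        Cmp (Fun J D) (far (post_fun J C G) \<xi>) (whisker_right J \<alpha> X)"
      using X Fun_homD[OF a] by (auto simp: Cmp_Fun whisker_left_mk whisker_right_mk mk_nt_def intro!: restrict_ext)
  qed
  then show ?thesis
    by (simp add: post_ntrans_def mk_nt_def Fun_homD(3,4)[OF a] restrict_def)
qed

lemma ncomp_post_ntrans [simp]: "is_functor J C X \<Longrightarrow> ncomp (post_ntrans J C \<alpha>) X = whisker_right J \<alpha> X"
  by (simp add: post_ntrans_def)

text \<open>The constant diagram on \<open>A\<close>, that is, the value of \<^term>\<open>const_fun\<close> on objects.\<close>

definition const_obj :: "('j, 'k) cat \<Rightarrow> ('o, 'a) cat \<Rightarrow> 'o \<Rightarrow> ('j, 'k, 'o, 'a) fctr" where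
  "const_obj J D A = \<lparr>fob = (\<lambda>i \<in> Obj J. A), far = (\<lambda>k \<in> Arr J. Ident D A)\<rparr>"

lemma const_obj_simps [simp]:
  "i \<in> Obj J \<Longrightarrow> fob (const_obj J D A) i = A" "k \<in> Arr J \<Longrightarrow> far (const_obj J D A) k = Ident D A"
  by (simp_all add: const_obj_def)

lemma const_fun_simps [simp]:
  "A \<in> Obj D \<Longrightarrow> fob (const_fun J D) A = const_obj J D A"
  "f \<in> hom D A B \<Longrightarrow> far (const_fun J D) f = mk_nt J (const_obj J D A) (const_obj J D B) (\<lambda>i. f)"
  by (auto simp: const_fun_def const_obj_def mk_nt_def Let_def hom_def)

lemma const_obj_functor: "category J \<Longrightarrow> category D \<Longrightarrow> A \<in> Obj D \<Longrightarrow> is_functor J D (const_obj J D A)"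
  apply (rule is_functorI)
  apply (simp_all add: const_obj_def)
  subgoal by (metis cat_hom_obj cat_id hom_Arr restrict_apply')
  subgoal by (metis cat_id hom_Arr restrict_apply')
  subgoal by (metis cat_cmp cat_id cat_idl hom_Arr restrict_apply')
  done

lemma const_functor:
  assumes J: "category J" and D: "category D"
  shows "is_functor D (Fun J D) (const_fun J D)"
proof (rule is_functorI)
  show "fob (const_fun J D) \<in> extensional (Obj D)" "far (const_fun J D) \<in> extensional (Arr D)"
    by (simp_all add: const_fun_def Let_def)
next
  fix f A B assume f: "f \<in> hom D A B"
  have AB: "A \<in> Obj D" "B \<in> Obj D" using cat_hom_obj[OF D f] by auto
  have "mk_nt J (const_obj J D A) (const_obj J D B) (\<lambda>i. f) \<in> hom (Fun J D) (const_obj J D A) (const_obj J D B)"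
    by (rule mk_nt_hom) (use f J D AB in \<open>auto simp: const_obj_functor hom_Arr cat_idl cat_idr cat_hom_obj\<close>)
  then show "far (const_fun J D) f \<in> hom (Fun J D) (fob (const_fun J D) A) (fob (const_fun J D) B)"
    using f AB by simp
next
  fix A assume A: "A \<in> Obj D"
  then show "far (const_fun J D) (Ident D A) = Ident (Fun J D) (fob (const_fun J D) A)"
    unfolding Ident_Fun const_fun_simps(2)[OF cat_id[OF D A]] const_fun_simps(1)[OF A] by (auto intro!: mk_nt_cong)
next
  fix f g A B B' assume f: "f \<in> hom D A B" and g: "g \<in> hom D B B'"
  show "far (const_fun J D) (Cmp D g f) = Cmp (Fun J D) (far (const_fun J D) g) (far (const_fun J D) f)"
    unfolding Cmp_Fun const_fun_simps(2)[OF cat_cmp[OF D f g]] const_fun_simps(2)[OF f] const_fun_simps(2)[OF g]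
    by (auto intro!: mk_nt_cong)
qed (use assms in \<open>auto simp: const_obj_functor\<close>)

section \<open>Isomorphisms\<close>

lemma is_isoI:
  "f \<in> hom C x y \<Longrightarrow> g \<in> hom C y x \<Longrightarrow> Cmp C g f = Ident C x \<Longrightarrow> Cmp C f g = Ident C y \<Longrightarrow> is_iso C f"
  by (auto simp: is_iso_def hom_def)

lemma is_isoE:
  assumes "is_iso C f" "f \<in> hom C x y"
  obtains g where "g \<in> hom C y x" "Cmp C g f = Ident C x" "Cmp C f g = Ident C y"
  using assms by (auto simp: is_iso_def hom_def)

lemma iso_id: "category C \<Longrightarrow> x \<in> Obj C \<Longrightarrow> is_iso C (Ident C x)"
  by (rule is_isoI[of _ _ x x "Ident C x"]) (auto intro: cat_id cat_idl[OF _ cat_id])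

lemma iso_cmp:
  assumes C: "category C" and f: "f \<in> hom C x y" and g: "g \<in> hom C y z" and "is_iso C f" "is_iso C g"
  shows "is_iso C (Cmp C g f)"
proof -
  obtain f' where f': "f' \<in> hom C y x" "Cmp C f' f = Ident C x" "Cmp C f f' = Ident C y"
    using assms by (blast elim: is_isoE)
  obtain g' where g': "g' \<in> hom C z y" "Cmp C g' g = Ident C y" "Cmp C g g' = Ident C z"
    using assms by (blast elim: is_isoE)
  show ?thesis
  proof (rule is_isoI)
    show "Cmp C g f \<in> hom C x z" "Cmp C f' g' \<in> hom C z x" using cat_cmp[OF C] f g f' g' by blast+
    have "Cmp C (Cmp C f' g') (Cmp C g f) = Cmp C f' (Cmp C (Cmp C g' g) f)"
      using cat_assoc[OF C f g g'(1)] cat_assoc[OF C cat_cmp[OF C f g] g'(1) f'(1)] by simp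
    then show "Cmp C (Cmp C f' g') (Cmp C g f) = Ident C x"
      using g' f' cat_idl[OF C f] by simp
    have "Cmp C (Cmp C g f) (Cmp C f' g') = Cmp C g (Cmp C (Cmp C f f') g')"
      using cat_assoc[OF C g'(1) f'(1) f] cat_assoc[OF C cat_cmp[OF C g'(1) f'(1)] f g] by simp
    then show "Cmp C (Cmp C g f) (Cmp C f' g') = Ident C z"
      using g' f' cat_idl[OF C g'(1)] by simp
  qed
qed

lemma iso_inverse:
  assumes "f \<in> hom C x y" "g \<in> hom C y x" "Cmp C g f = Ident C x" "Cmp C f g = Ident C y"
  shows "is_iso C g"
  using is_isoI[OF assms(2,1,4,3)] .

lemma iso_cancel_left:
  assumes C: "category C" and f: "f \<in> hom C x y" and g: "g \<in> hom C y z" and gi: "is_iso C g"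
    and gf: "is_iso C (Cmp C g f)"
  shows "is_iso C f"
proof -
  obtain g' where g': "g' \<in> hom C z y" "Cmp C g' g = Ident C y" "Cmp C g g' = Ident C z"
    using gi g by (blast elim: is_isoE)
  have "f = Cmp C g' (Cmp C g f)"
    using cat_assoc[OF C f g g'(1)] g' cat_idl[OF C f] by simp
  then show ?thesis
    using iso_cmp[OF C cat_cmp[OF C f g] g'(1) gf iso_inverse[OF g g']] by simp
qed

lemma iso_cancel_right:
  assumes C: "category C" and f: "f \<in> hom C x y" and g: "g \<in> hom C y z" and fi: "is_iso C f"
    and gf: "is_iso C (Cmp C g f)"
  shows "is_iso C g"
proof -
  obtain f' where f': "f' \<in> hom C y x" "Cmp C f' f = Ident C x" "Cmp C f f' = Ident C y"
    using fi f by (blast elim: is_isoE)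
  have "g = Cmp C (Cmp C g f) f'"
    using cat_assoc[OF C f'(1) f g] f' cat_idr[OF C g] by simp
  then show ?thesis
    using iso_cmp[OF C f'(1) cat_cmp[OF C f g] iso_inverse[OF f f'] gf] by simp
qed

lemma iso_idempotent:
  assumes C: "category C" and f: "f \<in> hom C x x" and i: "is_iso C f" and ff: "Cmp C f f = f"
  shows "f = Ident C x"
proof -
  obtain g where g: "g \<in> hom C x x" "Cmp C g f = Ident C x" "Cmp C f g = Ident C x"
    using i f by (blast elim: is_isoE)
  have "f = Cmp C g (Cmp C f f)"
    using cat_assoc[OF C f f g(1)] g cat_idl[OF C f] by simp
  then show ?thesis using ff g by simp
qed

lemma functor_iso:
  assumes C: "category C" and F: "is_functor C D F" and f: "f \<in> hom C x y" and i: "is_iso C f"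
  shows "is_iso D (far F f)"
proof -
  obtain g where g: "g \<in> hom C y x" "Cmp C g f = Ident C x" "Cmp C f g = Ident C y"
    using i f by (blast elim: is_isoE)
  show ?thesis
    by (rule is_isoI[OF functor_hom[OF F f] functor_hom[OF F g(1)]])
      (use g functor_cmp[OF F f g(1)] functor_cmp[OF F g(1) f] cat_hom_obj[OF C f] functor_id[OF F] in auto)
qed

lemma Fun_iso:
  assumes C: "category C" and D: "category D" and a: "\<alpha> \<in> hom (Fun C D) F G"
    and i: "\<And>x. x \<in> Obj C \<Longrightarrow> is_iso D (ncomp \<alpha> x)"
  shows "is_iso (Fun C D) \<alpha>"
proof -
  note FG = Fun_homD[OF a]
  have "\<exists>b. \<forall>x \<in> Obj C. b x \<in> hom D (fob G x) (fob F x) \<and>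
      Cmp D (b x) (ncomp \<alpha> x) = Ident D (fob F x) \<and> Cmp D (ncomp \<alpha> x) (b x) = Ident D (fob G x)"
    by (rule bchoice) (use i Fun_hom_comp[OF a] in \<open>metis is_isoE\<close>)
  then obtain b where b: "\<And>x. x \<in> Obj C \<Longrightarrow> b x \<in> hom D (fob G x) (fob F x)"
      "\<And>x. x \<in> Obj C \<Longrightarrow> Cmp D (b x) (ncomp \<alpha> x) = Ident D (fob F x)"
      "\<And>x. x \<in> Obj C \<Longrightarrow> Cmp D (ncomp \<alpha> x) (b x) = Ident D (fob G x)" by blast
  have "mk_nt C G F b \<in> hom (Fun C D) G F"
  proof (rule mk_nt_hom[OF C FG(2,1) b(1)])
    fix f x y assume f: "f \<in> hom C x y"
    have xy: "x \<in> Obj C" "y \<in> Obj C" using cat_hom_obj[OF C f] by auto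
    note Gf = functor_hom[OF FG(2) f] and Ff = functor_hom[OF FG(1) f]
    have "Cmp D (b y) (far G f) = Cmp D (b y) (Cmp D (far G f) (Cmp D (ncomp \<alpha> x) (b x)))"
      using b(3)[OF xy(1)] cat_idr[OF D Gf] by simp
    also have "\<dots> = Cmp D (b y) (Cmp D (Cmp D (ncomp \<alpha> y) (far F f)) (b x))"
      using cat_assoc[OF D b(1)[OF xy(1)] Fun_hom_comp[OF a xy(1)] Gf] Fun_hom_nat[OF a f] by simp
    also have "\<dots> = Cmp D (Cmp D (b y) (ncomp \<alpha> y)) (Cmp D (far F f) (b x))"
      using cat_assoc[OF D b(1)[OF xy(1)] Ff Fun_hom_comp[OF a xy(2)]]
        cat_assoc[OF D cat_cmp[OF D b(1)[OF xy(1)] Ff] Fun_hom_comp[OF a xy(2)] b(1)[OF xy(2)]] by simp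
    also have "\<dots> = Cmp D (far F f) (b x)"
      using b(2)[OF xy(2)] cat_idl[OF D cat_cmp[OF D b(1)[OF xy(1)] Ff]] by simp
    finally show "Cmp D (b y) (far G f) = Cmp D (far F f) (b x)" .
  qed
  then show ?thesis
    by (rule is_isoI[OF a]) (use FG b in \<open>auto simp: Cmp_Fun Ident_Fun intro!: mk_nt_cong\<close>)
qed

section \<open>Adjunctions from invertible units\<close>

text \<open>No triangle identity is assumed here. Invertibility of \<open>\<epsilon>\<close>, \<open>F \<eta>\<close> and \<open>\<eta> G\<close> allows \<open>\<eta>\<close> to be
  corrected by an automorphism of \<open>G\<close> so that both hold.\<close>

lemma left_adjointI_iso:
  assumes C: "category C" and D: "category D" and F: "is_functor C D F" and G: "is_functor D C G"
    and h: "\<eta> \<in> hom (Fun C C) (id_fun C) (comp_fun C G F)"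
    and e: "\<epsilon> \<in> hom (Fun D D) (comp_fun D F G) (id_fun D)"
    and ei: "\<And>y. y \<in> Obj D \<Longrightarrow> is_iso D (ncomp \<epsilon> y)"
    and Fh: "\<And>x. x \<in> Obj C \<Longrightarrow> is_iso D (far F (ncomp \<eta> x))"
    and hG: "\<And>y. y \<in> Obj D \<Longrightarrow> is_iso C (ncomp \<eta> (fob G y))"
  shows "left_adjoint C D F G"
proof -
  have Go: "fob G y \<in> Obj C" if "y \<in> Obj D" for y using functor_obj[OF G that] .
  have Fo: "fob F x \<in> Obj D" if "x \<in> Obj C" for x using functor_obj[OF F that] .
  have hh: "ncomp \<eta> x \<in> hom C x (fob G (fob F x))" if "x \<in> Obj C" for x
    using Fun_hom_comp[OF h that] that by simp
  have eh: "ncomp \<epsilon> y \<in> hom D (fob F (fob G y)) y" if "y \<in> Obj D" for y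
    using Fun_hom_comp[OF e that] that by simp
  have hn: "Cmp C (ncomp \<eta> y) f = Cmp C (far G (far F f)) (ncomp \<eta> x)" if "f \<in> hom C x y" for f x y
    using Fun_hom_nat[OF h that] that by (simp add: hom_Arr)
  have en: "Cmp D (ncomp \<epsilon> y) (far F (far G f)) = Cmp D f (ncomp \<epsilon> x)" if "f \<in> hom D x y" for f x y
    using Fun_hom_nat[OF e that] that by (simp add: hom_Arr)
  note Ge = functor_hom[OF G eh]
  define \<theta> where "\<theta> = mk_nt D G G (\<lambda>y. Cmp C (far G (ncomp \<epsilon> y)) (ncomp \<eta> (fob G y)))"
  have \<theta>: "\<theta> \<in> hom (Fun D C) G G"
    unfolding \<theta>_def
  proof (rule mk_nt_hom[OF D G G])
    show "Cmp C (far G (ncomp \<epsilon> y)) (ncomp \<eta> (fob G y)) \<in> hom C (fob G y) (fob G y)" if "y \<in> Obj D" for y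
      using cat_cmp[OF C hh[OF Go[OF that]] Ge[OF that]] .
    fix f x y assume f: "f \<in> hom D x y"
    have xy: "x \<in> Obj D" "y \<in> Obj D" using cat_hom_obj[OF D f] by auto
    note Gf = functor_hom[OF G f]
    note FGf = functor_hom[OF F Gf]
    have "Cmp C (Cmp C (far G (ncomp \<epsilon> y)) (ncomp \<eta> (fob G y))) (far G f)
        = Cmp C (far G (ncomp \<epsilon> y)) (Cmp C (far G (far F (far G f))) (ncomp \<eta> (fob G x)))"
      using cat_assoc[OF C Gf hh[OF Go[OF xy(2)]] Ge[OF xy(2)]] hn[OF Gf] by simp
    also have "\<dots> = Cmp C (far G (Cmp D (ncomp \<epsilon> y) (far F (far G f)))) (ncomp \<eta> (fob G x))"
      using cat_assoc[OF C hh[OF Go[OF xy(1)]] functor_hom[OF G FGf] Ge[OF xy(2)]]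
        functor_cmp[OF G FGf eh[OF xy(2)]] by simp
    also have "\<dots> = Cmp C (far G f) (Cmp C (far G (ncomp \<epsilon> x)) (ncomp \<eta> (fob G x)))"
      using en[OF f] functor_cmp[OF G eh[OF xy(1)] f]
        cat_assoc[OF C hh[OF Go[OF xy(1)]] Ge[OF xy(1)] Gf] by simp
    finally show "Cmp C (Cmp C (far G (ncomp \<epsilon> y)) (ncomp \<eta> (fob G y))) (far G f)
        = Cmp C (far G f) (Cmp C (far G (ncomp \<epsilon> x)) (ncomp \<eta> (fob G x)))" .
  qed
  have "is_iso (Fun D C) \<theta>"
    by (rule Fun_iso[OF D C \<theta>])
      (simp add: \<theta>_def iso_cmp[OF C hh[OF Go] Ge hG functor_iso[OF D G eh ei]])
  then obtain \<kappa> where \<kappa>: "\<kappa> \<in> hom (Fun D C) G G" and \<kappa>\<theta>: "Cmp (Fun D C) \<kappa> \<theta> = Ident (Fun D C) G"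
      and \<theta>\<kappa>: "Cmp (Fun D C) \<theta> \<kappa> = Ident (Fun D C) G"
    using \<theta> by (blast elim: is_isoE)
  have kt: "Cmp C (ncomp \<kappa> y) (ncomp \<theta> y) = Ident C (fob G y)"
    and tk: "Cmp C (ncomp \<theta> y) (ncomp \<kappa> y) = Ident C (fob G y)" if "y \<in> Obj D" for y
    using arg_cong[OF \<kappa>\<theta>, of "\<lambda>a. ncomp a y"] arg_cong[OF \<theta>\<kappa>, of "\<lambda>a. ncomp a y"] that by simp_all
  have kh: "ncomp \<kappa> y \<in> hom C (fob G y) (fob G y)" if "y \<in> Obj D" for y
    using Fun_hom_comp[OF \<kappa> that] .
  have th: "ncomp \<theta> y \<in> hom C (fob G y) (fob G y)" if "y \<in> Obj D" for y
    using Fun_hom_comp[OF \<theta> that] .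
  have ki: "is_iso C (ncomp \<kappa> y)" if "y \<in> Obj D" for y
    using iso_inverse[OF th kh kt tk] that by blast
  \<comment> \<open>The triangle at \<open>G\<close> fails for \<open>\<eta>\<close> by the automorphism \<open>\<theta>\<close>, so it holds for \<open>\<eta>\<close> corrected by
    the inverse \<open>\<kappa>\<close>.\<close>
  define \<eta>' where "\<eta>' = Cmp (Fun C C) (whisker_right C \<kappa> F) \<eta>"
  have \<eta>': "\<eta>' \<in> hom (Fun C C) (id_fun C) (comp_fun C G F)"
    unfolding \<eta>'_def using cat_cmp[OF category_Fun[OF C C] h whisker_right_hom[OF C F \<kappa>]] .
  have h'c: "ncomp \<eta>' x = Cmp C (ncomp \<kappa> (fob F x)) (ncomp \<eta> x)" if "x \<in> Obj C" for x
    using that by (simp add: \<eta>'_def)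
  have hh': "ncomp \<eta>' x \<in> hom C x (fob G (fob F x))" if "x \<in> Obj C" for x
    using Fun_hom_comp[OF \<eta>' that] that by simp
  have hn': "Cmp C (ncomp \<eta>' y) f = Cmp C (far G (far F f)) (ncomp \<eta>' x)" if "f \<in> hom C x y" for f x y
    using Fun_hom_nat[OF \<eta>' that] that by (simp add: hom_Arr)
  have tri2: "Cmp C (far G (ncomp \<epsilon> y)) (ncomp \<eta>' (fob G y)) = Ident C (fob G y)" if y: "y \<in> Obj D" for y
  proof -
    have FGy: "fob F (fob G y) \<in> Obj D" using Fo Go y by blast
    have "Cmp C (far G (ncomp \<epsilon> y)) (ncomp \<eta>' (fob G y))
        = Cmp C (Cmp C (far G (ncomp \<epsilon> y)) (ncomp \<kappa> (fob F (fob G y)))) (ncomp \<eta> (fob G y))"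
      using h'c[OF Go[OF y]] cat_assoc[OF C hh[OF Go[OF y]] kh[OF FGy] Ge[OF y]] by simp
    also have "\<dots> = Cmp C (ncomp \<kappa> y) (ncomp \<theta> y)"
      using Fun_hom_nat[OF \<kappa> eh[OF y]] cat_assoc[OF C hh[OF Go[OF y]] Ge[OF y] kh[OF y]] y
      by (simp add: \<theta>_def)
    finally show ?thesis using kt[OF y] by simp
  qed
  have tri1: "Cmp D (ncomp \<epsilon> (fob F x)) (far F (ncomp \<eta>' x)) = Ident D (fob F x)" if x: "x \<in> Obj C" for x
  proof -
    define y where "y = fob F x"
    define h' where "h' = ncomp \<eta>' x"
    have y: "y \<in> Obj D" using Fo[OF x] by (simp add: y_def)
    have h': "h' \<in> hom C x (fob G y)" using hh'[OF x] by (simp add: y_def h'_def)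
    note Fh' = functor_hom[OF F h', folded y_def]
    note GFh' = functor_hom[OF G Fh']
    note FGFh' = functor_hom[OF F GFh']
    note FGe = functor_hom[OF F Ge[OF y]]
    have FGy: "fob F (fob G y) \<in> Obj D" using Fo Go y by blast
    \<comment> \<open>Given the other triangle identity, this composite is idempotent; as it is invertible, it is
      the identity.\<close>
    let ?a = "Cmp D (ncomp \<epsilon> y) (far F h')"
    have a: "?a \<in> hom D y y" using cat_cmp[OF D Fh' eh[OF y]] .
    have "is_iso D (far F h')"
      using functor_cmp[OF F hh[OF x, folded y_def] kh[OF y]] h'c[OF x]
        iso_cmp[OF D functor_hom[OF F hh[OF x]] functor_hom[OF F kh[OF Fo[OF x]]] Fh[OF x]
          functor_iso[OF C F kh[OF Fo[OF x]] ki[OF Fo[OF x]]]]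
      by (simp add: h'_def y_def)
    then have ai: "is_iso D ?a" by (rule iso_cmp[OF D Fh' eh[OF y] _ ei[OF y]])
    have "Cmp D ?a ?a = Cmp D (Cmp D (ncomp \<epsilon> y) (Cmp D (far F h') (ncomp \<epsilon> y))) (far F h')"
      using cat_assoc[OF D Fh' eh[OF y] a] cat_assoc[OF D eh[OF y] Fh' eh[OF y]] by simp
    also have "\<dots> = Cmp D (Cmp D (ncomp \<epsilon> y) (Cmp D (ncomp \<epsilon> (fob F (fob G y))) (far F (far G (far F h'))))) (far F h')"
      using en[OF Fh'] by simp
    also have "\<dots> = Cmp D (Cmp D (Cmp D (ncomp \<epsilon> y) (far F (far G (ncomp \<epsilon> y)))) (far F (far G (far F h')))) (far F h')"
      using cat_assoc[OF D FGFh' eh[OF FGy] eh[OF y]] en[OF eh[OF y]] by simp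
    also have "\<dots> = Cmp D (ncomp \<epsilon> y) (Cmp D (far F (far G (ncomp \<epsilon> y))) (Cmp D (far F (far G (far F h'))) (far F h')))"
      using cat_assoc[OF D FGFh' FGe eh[OF y]] cat_assoc[OF D Fh' cat_cmp[OF D FGFh' FGe] eh[OF y]]
        cat_assoc[OF D Fh' FGFh' FGe] by simp
    also have "Cmp D (far F (far G (far F h'))) (far F h') = far F (Cmp C (ncomp \<eta>' (fob G y)) h')"
      using functor_cmp[OF F h' GFh'] hn'[OF h'] by (simp add: h'_def)
    also have "Cmp D (far F (far G (ncomp \<epsilon> y))) (far F (Cmp C (ncomp \<eta>' (fob G y)) h')) = far F h'"
      using functor_cmp[OF F cat_cmp[OF C h' hh'[OF Go[OF y]]] Ge[OF y]] tri2[OF y] cat_idl[OF C h']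
        cat_assoc[OF C h' hh'[OF Go[OF y]] Ge[OF y]] by simp
    finally have "Cmp D ?a ?a = ?a" .
    from iso_idempotent[OF D a ai this] show ?thesis by (simp add: y_def h'_def)
  qed
  show ?thesis unfolding left_adjoint_def using F G \<eta>' e tri1 tri2 by blast
qed

section \<open>Localization\<close>

lemma zigzag_obj: "category C \<Longrightarrow> zigzag C W x p y \<Longrightarrow> x \<in> Obj C \<and> y \<in> Obj C"
  by (induction C W x p y rule: zigzag.induct) (auto dest: category.dom_obj category.cod_obj)

lemma zigzag_append: "zigzag C W x p y \<Longrightarrow> zigzag C W y q z \<Longrightarrow> zigzag C W x (p @ q) z"
  by (induction C W x p y rule: zigzag.induct) auto

lemma zigzag_Fwd: "category C \<Longrightarrow> f \<in> hom C x y \<Longrightarrow> zigzag C W x [Fwd f] y"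
  and zigzag_Bwd: "category C \<Longrightarrow> f \<in> hom C x y \<Longrightarrow> f \<in> W \<Longrightarrow> zigzag C W y [Bwd f] x"
  by (auto simp: hom_def category.cod_obj category.dom_obj)

lemma zz_eq_ctx:
  assumes "zigzag C W x a y" "zz_eq C W y z p q" "zigzag C W z b w"
  shows "zz_eq C W x w (a @ p @ b) (a @ q @ b)"
  using assms by (intro zz_eq.append[OF zz_eq.refl] zz_eq.append[OF _ zz_eq.refl])

lemma loc_class_eqI: "zz_eq C W x y p q \<Longrightarrow> loc_class C W x p y = loc_class C W x q y"
  unfolding loc_class_def by (auto intro: zz_eq.trans zz_eq.sym)

lemma Loc_simps [simp]:
  "Obj (Loc C W) = Obj C" "Ident (Loc C W) x = loc_class C W x [] x"
  "Dom (Loc C W) (loc_class C W x p y) = x" "Cod (Loc C W) (loc_class C W x p y) = y"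
  by (simp_all add: Loc_def loc_class_def)

lemma hom_Loc: "hom (Loc C W) x y = {loc_class C W x p y | p. zigzag C W x p y}"
  by (auto simp: hom_def Loc_def loc_class_def)

lemma Arr_Loc: "Arr (Loc C W) = {loc_class C W x p y | x p y. zigzag C W x p y}"
  by (simp add: Loc_def)

lemma hom_LocI: "zigzag C W x p y \<Longrightarrow> loc_class C W x p y \<in> hom (Loc C W) x y"
  by (auto simp: hom_Loc)

lemma Cmp_Loc:
  assumes "zigzag C W x p y" "zigzag C W y q z"
  shows "Cmp (Loc C W) (loc_class C W y q z) (loc_class C W x p y) = loc_class C W x (p @ q) z"
  using assms unfolding Loc_def loc_class_def
  by (auto intro: zz_eq.append zz_eq.trans zz_eq.refl)

lemma category_Loc:
  assumes C: "category C"
  shows "category (Loc C W)"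
proof
  fix f assume "f \<in> Arr (Loc C W)"
  then show "Dom (Loc C W) f \<in> Obj (Loc C W)" "Cod (Loc C W) f \<in> Obj (Loc C W)"
    using zigzag_obj[OF C] by (auto simp: Arr_Loc)
next
  fix x assume "x \<in> Obj (Loc C W)"
  then show "Ident (Loc C W) x \<in> hom (Loc C W) x x" by (auto intro: hom_LocI)
next
  fix f g x y z assume "f \<in> hom (Loc C W) x y" "g \<in> hom (Loc C W) y z"
  then show "Cmp (Loc C W) g f \<in> hom (Loc C W) x z"
    by (auto simp: hom_Loc Cmp_Loc intro: zigzag_append)
next
  fix f g h w x y z assume "f \<in> hom (Loc C W) w x" "g \<in> hom (Loc C W) x y" "h \<in> hom (Loc C W) y z"
  then show "Cmp (Loc C W) h (Cmp (Loc C W) g f) = Cmp (Loc C W) (Cmp (Loc C W) h g) f"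
    by (auto simp: hom_Loc Cmp_Loc zigzag_append)
next
  fix f x y assume f: "f \<in> hom (Loc C W) x y"
  then obtain p where p: "f = loc_class C W x p y" "zigzag C W x p y" by (auto simp: hom_Loc)
  have "zigzag C W x [] x" "zigzag C W y [] y" using zigzag_obj[OF C p(2)] by auto
  then show "Cmp (Loc C W) (Ident (Loc C W) y) f = f" "Cmp (Loc C W) f (Ident (Loc C W) x) = f"
    using p by (simp_all add: Cmp_Loc del: zigzag.simps)
qed

text \<open>The image of an arrow under the localization functor.\<close>

definition loc_of :: "('o, 'a) cat \<Rightarrow> 'a set \<Rightarrow> 'a \<Rightarrow> ('o, 'a) loc_arr" where
  "loc_of C W f = loc_class C W (Dom C f) [Fwd f] (Cod C f)"

lemma loc_of_class: "f \<in> hom C x y \<Longrightarrow> loc_of C W f = loc_class C W x [Fwd f] y"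
  by (simp add: loc_of_def hom_def)

lemma loc_of_hom: "category C \<Longrightarrow> f \<in> hom C x y \<Longrightarrow> loc_of C W f \<in> hom (Loc C W) x y"
  unfolding loc_of_class by (rule hom_LocI[OF zigzag_Fwd])

lemma loc_of_cmp:
  assumes "category C" "f \<in> hom C x y" "g \<in> hom C y z"
  shows "loc_of C W (Cmp C g f) = Cmp (Loc C W) (loc_of C W g) (loc_of C W f)"
  using loc_class_eqI[OF zz_eq.cmp[OF assms(2,3)]] assms
  by (simp add: loc_of_class[OF cat_cmp[OF assms]] loc_of_class Cmp_Loc[OF zigzag_Fwd zigzag_Fwd])

lemma loc_of_id: "category C \<Longrightarrow> x \<in> Obj C \<Longrightarrow> loc_of C W (Ident C x) = Ident (Loc C W) x"
  by (simp add: loc_of_class[OF cat_id] loc_class_eqI[OF zz_eq.ident])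

lemma loc_of_iso:
  assumes C: "category C" and w: "w \<in> hom C x y" "w \<in> W"
  shows "is_iso (Loc C W) (loc_of C W w)"
  by (rule is_isoI[OF loc_of_hom[OF C w(1)] hom_LocI[OF zigzag_Bwd[OF C w]]])
   (use w in \<open>simp_all add: loc_of_class
     Cmp_Loc[OF zigzag_Bwd[OF C w] zigzag_Fwd[OF C w(1)]] Cmp_Loc[OF zigzag_Fwd[OF C w(1)] zigzag_Bwd[OF C w]]
     loc_class_eqI[OF zz_eq.inv_left] loc_class_eqI[OF zz_eq.inv_right]\<close>)

lemma saturatedD:
  assumes "saturated C W"
  shows "W \<subseteq> Arr C" "f \<in> Arr C \<Longrightarrow> is_iso (Loc C W) (loc_of C W f) \<Longrightarrow> f \<in> W"
  using assms unfolding saturated_def loc_of_def by auto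

lemma saturated_iff:
  assumes "category C" "saturated C W" "f \<in> hom C x y"
  shows "f \<in> W \<longleftrightarrow> is_iso (Loc C W) (loc_of C W f)"
  using loc_of_iso[OF assms(1,3)] saturatedD(2)[OF assms(2) hom_Arr[OF assms(3)]] by blast

lemma saturated_id: "category C \<Longrightarrow> saturated C W \<Longrightarrow> x \<in> Obj C \<Longrightarrow> Ident C x \<in> W"
  using iso_id[OF category_Loc, of C x W] saturated_iff[OF _ _ cat_id, of C W x] by (simp add: loc_of_id)

subsection \<open>Induced functors\<close>

text \<open>Functors that preserve the distinguished classes, and so descend to the localizations.\<close>

definition rel_functor :: "('o, 'a) cat \<Rightarrow> 'a set \<Rightarrow> ('p, 'b) cat \<Rightarrow> 'b set \<Rightarrow> ('o, 'a, 'p, 'b) fctr \<Rightarrow> bool" where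
  "rel_functor C W D E F \<longleftrightarrow> is_functor C D F \<and> (\<forall>w \<in> Arr C \<inter> W. far F w \<in> E)"

lemma rel_functorD: "rel_functor C W D E F \<Longrightarrow> is_functor C D F"
  and rel_functor_weq: "rel_functor C W D E F \<Longrightarrow> w \<in> hom C x y \<Longrightarrow> w \<in> W \<Longrightarrow> far F w \<in> E"
  by (auto simp: rel_functor_def hom_def)

lemma rel_functor_zigzag:
  assumes F: "rel_functor C W D E F"
  shows "zigzag C W x p y \<Longrightarrow> zigzag D E (fob F x) (map (map_step (far F)) p) (fob F y)"
proof (induction p arbitrary: x)
  case Nil
  then show ?case using functor_obj[OF rel_functorD[OF F]] by auto
next
  case (Cons t p)
  note h = functor_hom[OF rel_functorD[OF F] Arr_hom]
  show ?case
    by (cases t) (use Cons h rel_functor_weq[OF F Arr_hom] in \<open>auto simp: hom_def\<close>)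
qed

lemma rel_functor_zz_eq:
  assumes C: "category C" and F: "rel_functor C W D E F"
  shows "zz_eq C W x y p q \<Longrightarrow>
    zz_eq D E (fob F x) (fob F y) (map (map_step (far F)) p) (map (map_step (far F)) q)"
proof (induction rule: zz_eq.induct)
  case (refl x p y)
  then show ?case using rel_functor_zigzag[OF F] by (blast intro: zz_eq.refl)
next
  case (cmp f x y g z)
  then show ?case
    using functor_cmp[OF rel_functorD[OF F] cmp] zz_eq.cmp[OF functor_hom[OF rel_functorD[OF F] cmp(1)] functor_hom[OF rel_functorD[OF F] cmp(2)]]
    by simp
next
  case (ident x)
  then show ?case using functor_id[OF rel_functorD[OF F]] functor_obj[OF rel_functorD[OF F]] by (simp add: zz_eq.ident)
next
  case (inv_right w x y)
  then show ?case using functor_hom[OF rel_functorD[OF F]] rel_functor_weq[OF F] by (auto intro!: zz_eq.inv_right)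
next
  case (inv_left w x y)
  then show ?case using functor_hom[OF rel_functorD[OF F]] rel_functor_weq[OF F] by (auto intro!: zz_eq.inv_left)
next
  case (append x y p p' z q q')
  then show ?case by (simp add: zz_eq.append)
qed (blast intro: zz_eq.sym zz_eq.trans)+

lemma Loc_fun_obj [simp]: "x \<in> Obj C \<Longrightarrow> fob (Loc_fun C W D E F) x = fob F x"
  by (simp add: Loc_fun_def)

lemma Loc_fun_class:
  assumes C: "category C" and F: "rel_functor C W D E F" and p: "zigzag C W x p y"
  shows "far (Loc_fun C W D E F) (loc_class C W x p y) =
    loc_class D E (fob F x) (map (map_step (far F)) p) (fob F y)"
proof -
  have "loc_class C W x p y \<in> Arr (Loc C W)" using p by (auto simp: Arr_Loc)
  moreover have "{q. \<exists>p' \<in> {q. zz_eq C W x y p q}. zz_eq D E (fob F x) (fob F y) (map (map_step (far F)) p') q}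
      = {q. zz_eq D E (fob F x) (fob F y) (map (map_step (far F)) p) q}"
    using zz_eq.refl[OF p] rel_functor_zz_eq[OF C F] zz_eq.trans by (metis (lifting) mem_Collect_eq)
  ultimately show ?thesis
    by (simp add: Loc_fun_def loc_class_def)
qed

lemma Loc_functor:
  assumes C: "category C" and D: "category D" and F: "rel_functor C W D E F"
  shows "is_functor (Loc C W) (Loc D E) (Loc_fun C W D E F)"
proof (rule is_functorI)
  show "fob (Loc_fun C W D E F) \<in> extensional (Obj (Loc C W))" "far (Loc_fun C W D E F) \<in> extensional (Arr (Loc C W))"
    by (simp_all add: Loc_fun_def)
next
  fix f x y assume f: "f \<in> hom (Loc C W) x y"
  then obtain p where p: "f = loc_class C W x p y" "zigzag C W x p y" by (auto simp: hom_Loc)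
  show "far (Loc_fun C W D E F) f \<in> hom (Loc D E) (fob (Loc_fun C W D E F) x) (fob (Loc_fun C W D E F) y)"
    using p zigzag_obj[OF C p(2)] by (simp add: Loc_fun_class[OF C F] hom_LocI rel_functor_zigzag[OF F])
next
  fix f g x y z assume f: "f \<in> hom (Loc C W) x y" and g: "g \<in> hom (Loc C W) y z"
  then obtain p q where p: "f = loc_class C W x p y" "zigzag C W x p y"
    and q: "g = loc_class C W y q z" "zigzag C W y q z" by (auto simp: hom_Loc)
  show "far (Loc_fun C W D E F) (Cmp (Loc C W) g f) = Cmp (Loc D E) (far (Loc_fun C W D E F) g) (far (Loc_fun C W D E F) f)"
    using p(2) q(2) by (simp add: p q Loc_fun_class[OF C F] Loc_fun_class[OF C F zigzag_append[OF p(2) q(2)]]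
        Cmp_Loc rel_functor_zigzag[OF F])
qed (use functor_obj[OF rel_functorD[OF F]] in \<open>auto simp: Loc_fun_class[OF C F]\<close>)

lemma rel_functor_id: "category C \<Longrightarrow> rel_functor C W C W (id_fun C)"
  by (simp add: rel_functor_def id_functor)

lemma rel_functor_comp:
  assumes C: "category C" and F: "rel_functor C W D E F" and G: "rel_functor D E B V G"
  shows "rel_functor C W B V (comp_fun C G F)"
  unfolding rel_functor_def
  using comp_functor[OF C rel_functorD[OF F] rel_functorD[OF G]] rel_functor_weq[OF F Arr_hom]
    rel_functor_weq[OF G functor_hom[OF rel_functorD[OF F] Arr_hom]] by auto

lemma map_step_id: "map_step (\<lambda>x. x) t = t" by (cases t) auto

lemma zigzag_set: "zigzag C W x p y \<Longrightarrow> t \<in> set p \<Longrightarrow> set_step t \<subseteq> Arr C"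
  by (induction C W x p y rule: zigzag.induct) auto

lemma Loc_fun_id:
  assumes C: "category C"
  shows "Loc_fun C W C W (id_fun C) = id_fun (Loc C W)"
proof (rule functor_eqI[OF Loc_functor[OF C C rel_functor_id[OF C]] id_functor[OF category_Loc[OF C]]])
  fix f x y assume f: "f \<in> hom (Loc C W) x y"
  then obtain p where p: "f = loc_class C W x p y" "zigzag C W x p y" by (auto simp: hom_Loc)
  have "map (map_step (far (id_fun C))) p = p"
    using zigzag_set[OF p(2)] by (intro map_idI) (auto cong: step.map_cong simp: map_step_id subset_iff)
  then show "far (Loc_fun C W C W (id_fun C)) f = far (id_fun (Loc C W)) f"
    using f p zigzag_obj[OF C p(2)] by (simp add: Loc_fun_class[OF C rel_functor_id[OF C]] hom_Arr)
qed simp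

lemma Loc_fun_comp:
  assumes C: "category C" and D: "category D" and B: "category B"
    and F: "rel_functor C W D E F" and G: "rel_functor D E B V G"
  shows "Loc_fun C W B V (comp_fun C G F) = comp_fun (Loc C W) (Loc_fun D E B V G) (Loc_fun C W D E F)"
proof (rule functor_eqI[OF Loc_functor[OF C B rel_functor_comp[OF C F G]]
      comp_functor[OF category_Loc[OF C] Loc_functor[OF C D F] Loc_functor[OF D B G]]])
  fix f x y assume f: "f \<in> hom (Loc C W) x y"
  then obtain p where p: "f = loc_class C W x p y" "zigzag C W x p y" by (auto simp: hom_Loc)
  have "map (map_step (far (comp_fun C G F))) p = map (map_step (far G)) (map (map_step (far F)) p)"
    using zigzag_set[OF p(2)] by (auto simp: step.map_comp comp_def subset_iff intro!: step.map_cong0)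
  then show "far (Loc_fun C W B V (comp_fun C G F)) f = far (comp_fun (Loc C W) (Loc_fun D E B V G) (Loc_fun C W D E F)) f"
    using f p(2) zigzag_obj[OF C p(2)]
    by (simp add: p(1) Loc_fun_class[OF C rel_functor_comp[OF C F G]] hom_Arr Loc_fun_class[OF C F]
        Loc_fun_class[OF D G rel_functor_zigzag[OF F p(2)]] del: map_map map_eq_conv)
qed (use functor_obj[OF rel_functorD[OF F]] in auto)

text \<open>If \<open>f\<close> becomes invertible after inverting \<open>F\<^sup>-\<^sup>1 E\<close>, then \<open>F f\<close> becomes invertible in \<open>D[E\<^sup>-\<^sup>1]\<close>.\<close>

lemma saturated_preimage:
  assumes C: "category C" and D: "category D" and F: "is_functor C D F" and E: "saturated D E"
  shows "saturated C {f \<in> Arr C. far F f \<in> E}" (is "saturated C ?S")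
proof -
  have R: "rel_functor C ?S D E F" using F by (auto simp: rel_functor_def)
  have *: "f \<in> ?S" if f: "f \<in> hom C x y" and i: "is_iso (Loc C ?S) (loc_of C ?S f)" for f x y
  proof -
    have "is_iso (Loc D E) (far (Loc_fun C ?S D E F) (loc_of C ?S f))"
      by (rule functor_iso[OF category_Loc[OF C] Loc_functor[OF C D R] loc_of_hom[OF C f] i])
    then have "is_iso (Loc D E) (loc_of D E (far F f))"
      using f by (simp add: loc_of_class[OF f] loc_of_class[OF functor_hom[OF F f]]
          Loc_fun_class[OF C R zigzag_Fwd[OF C f]])
    then show ?thesis using saturatedD(2)[OF E hom_Arr[OF functor_hom[OF F f]]] hom_Arr[OF f] by simp
  qed
  then show ?thesis
    unfolding saturated_def loc_of_def[symmetric]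
  proof (intro equalityI subsetI)
    fix f assume "f \<in> ?S"
    then show "f \<in> {f \<in> Arr C. is_iso (Loc C ?S) (loc_of C ?S f)}"
      using loc_of_iso[OF C Arr_hom, of f ?S] by simp
  next
    fix f assume "f \<in> {f \<in> Arr C. is_iso (Loc C ?S) (loc_of C ?S f)}"
    then show "f \<in> ?S" using *[OF Arr_hom, of f] by simp
  qed
qed

subsection \<open>Zigzags of natural transformations\<close>

text \<open>The zigzag of components at \<open>x\<close> of a zigzag of natural transformations.\<close>

definition ev_zz :: "'o \<Rightarrow> ('o, 'a, 'p, 'b) ntrans step list \<Rightarrow> 'b step list" where
  "ev_zz x p = map (map_step (\<lambda>\<alpha>. ncomp \<alpha> x)) p"

lemma ev_zz_simps [simp]: "ev_zz x [] = []" "ev_zz x (Fwd \<alpha> # p) = Fwd (ncomp \<alpha> x) # ev_zz x p"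
   "ev_zz x (Bwd \<alpha> # p) = Bwd (ncomp \<alpha> x) # ev_zz x p" "ev_zz x (p @ q) = ev_zz x p @ ev_zz x q"
  by (simp_all add: ev_zz_def)

lemma nat_weqs_comp: "\<alpha> \<in> nat_weqs C D E \<Longrightarrow> x \<in> Obj C \<Longrightarrow> ncomp \<alpha> x \<in> E"
  by (simp add: nat_weqs_def)

lemma nat_weqsI: "\<alpha> \<in> hom (Fun C D) F G \<Longrightarrow> (\<And>x. x \<in> Obj C \<Longrightarrow> ncomp \<alpha> x \<in> E) \<Longrightarrow> \<alpha> \<in> nat_weqs C D E"
  by (simp add: nat_weqs_def hom_def)

lemma ev_zigzag:
  assumes x: "x \<in> Obj C"
  shows "zigzag (Fun C D) (nat_weqs C D E) F p G \<Longrightarrow> zigzag D E (fob F x) (ev_zz x p) (fob G x)"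
proof (induction p arbitrary: F)
  case Nil
  then show ?case using functor_obj[OF _ x] by auto
next
  case (Cons t p)
  note h = Fun_hom_comp[OF Arr_hom x]
  show ?case
    by (cases t) (use Cons h nat_weqs_comp[OF _ x] in \<open>auto simp: hom_def\<close>)
qed

text \<open>In a commutative square whose vertical sides \<open>w\<close> and \<open>w'\<close> lie in \<open>W\<close>, these sides may be replaced
  by their inverses.\<close>

lemma zz_eq_invert_square:
  assumes C: "category C" and a: "zigzag C W x a x'" and b: "zigzag C W y b y'"
    and w: "w \<in> hom C x y" "w \<in> W" and w': "w' \<in> hom C x' y'" "w' \<in> W"
    and eq: "zz_eq C W x y' (a @ [Fwd w']) (Fwd w # b)"
  shows "zz_eq C W y x' (Bwd w # a) (b @ [Bwd w'])"
proof -
  note zw = zigzag_Bwd[OF C w] and zw' = zigzag_Bwd[OF C w'] and fw = zigzag_Fwd[OF C w(1)]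
  have n: "zigzag C W x' [] x'" "zigzag C W y [] y" using zigzag_obj[OF C a] zigzag_obj[OF C b] by auto
  have "zz_eq C W y x' (Bwd w # a) (Bwd w # a @ [Fwd w', Bwd w'])"
    using zz_eq.sym[OF zz_eq_ctx[OF zigzag_append[OF zw a] zz_eq.inv_right n(1)]] w' by auto
  moreover have "zz_eq C W y x' (Bwd w # a @ [Fwd w', Bwd w']) (Bwd w # Fwd w # b @ [Bwd w'])"
    using zz_eq_ctx[OF zw eq zw'] by simp
  moreover have "zz_eq C W y x' (Bwd w # Fwd w # b @ [Bwd w']) (b @ [Bwd w'])"
    using zz_eq_ctx[OF n(2) zz_eq.inv_left zigzag_append[OF b zw'], of w x] w by auto
  ultimately show ?thesis by (meson zz_eq.trans)
qed

lemma ev_zz_natural: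
  assumes C: "category C" and D: "category D" and f: "f \<in> hom C x y"
  shows "zigzag (Fun C D) (nat_weqs C D E) F p G \<Longrightarrow>
    zz_eq D E (fob F x) (fob G y) (ev_zz x p @ [Fwd (far G f)]) (Fwd (far F f) # ev_zz y p)"
proof (induction p arbitrary: F)
  case Nil
  then show ?case using zz_eq.refl[OF zigzag_Fwd[OF D functor_hom[OF _ f]]] by auto
next
  case (Cons t p)
  have xy: "x \<in> Obj C" "y \<in> Obj C" using cat_hom_obj[OF C f] by auto
  show ?case
  proof (cases t)
    case (Fwd \<alpha>)
    define F' where "F' = ntgt \<alpha>"
    have a: "\<alpha> \<in> hom (Fun C D) F F'" and p: "zigzag (Fun C D) (nat_weqs C D E) F' p G"
      using Cons(2) Fwd by (auto simp: hom_def F'_def)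
    note FF = Fun_homD[OF a]
    note ax = Fun_hom_comp[OF a xy(1)] and ay = Fun_hom_comp[OF a xy(2)]
    note Ff = functor_hom[OF FF(1) f] and F'f = functor_hom[OF FF(2) f]
    note zy = ev_zigzag[OF xy(2) p]
    have n: "zigzag D E (fob F x) [] (fob F x)" "zigzag D E (fob G y) [] (fob G y)"
      using zigzag_obj[OF D zy] functor_obj[OF FF(1) xy(1)] by auto
    have "zz_eq D E (fob F x) (fob G y) (Fwd (ncomp \<alpha> x) # ev_zz x p @ [Fwd (far G f)]) (Fwd (ncomp \<alpha> x) # Fwd (far F' f) # ev_zz y p)"
      using zz_eq_ctx[OF zigzag_Fwd[OF D ax] Cons(1)[OF p] n(2)] by simp
    moreover have "zz_eq D E (fob F x) (fob G y) ([Fwd (ncomp \<alpha> x), Fwd (far F' f)] @ ev_zz y p) ([Fwd (far F f), Fwd (ncomp \<alpha> y)] @ ev_zz y p)"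
      by (rule zz_eq.append[OF _ zz_eq.refl[OF zy]])
        (rule zz_eq.trans[OF zz_eq.cmp[OF ax F'f] zz_eq.sym[OF zz_eq.cmp[OF Ff ay, unfolded Fun_hom_nat[OF a f]]]])
    ultimately show ?thesis unfolding Fwd by simp (erule (1) zz_eq.trans)
  next
    case (Bwd \<alpha>)
    define F' where "F' = nsrc \<alpha>"
    have a: "\<alpha> \<in> hom (Fun C D) F' F" and ae: "\<alpha> \<in> nat_weqs C D E" and p: "zigzag (Fun C D) (nat_weqs C D E) F' p G"
      using Cons(2) Bwd by (auto simp: hom_def F'_def)
    note FF = Fun_homD[OF a]
    note ax = Fun_hom_comp[OF a xy(1)] and ay = Fun_hom_comp[OF a xy(2)]
    note Ff = functor_hom[OF FF(2) f] and F'f = functor_hom[OF FF(1) f]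
    note zy = ev_zigzag[OF xy(2) p]
    have n: "zigzag D E (fob G y) [] (fob G y)" using zigzag_obj[OF D zy] by auto
    note bx = zigzag_Bwd[OF D ax nat_weqs_comp[OF ae xy(1)]]
    have "zz_eq D E (fob F x) (fob G y) (Bwd (ncomp \<alpha> x) # ev_zz x p @ [Fwd (far G f)]) (Bwd (ncomp \<alpha> x) # Fwd (far F' f) # ev_zz y p)"
      using zz_eq_ctx[OF bx Cons(1)[OF p] n] by simp
    moreover have "zz_eq D E (fob F x) (fob G y) ([Bwd (ncomp \<alpha> x), Fwd (far F' f)] @ ev_zz y p) ([Fwd (far F f), Bwd (ncomp \<alpha> y)] @ ev_zz y p)"
    proof (rule zz_eq.append[OF _ zz_eq.refl[OF zy]])
      have "zz_eq D E (fob F x) (fob F' y) (Bwd (ncomp \<alpha> x) # [Fwd (far F' f)]) ([Fwd (far F f)] @ [Bwd (ncomp \<alpha> y)])"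
        by (rule zz_eq_invert_square[OF D zigzag_Fwd[OF D F'f] zigzag_Fwd[OF D Ff] ax nat_weqs_comp[OF ae xy(1)] ay nat_weqs_comp[OF ae xy(2)]])
         (use zz_eq.trans[OF zz_eq.cmp[OF F'f ay, unfolded Fun_hom_nat[OF a f]] zz_eq.sym[OF zz_eq.cmp[OF ax Ff]]] in simp)
      then show "zz_eq D E (fob F x) (fob F' y) [Bwd (ncomp \<alpha> x), Fwd (far F' f)] [Fwd (far F f), Bwd (ncomp \<alpha> y)]" by simp
    qed
    ultimately show ?thesis unfolding Bwd by simp (erule (1) zz_eq.trans)
  qed
qed

text \<open>Naturality extends from the arrows of \<open>C\<close> to those of \<open>C[W\<^sup>-\<^sup>1]\<close>.\<close>

lemma ev_zz_natural_loc:
  assumes C: "category C" and D: "category D" and F: "rel_functor C W D E F" and G: "rel_functor C W D E G"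
    and p: "zigzag (Fun C D) (nat_weqs C D E) F p G"
  shows "zigzag C W x q y \<Longrightarrow> zz_eq D E (fob F x) (fob G y)
     (ev_zz x p @ map (map_step (far G)) q) (map (map_step (far F)) q @ ev_zz y p)"
proof (induction q arbitrary: x)
  case Nil
  then show ?case using zz_eq.refl[OF ev_zigzag[OF _ p]] by auto
next
  case (Cons t q)
  have "\<exists>z. zigzag C W x [t] z \<and> zigzag C W z q y \<and> z \<in> Obj C \<and> x \<in> Obj C"
    using Cons(2) category.dom_obj[OF C] category.cod_obj[OF C] by (cases t) auto
  then obtain z where z: "zigzag C W x [t] z" "zigzag C W z q y" "z \<in> Obj C" "x \<in> Obj C" by blast
  note zt = rel_functor_zigzag[OF F z(1)] and zq = rel_functor_zigzag[OF G z(2)]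
  have "zz_eq D E (fob F x) (fob G z)
     (ev_zz x p @ map (map_step (far G)) [t]) (map (map_step (far F)) [t] @ ev_zz z p)"
  proof (cases t)
    case (Fwd f)
    then have "f \<in> hom C x z" using z by (auto simp: hom_def)
    then show ?thesis using ev_zz_natural[OF C D _ p] Fwd by auto
  next
    case (Bwd w)
    then have w: "w \<in> hom C z x" "w \<in> W" using z by (auto simp: hom_def)
    note Fw = functor_hom[OF rel_functorD[OF F] w(1)] rel_functor_weq[OF F w]
    note Gw = functor_hom[OF rel_functorD[OF G] w(1)] rel_functor_weq[OF G w]
    show ?thesis
      using zz_eq.sym[OF zz_eq_invert_square[OF D ev_zigzag[OF z(3) p] ev_zigzag[OF z(4) p] Fw Gw ev_zz_natural[OF C D w(1) p]]] Bwd by simp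
  qed
  then have "zz_eq D E (fob F x) (fob G y) ((ev_zz x p @ map (map_step (far G)) [t]) @ map (map_step (far G)) q)
      ((map (map_step (far F)) [t] @ ev_zz z p) @ map (map_step (far G)) q)"
    by (rule zz_eq.append[OF _ zz_eq.refl[OF zq]])
  moreover have "zz_eq D E (fob F x) (fob G y) (map (map_step (far F)) [t] @ ev_zz z p @ map (map_step (far G)) q)
      (map (map_step (far F)) [t] @ map (map_step (far F)) q @ ev_zz y p)"
    by (rule zz_eq.append[OF zz_eq.refl[OF zt] Cons(1)[OF z(2)]])
  ultimately show ?case by simp (erule (1) zz_eq.trans)
qed

text \<open>The natural transformation between induced functors given by a zigzag of natural transformations
  whose backward steps are objectwise in \<open>E\<close>.\<close>

definition loc_nt where
  "loc_nt C W D E F p G = mk_nt (Loc C W) (Loc_fun C W D E F) (Loc_fun C W D E G)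
     (\<lambda>x. loc_class D E (fob F x) (ev_zz x p) (fob G x))"

lemma loc_nt_hom:
  assumes C: "category C" and D: "category D" and F: "rel_functor C W D E F" and G: "rel_functor C W D E G"
    and p: "zigzag (Fun C D) (nat_weqs C D E) F p G"
  shows "loc_nt C W D E F p G \<in> hom (Fun (Loc C W) (Loc D E)) (Loc_fun C W D E F) (Loc_fun C W D E G)"
  unfolding loc_nt_def
proof (rule mk_nt_hom[OF category_Loc[OF C] Loc_functor[OF C D F] Loc_functor[OF C D G]])
  fix f x y assume "f \<in> hom (Loc C W) x y"
  then obtain q where q: "f = loc_class C W x q y" "zigzag C W x q y" by (auto simp: hom_Loc)
  have xy: "x \<in> Obj C" "y \<in> Obj C" using zigzag_obj[OF C q(2)] by auto
  show "Cmp (Loc D E) (loc_class D E (fob F y) (ev_zz y p) (fob G y)) (far (Loc_fun C W D E F) f) =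
    Cmp (Loc D E) (far (Loc_fun C W D E G) f) (loc_class D E (fob F x) (ev_zz x p) (fob G x))"
    using loc_class_eqI[OF ev_zz_natural_loc[OF C D F G p q(2)]]
    by (simp add: q Loc_fun_class[OF C F] Loc_fun_class[OF C G] Cmp_Loc rel_functor_zigzag[OF F q(2)]
        rel_functor_zigzag[OF G q(2)] ev_zigzag[OF _ p] xy)
qed (auto intro: hom_LocI ev_zigzag[OF _ p])

lemma zigzag_iso:
  assumes C: "category C"
  shows "zigzag C W x p y \<Longrightarrow> \<forall>t \<in> set p. set_step t \<subseteq> W \<Longrightarrow> is_iso (Loc C W) (loc_class C W x p y)"
proof (induction p arbitrary: x)
  case Nil
  then show ?case using iso_id[OF category_Loc[OF C], of x W] by auto
next
  case (Cons t q)
  have "\<exists>z. zigzag C W x [t] z \<and> zigzag C W z q y \<and> z \<in> Obj C \<and> x \<in> Obj C"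
    using Cons(2) category.dom_obj[OF C] category.cod_obj[OF C] by (cases t) auto
  then obtain z where z: "zigzag C W x [t] z" "zigzag C W z q y" "z \<in> Obj C" "x \<in> Obj C" by blast
  have "is_iso (Loc C W) (loc_class C W x [t] z)"
  proof (cases t)
    case (Fwd f)
    then have "f \<in> hom C x z" "f \<in> W" using z Cons(3) by (auto simp: hom_def)
    then show ?thesis using loc_of_iso[OF C] Fwd by (auto simp: loc_of_class)
  next
    case (Bwd w)
    then have w: "w \<in> hom C z x" "w \<in> W" using z by (auto simp: hom_def)
    show ?thesis unfolding Bwd
      by (rule iso_inverse[OF loc_of_hom[OF C w(1)] hom_LocI[OF zigzag_Bwd[OF C w]]])
       (use w in \<open>simp_all add: loc_of_class Cmp_Loc[OF zigzag_Bwd[OF C w] zigzag_Fwd[OF C w(1)]] Cmp_Loc[OF zigzag_Fwd[OF C w(1)] zigzag_Bwd[OF C w]]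
     loc_class_eqI[OF zz_eq.inv_left] loc_class_eqI[OF zz_eq.inv_right]\<close>)
  qed
  then show ?case
    using iso_cmp[OF category_Loc[OF C] hom_LocI[OF z(1)] hom_LocI[OF z(2)]] Cons(1)[OF z(2)] Cons(3) Cmp_Loc[OF z(1,2)] by simp
qed

lemma weq_zigzagD: "weq_zigzag C D E F p G \<Longrightarrow> zigzag (Fun C D) (nat_weqs C D E) F p G"
  by (simp add: weq_zigzag_def)

lemma set_ev_zz: "t \<in> set (ev_zz x p) \<Longrightarrow> \<exists>t' \<in> set p. set_step t = (\<lambda>\<alpha>. ncomp \<alpha> x) ` set_step t'"
  by (auto simp: ev_zz_def step.set_map)

lemma weq_zigzag_iso:
  assumes D: "category D" and p: "weq_zigzag C D E F p G" and x: "x \<in> Obj C"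
  shows "is_iso (Loc D E) (loc_class D E (fob F x) (ev_zz x p) (fob G x))"
  by (rule zigzag_iso[OF D ev_zigzag[OF x weq_zigzagD[OF p]]])
   (use p nat_weqs_comp[OF _ x] in \<open>fastforce simp: weq_zigzag_def dest: set_ev_zz\<close>)

lemma weq_zigzag_isomorphic:
  assumes C: "category C" and D: "category D" and F: "rel_functor C W D E F" and G: "rel_functor C W D E G"
    and p: "weq_zigzag C D E F p G"
  shows "isomorphic (Fun (Loc C W) (Loc D E)) (Loc_fun C W D E F) (Loc_fun C W D E G)"
proof -
  note h = loc_nt_hom[OF C D F G weq_zigzagD[OF p]]
  have "is_iso (Fun (Loc C W) (Loc D E)) (loc_nt C W D E F p G)"
    by (rule Fun_iso[OF category_Loc[OF C] category_Loc[OF D] h])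
     (simp add: loc_nt_def weq_zigzag_iso[OF D p])
  then show ?thesis using h by (auto simp: isomorphic_def)
qed

lemma weq_zigzag_transfer:
  assumes C: "category C" and D: "category D" and E: "saturated D E" and f: "f \<in> hom C x y"
    and p: "weq_zigzag C D E F p G"
  shows "far F f \<in> E \<longleftrightarrow> far G f \<in> E"
proof -
  have xy: "x \<in> Obj C" "y \<in> Obj C" using cat_hom_obj[OF C f] by auto
  note zx = ev_zigzag[OF xy(1) weq_zigzagD[OF p]] and zy = ev_zigzag[OF xy(2) weq_zigzagD[OF p]]
  have FG: "is_functor C D F" "is_functor C D G"
    using zigzag_obj[OF category_Fun[OF C D] weq_zigzagD[OF p]] by auto
  note Ff = functor_hom[OF FG(1) f] and Gf = functor_hom[OF FG(2) f] and L = category_Loc[OF D, of E]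
  have "Cmp (Loc D E) (loc_of D E (far G f)) (loc_class D E (fob F x) (ev_zz x p) (fob G x)) =
     Cmp (Loc D E) (loc_class D E (fob F y) (ev_zz y p) (fob G y)) (loc_of D E (far F f))"
    using loc_class_eqI[OF ev_zz_natural[OF C D f weq_zigzagD[OF p]]]
    by (simp add: loc_of_class[OF Ff] loc_of_class[OF Gf] Cmp_Loc[OF zx zigzag_Fwd[OF D Gf]] Cmp_Loc[OF zigzag_Fwd[OF D Ff] zy])
  then show ?thesis
    unfolding saturated_iff[OF D E Ff] saturated_iff[OF D E Gf]
    using iso_cmp[OF L loc_of_hom[OF D Ff] hom_LocI[OF zy] _ weq_zigzag_iso[OF D p xy(2)]]
      iso_cmp[OF L hom_LocI[OF zx] loc_of_hom[OF D Gf] weq_zigzag_iso[OF D p xy(1)]]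
      iso_cancel_left[OF L loc_of_hom[OF D Ff] hom_LocI[OF zy] weq_zigzag_iso[OF D p xy(2)]]
      iso_cancel_right[OF L hom_LocI[OF zx] loc_of_hom[OF D Gf] weq_zigzag_iso[OF D p xy(1)]]
    by metis
qed

fun rev_step where "rev_step (Fwd a) = Bwd a" | "rev_step (Bwd a) = Fwd a"

lemma rev_zigzag:
  assumes C: "category C"
  shows "zigzag C W x p y \<Longrightarrow> \<forall>t \<in> set p. set_step t \<subseteq> W \<Longrightarrow> zigzag C W y (rev (map rev_step p)) x"
proof (induction p arbitrary: x)
  case (Cons t p)
  then show ?case
    by (cases t) (auto intro!: zigzag_append dest: category.dom_obj[OF C] category.cod_obj[OF C])
qed auto

subsection \<open>Zigzags of weak equivalences\<close>

lemma set_rev_step [simp]: "set_step (rev_step t) = set_step t"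
  by (cases t) auto

lemma weq_zigzag_simps [simp]:
  "weq_zigzag C D E F [] G \<longleftrightarrow> is_functor C D F \<and> F = G"
  "weq_zigzag C D E F (Fwd \<alpha> # p) G \<longleftrightarrow> \<alpha> \<in> nat_weqs C D E \<and> nsrc \<alpha> = F \<and> weq_zigzag C D E (ntgt \<alpha>) p G"
  "weq_zigzag C D E F (Bwd \<alpha> # p) G \<longleftrightarrow> \<alpha> \<in> nat_weqs C D E \<and> ntgt \<alpha> = F \<and> weq_zigzag C D E (nsrc \<alpha>) p G"
  by (auto simp: weq_zigzag_def nat_weqs_def)

lemma nat_weqs_mono: "E \<subseteq> E' \<Longrightarrow> nat_weqs C D E \<subseteq> nat_weqs C D E'"
  by (auto simp: nat_weqs_def)

lemma weq_zigzag_mono: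
  assumes "E \<subseteq> E'"
  shows "weq_zigzag C D E F p G \<Longrightarrow> weq_zigzag C D E' F p G"
proof (induction p arbitrary: F)
  case (Cons t p)
  then show ?case using nat_weqs_mono[OF assms, of C D] by (cases t) auto
qed simp

lemma post_nat_weqs:
  assumes J: "category J" and C: "category C" and D: "category D" and a: "\<alpha> \<in> nat_weqs C D E"
  shows "post_ntrans J C \<alpha> \<in> nat_weqs (Fun J C) (Fun J D) (nat_weqs J D E)"
proof -
  have h: "\<alpha> \<in> hom (Fun C D) (nsrc \<alpha>) (ntgt \<alpha>)" using a by (simp add: nat_weqs_def hom_def)
  show ?thesis
  proof (rule nat_weqsI[OF post_ntrans_hom[OF J C D h]])
    fix X assume "X \<in> Obj (Fun J C)"
    then have X: "is_functor J C X" by simp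
    have "whisker_right J \<alpha> X \<in> nat_weqs J D E"
      by (rule nat_weqsI[OF whisker_right_hom[OF J X h]]) (use a functor_obj[OF X] in \<open>simp add: nat_weqs_def\<close>)
    then show "ncomp (post_ntrans J C \<alpha>) X \<in> nat_weqs J D E" using X by simp
  qed
qed

lemma post_ntrans_ends [simp]:
  "nsrc (post_ntrans J C \<alpha>) = post_fun J C (nsrc \<alpha>)" "ntgt (post_ntrans J C \<alpha>) = post_fun J C (ntgt \<alpha>)"
  by (simp_all add: post_ntrans_def)

lemma post_weq_zigzag:
  assumes J: "category J" and C: "category C" and D: "category D"
  shows "weq_zigzag C D E F p G \<Longrightarrow> weq_zigzag (Fun J C) (Fun J D) (nat_weqs J D E)
     (post_fun J C F) (map (map_step (post_ntrans J C)) p) (post_fun J C G)"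
proof (induction p arbitrary: F)
  case Nil
  then show ?case using post_functor[OF J C] by auto
next
  case (Cons t p)
  then show ?case using Cons post_nat_weqs[OF J C D] by (cases t) auto
qed

lemma ev_zz_weqs:
  assumes "\<forall>t \<in> set p. set_step t \<subseteq> nat_weqs C D E" "x \<in> Obj C"
  shows "\<forall>t \<in> set (ev_zz x p). set_step t \<subseteq> E"
  using assms nat_weqs_comp by (fastforce dest: set_ev_zz)

section \<open>The simplex category\<close>

text \<open>The arrow \<open>[m] \<rightarrow> [n]\<close> with underlying function \<open>f\<close>; conversely \<open>dfun\<close> is the underlying function.\<close>

definition dmap :: "nat \<Rightarrow> nat \<Rightarrow> (nat \<Rightarrow> nat) \<Rightarrow> delta_arr" where
  "dmap m n f = (m, n, \<lambda>i \<in> {0..m}. f i)"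

abbreviation dfun :: "delta_arr \<Rightarrow> nat \<Rightarrow> nat" where
  "dfun \<theta> \<equiv> snd (snd \<theta>)"

lemma Obj_Delta [simp]: "Obj Delta = UNIV"
  by (simp add: Delta_def)

lemma dmap_hom:
  assumes "\<And>i. i \<le> m \<Longrightarrow> f i \<le> n" "\<And>i j. i \<le> j \<Longrightarrow> j \<le> m \<Longrightarrow> f i \<le> f j"
  shows "dmap m n f \<in> hom Delta m n"
  using assms by (auto simp: dmap_def hom_def Delta_def mono_on_def)

lemma hom_DeltaE:
  assumes "\<theta> \<in> hom Delta m n"
  shows "\<theta> = dmap m n (dfun \<theta>)" "\<And>i. i \<le> m \<Longrightarrow> dfun \<theta> i \<le> n"
    "\<And>i j. i \<le> j \<Longrightarrow> j \<le> m \<Longrightarrow> dfun \<theta> i \<le> dfun \<theta> j"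
  using assms by (auto simp: dmap_def hom_def Delta_def mono_on_def PiE_def extensional_restrict)

lemma dfun_dmap [simp]: "i \<le> m \<Longrightarrow> dfun (dmap m n f) i = f i"
  by (simp add: dmap_def)

lemma Delta_eqI:
  assumes "\<theta> \<in> hom Delta m n" "\<phi> \<in> hom Delta m n" "\<And>i. i \<le> m \<Longrightarrow> dfun \<theta> i = dfun \<phi> i"
  shows "\<theta> = \<phi>"
proof -
  have "dmap m n (dfun \<theta>) = dmap m n (dfun \<phi>)"
    using assms(3) by (auto simp: dmap_def intro: restrict_ext)
  then show ?thesis using hom_DeltaE(1)[OF assms(1)] hom_DeltaE(1)[OF assms(2)] by simp
qed

lemma Ident_Delta: "Ident Delta n = dmap n n (\<lambda>i. i)"
  by (simp add: Delta_def dmap_def)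

lemma Cmp_Delta: "\<theta> \<in> hom Delta l m \<Longrightarrow> \<phi> \<in> hom Delta m n \<Longrightarrow> Cmp Delta \<phi> \<theta> = dmap l n (\<lambda>i. dfun \<phi> (dfun \<theta> i))"
  by (auto simp: Delta_def dmap_def hom_def)

lemma category_Delta: "category Delta"
proof
  have 1: "Cmp Delta g f \<in> hom Delta x z" if "f \<in> hom Delta x y" "g \<in> hom Delta y z" for f g x y z
    using that hom_DeltaE[OF that(1)] hom_DeltaE[OF that(2)] by (simp add: Cmp_Delta dmap_hom)
  have 2: "Ident Delta x \<in> hom Delta x x" for x by (simp add: Ident_Delta dmap_hom)
  show "f \<in> hom Delta x y \<Longrightarrow> g \<in> hom Delta y z \<Longrightarrow> Cmp Delta g f \<in> hom Delta x z" for f g x y z by (rule 1)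
  show "Ident Delta x \<in> hom Delta x x" for x by (rule 2)
  show "Cmp Delta h (Cmp Delta g f) = Cmp Delta (Cmp Delta h g) f"
    if "f \<in> hom Delta w x" "g \<in> hom Delta x y" "h \<in> hom Delta y z" for f g h w x y z
    by (rule Delta_eqI[of _ w z])
      (use that 1[OF that(1,2)] 1[OF that(2,3)] 1[OF 1[OF that(1,2)] that(3)] 1[OF that(1) 1[OF that(2,3)]]
        hom_DeltaE(2)[OF that(1)] in \<open>simp_all add: Cmp_Delta\<close>)
  show "Cmp Delta (Ident Delta y) f = f" "Cmp Delta f (Ident Delta x) = f" if "f \<in> hom Delta x y" for f x y
    by (rule Delta_eqI[of _ x y];
       use that 1[OF that 2] 1[OF 2 that] hom_DeltaE[OF that] in \<open>simp add: Cmp_Delta[OF that 2] Cmp_Delta[OF 2 that]\<close>; simp add: Ident_Delta)+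
qed simp_all

lemma dfun_Cmp: "\<theta> \<in> hom Delta l m \<Longrightarrow> \<phi> \<in> hom Delta m n \<Longrightarrow> i \<le> l \<Longrightarrow> dfun (Cmp Delta \<phi> \<theta>) i = dfun \<phi> (dfun \<theta> i)"
  by (simp add: Cmp_Delta)

lemma dfun_Ident [simp]: "i \<le> n \<Longrightarrow> dfun (Ident Delta n) i = i"
  by (simp add: Ident_Delta)

lemmas Delta_id = cat_id[OF category_Delta, simplified]
lemmas Delta_cmp = cat_cmp[OF category_Delta]

lemma finite_hom_Delta: "finite (hom Delta m n)"
proof (rule finite_subset)
  show "hom Delta m n \<subseteq> {m} \<times> {n} \<times> ({0..m} \<rightarrow>\<^sub>E {0..n})" by (auto simp: hom_def Delta_def)
qed (intro finite_cartesian_product finite_PiE, auto)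

abbreviation op_Delta :: "(nat, delta_arr) cat" where "op_Delta \<equiv> op_cat Delta"

lemma cat_op: "category op_Delta"
  by (rule category_op[OF category_Delta])

lemma category_Simp: "category D \<Longrightarrow> category (Simp D)"
  by (rule category_Fun[OF cat_op])

section \<open>Restriction along a family of functors\<close>

text \<open>A functor \<open>K : I \<rightarrow> Fun J M\<close> turns a diagram \<open>X\<close> of shape \<open>M\<close> into the diagram
  \<open>i \<mapsto> (j \<mapsto> X(K(i)(j)))\<close> of shape \<open>I\<close> in \<open>Fun J D\<close>. This is functorial in \<open>X\<close> (\<open>res_fun\<close>) and in \<open>K\<close>
  (\<open>res_nt\<close>).\<close>

definition res_obj :: "('i, 'l) cat \<Rightarrow> ('j, 'k) cat \<Rightarrow> ('m, 'n) cat \<Rightarrow>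
    ('i, 'l, ('j, 'k, 'm, 'n) fctr, ('j, 'k, 'm, 'n) ntrans) fctr \<Rightarrow> ('m, 'n, 'o, 'a) fctr \<Rightarrow>
    ('i, 'l, ('j, 'k, 'o, 'a) fctr, ('j, 'k, 'o, 'a) ntrans) fctr" where
  "res_obj I J M K X = comp_fun I (post_fun J M X) K"

definition res_fun :: "('i, 'l) cat \<Rightarrow> ('j, 'k) cat \<Rightarrow> ('m, 'n) cat \<Rightarrow> ('o, 'a) cat \<Rightarrow>
    ('i, 'l, ('j, 'k, 'm, 'n) fctr, ('j, 'k, 'm, 'n) ntrans) fctr \<Rightarrow>
    (('m, 'n, 'o, 'a) fctr, ('m, 'n, 'o, 'a) ntrans,
     ('i, 'l, ('j, 'k, 'o, 'a) fctr, ('j, 'k, 'o, 'a) ntrans) fctr,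
     ('i, 'l, ('j, 'k, 'o, 'a) fctr, ('j, 'k, 'o, 'a) ntrans) ntrans) fctr" where
  "res_fun I J M D K = \<lparr>fob = (\<lambda>X \<in> Obj (Fun M D). res_obj I J M K X),
     far = (\<lambda>\<xi> \<in> Arr (Fun M D). whisker_right I (post_ntrans J M \<xi>) K)\<rparr>"

lemma res_fun_simps [simp]:
  "is_functor M D X \<Longrightarrow> fob (res_fun I J M D K) X = res_obj I J M K X"
  "is_ntrans M D \<xi> \<Longrightarrow> far (res_fun I J M D K) \<xi> = whisker_right I (post_ntrans J M \<xi>) K"
  by (simp_all add: res_fun_def)

lemma res_obj_functor:
  assumes "category I" "category J" "category M" "is_functor I (Fun J M) K" "is_functor M D X"
  shows "is_functor I (Fun J D) (res_obj I J M K X)"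
  unfolding res_obj_def using assms by (intro comp_functor[OF _ _ post_functor])

lemma res_fun_hom:
  assumes "category I" "category J" "category M" "category D" "is_functor I (Fun J M) K"
    and "\<xi> \<in> hom (Fun M D) X Y"
  shows "whisker_right I (post_ntrans J M \<xi>) K \<in> hom (Fun I (Fun J D)) (res_obj I J M K X) (res_obj I J M K Y)"
  unfolding res_obj_def using assms by (intro whisker_right_hom[OF _ _ post_ntrans_hom])

lemma res_fun_comp:
  assumes K: "is_functor I (Fun J M) K" and x: "\<xi> \<in> hom (Fun M D) X Y" and i: "i \<in> Obj I"
  shows "ncomp (whisker_right I (post_ntrans J M \<xi>) K) i = whisker_right J \<xi> (fob K i)"
  using functor_obj[OF K i] i by simp

lemma res_functor:
  assumes I: "category I" and J: "category J" and M: "category M" and D: "category D"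
    and K: "is_functor I (Fun J M) K"
  shows "is_functor (Fun M D) (Fun I (Fun J D)) (res_fun I J M D K)"
proof (rule is_functorI)
  show "fob (res_fun I J M D K) \<in> extensional (Obj (Fun M D))" "far (res_fun I J M D K) \<in> extensional (Arr (Fun M D))"
    by (auto simp: res_fun_def)
next
  note MD = category_Fun[OF M D] and JD = category_Fun[OF J D] and IJD = category_Fun[OF I category_Fun[OF J D]]
  note Kf = functor_obj[OF K, simplified]
  {
    fix X assume "X \<in> Obj (Fun M D)"
    then have X: "is_functor M D X" by simp
    show "fob (res_fun I J M D K) X \<in> Obj (Fun I (Fun J D))"
      using res_obj_functor[OF I J M K X] X by simp
    have 1: "Ident (Fun M D) X \<in> hom (Fun M D) X X" using cat_id[OF MD] X by simp
    have "whisker_right I (post_ntrans J M (Ident (Fun M D) X)) K = Ident (Fun I (Fun J D)) (res_obj I J M K X)"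
    proof (rule Fun_hom_eqI[OF res_fun_hom[OF I J M D K 1] cat_id[OF IJD]])
      show "res_obj I J M K X \<in> Obj (Fun I (Fun J D))" using res_obj_functor[OF I J M K X] by simp
      fix i assume i: "i \<in> Obj I"
      note Ki = Kf[OF i]
      have "whisker_right J (Ident (Fun M D) X) (fob K i) = Ident (Fun J D) (comp_fun J X (fob K i))"
        by (rule Fun_hom_eqI[OF whisker_right_hom[OF J Ki 1] cat_id[OF JD]])
          (use comp_functor[OF J Ki X] functor_obj[OF Ki] in simp_all)
      then show "ncomp (whisker_right I (post_ntrans J M (Ident (Fun M D) X)) K) i = ncomp (Ident (Fun I (Fun J D)) (res_obj I J M K X)) i"
        using i Ki res_fun_comp[OF K 1 i] by (simp add: res_obj_def)
    qed
    then show "far (res_fun I J M D K) (Ident (Fun M D) X) = Ident (Fun I (Fun J D)) (fob (res_fun I J M D K) X)"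
      using X Fun_homD(5)[OF 1] by simp
  next
    fix \<xi> X Y assume x: "\<xi> \<in> hom (Fun M D) X Y"
    show "far (res_fun I J M D K) \<xi> \<in> hom (Fun I (Fun J D)) (fob (res_fun I J M D K) X) (fob (res_fun I J M D K) Y)"
      using res_fun_hom[OF I J M D K x] Fun_homD[OF x] by simp
  next
    fix \<xi> \<zeta> X Y Z assume x: "\<xi> \<in> hom (Fun M D) X Y" and z: "\<zeta> \<in> hom (Fun M D) Y Z"
    note zx = cat_cmp[OF MD x z]
    have "whisker_right I (post_ntrans J M (Cmp (Fun M D) \<zeta> \<xi>)) K = Cmp (Fun I (Fun J D))
       (whisker_right I (post_ntrans J M \<zeta>) K) (whisker_right I (post_ntrans J M \<xi>) K)"
    proof (rule Fun_hom_eqI[OF res_fun_hom[OF I J M D K zx] cat_cmp[OF IJD res_fun_hom[OF I J M D K x] res_fun_hom[OF I J M D K z]]])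
      fix i assume i: "i \<in> Obj I"
      note Ki = Kf[OF i]
      have "whisker_right J (Cmp (Fun M D) \<zeta> \<xi>) (fob K i) = Cmp (Fun J D) (whisker_right J \<zeta> (fob K i)) (whisker_right J \<xi> (fob K i))"
        by (rule Fun_hom_eqI[OF whisker_right_hom[OF J Ki zx]
              cat_cmp[OF JD whisker_right_hom[OF J Ki x] whisker_right_hom[OF J Ki z]]])
          (use functor_obj[OF Ki] in simp)
      then show "ncomp (whisker_right I (post_ntrans J M (Cmp (Fun M D) \<zeta> \<xi>)) K) i =
          ncomp (Cmp (Fun I (Fun J D)) (whisker_right I (post_ntrans J M \<zeta>) K) (whisker_right I (post_ntrans J M \<xi>) K)) i"
        using i Ki by simp
    qed
    then show "far (res_fun I J M D K) (Cmp (Fun M D) \<zeta> \<xi>) = Cmp (Fun I (Fun J D)) (far (res_fun I J M D K) \<zeta>) (far (res_fun I J M D K) \<xi>)"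
      using Fun_homD(5)[OF x] Fun_homD(5)[OF z] Fun_homD(5)[OF zx] by simp
  }
qed

definition res_nt :: "('i, 'l) cat \<Rightarrow> ('j, 'k) cat \<Rightarrow> ('m, 'n) cat \<Rightarrow> ('o, 'a) cat \<Rightarrow>
    ('i, 'l, ('j, 'k, 'm, 'n) fctr, ('j, 'k, 'm, 'n) ntrans) ntrans \<Rightarrow>
    (('m, 'n, 'o, 'a) fctr, ('m, 'n, 'o, 'a) ntrans,
     ('i, 'l, ('j, 'k, 'o, 'a) fctr, ('j, 'k, 'o, 'a) ntrans) fctr,
     ('i, 'l, ('j, 'k, 'o, 'a) fctr, ('j, 'k, 'o, 'a) ntrans) ntrans) ntrans" where
  "res_nt I J M D \<kappa> = mk_nt (Fun M D) (res_fun I J M D (nsrc \<kappa>)) (res_fun I J M D (ntgt \<kappa>))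
     (\<lambda>X. whisker_left I (post_fun J M X) \<kappa>)"

lemma res_nt_comp [simp]: "is_functor M D X \<Longrightarrow> ncomp (res_nt I J M D \<kappa>) X = whisker_left I (post_fun J M X) \<kappa>"
  by (simp add: res_nt_def)

lemma res_nt_hom:
  assumes I: "category I" and J: "category J" and M: "category M" and D: "category D"
    and k: "\<kappa> \<in> hom (Fun I (Fun J M)) K L"
  shows "res_nt I J M D \<kappa> \<in> hom (Fun (Fun M D) (Fun I (Fun J D))) (res_fun I J M D K) (res_fun I J M D L)"
  unfolding res_nt_def Fun_homD(3,4)[OF k]
proof (rule mk_nt_hom[OF category_Fun[OF M D]])
  note K = Fun_homD(1)[OF k] and L = Fun_homD(2)[OF k]
  note JD = category_Fun[OF J D] and IJD = category_Fun[OF I category_Fun[OF J D]]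
  show "is_functor (Fun M D) (Fun I (Fun J D)) (res_fun I J M D K)"
    "is_functor (Fun M D) (Fun I (Fun J D)) (res_fun I J M D L)"
    using I J M D K L by (simp_all add: res_functor)
  have h: "whisker_left I (post_fun J M X) \<kappa> \<in> hom (Fun I (Fun J D)) (res_obj I J M K X) (res_obj I J M L X)"
    if "is_functor M D X" for X
    unfolding res_obj_def by (rule whisker_left_hom[OF I post_functor[OF J M that] k])
  show "whisker_left I (post_fun J M X) \<kappa> \<in> hom (Fun I (Fun J D)) (fob (res_fun I J M D K) X) (fob (res_fun I J M D L) X)"
    if "X \<in> Obj (Fun M D)" for X using that h by simp
  fix \<xi> X Y assume x: "\<xi> \<in> hom (Fun M D) X Y"
  note XY = Fun_homD[OF x]
  have "Cmp (Fun I (Fun J D)) (whisker_left I (post_fun J M Y) \<kappa>) (whisker_right I (post_ntrans J M \<xi>) K) =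
    Cmp (Fun I (Fun J D)) (whisker_right I (post_ntrans J M \<xi>) L) (whisker_left I (post_fun J M X) \<kappa>)"
  proof (rule Fun_hom_eqI[OF cat_cmp[OF IJD res_fun_hom[OF I J M D K x] h[OF XY(2)]] cat_cmp[OF IJD h[OF XY(1)] res_fun_hom[OF I J M D L x]]])
    fix i assume i: "i \<in> Obj I"
    note ki = Fun_hom_comp[OF k i]
    note KL = Fun_homD[OF ki]
    have "Cmp (Fun J D) (whisker_left J Y (ncomp \<kappa> i)) (whisker_right J \<xi> (fob K i)) =
       Cmp (Fun J D) (whisker_right J \<xi> (fob L i)) (whisker_left J X (ncomp \<kappa> i))"
      by (rule Fun_hom_eqI[OF cat_cmp[OF JD whisker_right_hom[OF J KL(1) x] whisker_left_hom[OF J XY(2) ki]]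
            cat_cmp[OF JD whisker_left_hom[OF J XY(1) ki] whisker_right_hom[OF J KL(2) x]]])
         (simp add: Fun_hom_nat[OF x Fun_hom_comp[OF ki]])
    then show "ncomp (Cmp (Fun I (Fun J D)) (whisker_left I (post_fun J M Y) \<kappa>) (whisker_right I (post_ntrans J M \<xi>) K)) i =
      ncomp (Cmp (Fun I (Fun J D)) (whisker_right I (post_ntrans J M \<xi>) L) (whisker_left I (post_fun J M X) \<kappa>)) i"
      using i KL by simp
  qed
  then show "Cmp (Fun I (Fun J D)) (whisker_left I (post_fun J M Y) \<kappa>) (far (res_fun I J M D K) \<xi>) =
    Cmp (Fun I (Fun J D)) (far (res_fun I J M D L) \<xi>) (whisker_left I (post_fun J M X) \<kappa>)"
    using XY by simp
qed

lemma comp_const: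
  assumes I: "category I" and C: "category C" and G: "is_functor C D G" and x: "x \<in> Obj C" and D: "category D"
  shows "comp_fun I G (const_obj I C x) = const_obj I D (fob G x)"
  by (rule functor_eqI[OF comp_functor[OF I const_obj_functor[OF I C x] G] const_obj_functor[OF I D functor_obj[OF G x]]])
    (use G x in \<open>auto simp: functor_id hom_Arr\<close>)

lemma whisker_left_const:
  assumes J: "category J" and C: "category C" and G: "is_functor C D G" and D: "category D" and f: "f \<in> hom C x y"
  shows "whisker_left J G (mk_nt J (const_obj J C x) (const_obj J C y) (\<lambda>i. f)) =
     mk_nt J (const_obj J D (fob G x)) (const_obj J D (fob G y)) (\<lambda>i. far G f)"
  using cat_hom_obj[OF C f]
  by (auto simp: whisker_left_mk comp_const[OF J C G _ D] intro!: mk_nt_cong)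

lemma comp_fun_const_fun:
  assumes J: "category J" and C: "category C" and D: "category D" and G: "is_functor C D G"
  shows "comp_fun C (post_fun J C G) (const_fun J C) = comp_fun C (const_fun J D) G"
  apply (rule functor_eqI[OF comp_functor[OF C const_functor[OF J C] post_functor[OF J C G]] comp_functor[OF C G const_functor[OF J D]]])
  subgoal for x by (simp add: const_obj_functor[OF J C] comp_const[OF J C G _ D] functor_obj[OF G])
  subgoal for f x y using Fun_homD(5)[OF functor_hom[OF const_functor[OF J C], of f x y]]
    by (simp add: hom_Arr whisker_left_const[OF J C G D] const_fun_simps(2)[OF functor_hom[OF G]])
  done

lemma whisker_right_const:
  assumes J: "category J" and M: "category M" and D: "category D" and x: "\<xi> \<in> hom (Fun M D) X Y" and i: "i \<in> Obj M"
  shows "whisker_right J \<xi> (const_obj J M i) = mk_nt J (const_obj J D (fob X i)) (const_obj J D (fob Y i)) (\<lambda>_. ncomp \<xi> i)"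
  unfolding whisker_right_mk Fun_homD(3,4)[OF x] comp_const[OF J M Fun_homD(1)[OF x] i D] comp_const[OF J M Fun_homD(2)[OF x] i D]
  by (auto intro!: mk_nt_cong)

text \<open>Restriction along the two projections \<open>(i, j) \<mapsto> i\<close> and \<open>(i, j) \<mapsto> j\<close>. On simplicial objects they
  are \<open>X \<mapsto> X \<times> \<Delta>\<close> and \<open>X \<mapsto> \<Delta> \<times> X\<close>.\<close>

lemma res_const_fun:
  assumes J: "category J" and M: "category M" and D: "category D"
  shows "res_fun M J M D (const_fun J M) = post_fun M D (const_fun J D)"
proof (rule functor_eqI[OF res_functor[OF M J M D const_functor[OF J M]] post_functor[OF M D const_functor[OF J D]]])
  note MD = category_Fun[OF M D] and JD = category_Fun[OF J D]
  have o: "res_obj M J M (const_fun J M) X = comp_fun M (const_fun J D) X" if "is_functor M D X" for X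
    unfolding res_obj_def by (rule comp_fun_const_fun[OF J M D that])
  show "fob (res_fun M J M D (const_fun J M)) X = fob (post_fun M D (const_fun J D)) X" if "X \<in> Obj (Fun M D)" for X
    using that by (simp add: o)
  fix \<xi> X Y assume x: "\<xi> \<in> hom (Fun M D) X Y"
  note XY = Fun_homD[OF x]
  have "whisker_right M (post_ntrans J M \<xi>) (const_fun J M) = whisker_left M (const_fun J D) \<xi>"
  proof (rule Fun_hom_eqI[OF _ whisker_left_hom[OF M const_functor[OF J D] x]])
    show "whisker_right M (post_ntrans J M \<xi>) (const_fun J M) \<in> hom (Fun M (Fun J D)) (comp_fun M (const_fun J D) X) (comp_fun M (const_fun J D) Y)"
      using res_fun_hom[OF M J M D const_functor[OF J M] x] unfolding o[OF XY(1)] o[OF XY(2)] .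
    fix i assume i: "i \<in> Obj M"
    then show "ncomp (whisker_right M (post_ntrans J M \<xi>) (const_fun J M)) i = ncomp (whisker_left M (const_fun J D) \<xi>) i"
      using whisker_right_const[OF J M D x i]
      by (simp add: const_obj_functor[OF J M] const_fun_simps(2)[OF Fun_hom_comp[OF x i]])
  qed
  then show "far (res_fun M J M D (const_fun J M)) \<xi> = far (post_fun M D (const_fun J D)) \<xi>"
    using XY by simp
qed

lemma comp_fun_id_right: "is_functor C D F \<Longrightarrow> category C \<Longrightarrow> comp_fun C F (id_fun C) = F"
  by (rule functor_eqI[OF comp_functor[OF _ id_functor]]) (auto simp: hom_Arr)

lemma comp_fun_id_left: "is_functor C D F \<Longrightarrow> category C \<Longrightarrow> category D \<Longrightarrow> comp_fun C (id_fun D) F = F"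
  by (rule functor_eqI[OF comp_functor[OF _ _ id_functor]]) (auto simp: hom_Arr functor_obj functor_Arr)

lemma comp_fun_assoc: "is_functor B C F \<Longrightarrow> comp_fun B H (comp_fun B G F) = comp_fun B (comp_fun C H G) F"
  by (auto simp: comp_fun_def functor_obj functor_Arr intro!: restrict_ext)

lemma res_const_id:
  assumes I: "category I" and M: "category M" and D: "category D"
  shows "res_fun I M M D (const_obj I (Fun M M) (id_fun M)) = const_fun I (Fun M D)"
proof -
  let ?K = "const_obj I (Fun M M) (id_fun M)"
  note MM = category_Fun[OF M M] and MD = category_Fun[OF M D] and IMD = category_Fun[OF I category_Fun[OF M D]]
  have id: "id_fun M \<in> Obj (Fun M M)" using id_functor[OF M] by simp
  have K: "is_functor I (Fun M M) ?K" by (rule const_obj_functor[OF I MM id])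
  have o: "res_obj I M M ?K X = const_obj I (Fun M D) X" if "is_functor M D X" for X
    unfolding res_obj_def comp_const[OF I MM post_functor[OF M M that] id MD]
    using that id_functor[OF M] by (simp add: comp_fun_id_right[OF _ M])
  show ?thesis
  proof (rule functor_eqI[OF res_functor[OF I M M D K] const_functor[OF I MD]])
    show "fob (res_fun I M M D ?K) X = fob (const_fun I (Fun M D)) X" if "X \<in> Obj (Fun M D)" for X
      using that by (simp add: o)
    fix \<xi> X Y assume x: "\<xi> \<in> hom (Fun M D) X Y"
    note XY = Fun_homD[OF x]
    have "whisker_right I (post_ntrans M M \<xi>) ?K = mk_nt I (const_obj I (Fun M D) X) (const_obj I (Fun M D) Y) (\<lambda>_. \<xi>)"
    proof (rule Fun_hom_eqI[of _ I "Fun M D"])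
      show "whisker_right I (post_ntrans M M \<xi>) ?K \<in> hom (Fun I (Fun M D)) (const_obj I (Fun M D) X) (const_obj I (Fun M D) Y)"
        using res_fun_hom[OF I M M D K x] unfolding o[OF XY(1)] o[OF XY(2)] .
      show "mk_nt I (const_obj I (Fun M D) X) (const_obj I (Fun M D) Y) (\<lambda>_. \<xi>) \<in>
         hom (Fun I (Fun M D)) (const_obj I (Fun M D) X) (const_obj I (Fun M D) Y)"
        using functor_hom[OF const_functor[OF I MD] x] XY const_fun_simps(2)[OF x, of I] by simp
      fix i assume i: "i \<in> Obj I"
      have "whisker_right M \<xi> (id_fun M) = \<xi>"
        by (rule Fun_hom_eqI[OF _ x])
          (use whisker_right_hom[OF M id_functor[OF M] x] XY in \<open>simp_all add: comp_fun_id_right[OF _ M]\<close>)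
      then show "ncomp (whisker_right I (post_ntrans M M \<xi>) ?K) i = ncomp (mk_nt I (const_obj I (Fun M D) X) (const_obj I (Fun M D) Y) (\<lambda>_. \<xi>)) i"
        using i id_functor[OF M] by simp
    qed
    then show "far (res_fun I M M D ?K) \<xi> = far (const_fun I (Fun M D)) \<xi>"
      using XY const_fun_simps(2)[OF x, of I] by simp
  qed
qed

lemma post_id:
  assumes J: "category J" and C: "category C"
  shows "post_fun J C (id_fun C) = id_fun (Fun J C)"
proof (rule functor_eqI[OF post_functor[OF J C id_functor[OF C]] id_functor[OF category_Fun[OF J C]]])
  show "fob (post_fun J C (id_fun C)) X = fob (id_fun (Fun J C)) X" if "X \<in> Obj (Fun J C)" for X
    using that by (simp add: comp_fun_id_left[OF _ J C])
  fix \<xi> X Y assume x: "\<xi> \<in> hom (Fun J C) X Y"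
  note XY = Fun_homD[OF x]
  have "whisker_left J (id_fun C) \<xi> = \<xi>"
    by (rule Fun_hom_eqI[OF _ x])
      (use whisker_left_hom[OF J id_functor[OF C] x] XY in \<open>simp_all add: hom_Arr[OF Fun_hom_comp[OF x]] comp_fun_id_left[OF _ J C]\<close>)
  then show "far (post_fun J C (id_fun C)) \<xi> = far (id_fun (Fun J C)) \<xi>" using XY by simp
qed

lemma post_comp:
  assumes J: "category J" and C: "category C" and B: "category B" and F: "is_functor B C F" and G: "is_functor C D G"
  shows "comp_fun (Fun J B) (post_fun J C G) (post_fun J B F) = post_fun J B (comp_fun B G F)"
proof (rule functor_eqI[OF comp_functor[OF category_Fun[OF J B] post_functor[OF J B F] post_functor[OF J C G]] post_functor[OF J B comp_functor[OF B F G]]])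
  show "fob (comp_fun (Fun J B) (post_fun J C G) (post_fun J B F)) X = fob (post_fun J B (comp_fun B G F)) X"
    if "X \<in> Obj (Fun J B)" for X
    using that comp_functor[OF J _ F, of X] by (simp add: comp_fun_assoc)
  fix \<xi> X Y assume x: "\<xi> \<in> hom (Fun J B) X Y"
  note XY = Fun_homD[OF x]
  have "whisker_left J G (whisker_left J F \<xi>) = whisker_left J (comp_fun B G F) \<xi>"
    unfolding whisker_left_mk using XY(1,2)
    by (auto intro!: mk_nt_cong simp: comp_fun_assoc XY(3,4) hom_Arr[OF Fun_hom_comp[OF x]])
  then show "far (comp_fun (Fun J B) (post_fun J C G) (post_fun J B F)) \<xi> = far (post_fun J B (comp_fun B G F)) \<xi>"
    using XY Fun_homD(5)[OF whisker_left_hom[OF J F x]] by simp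
qed

section \<open>Diagonals of bisimplicial objects\<close>

lemma diag_obj_simps [simp]:
  "fob (diag_obj D Z) n = fob (fob Z n) n"
  "\<theta> \<in> hom Delta m n \<Longrightarrow> far (diag_obj D Z) \<theta> = Cmp D (ncomp (far Z \<theta>) m) (far (fob Z n) \<theta>)"
  by (auto simp: diag_obj_def hom_def)

lemma bisimp_homs:
  assumes Z: "is_functor op_Delta (Simp D) Z" and t: "\<theta> \<in> hom Delta m n"
  shows "far Z \<theta> \<in> hom (Simp D) (fob Z n) (fob Z m)"
    "ncomp (far Z \<theta>) k \<in> hom D (fob (fob Z n) k) (fob (fob Z m) k)"
    "is_functor op_Delta D (fob Z k)"
    "far (fob Z k) \<theta> \<in> hom D (fob (fob Z k) n) (fob (fob Z k) m)"
proof -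
  show 1: "far Z \<theta> \<in> hom (Simp D) (fob Z n) (fob Z m)" using functor_hom[OF Z, of \<theta> n m] t by simp
  show "ncomp (far Z \<theta>) k \<in> hom D (fob (fob Z n) k) (fob (fob Z m) k)" using Fun_hom_comp[OF 1, of k] by simp
  show 2: "is_functor op_Delta D (fob Z k)" using functor_obj[OF Z, of k] by simp
  show "far (fob Z k) \<theta> \<in> hom D (fob (fob Z k) n) (fob (fob Z k) m)" using functor_hom[OF 2, of \<theta> n m] t by simp
qed

lemma diag_obj_functor:
  assumes D: "category D" and Z: "is_functor op_Delta (Simp D) Z"
  shows "is_functor op_Delta D (diag_obj D Z)"
proof (rule is_functorI)
  show "fob (diag_obj D Z) \<in> extensional (Obj op_Delta)" "far (diag_obj D Z) \<in> extensional (Arr op_Delta)"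
    by (simp_all add: diag_obj_def)
  note Zn = bisimp_homs[OF Z]
  show "fob (diag_obj D Z) n \<in> Obj D" for n
    using functor_obj[OF Zn(3)[OF Delta_id, of n]] by simp
  show "far (diag_obj D Z) (Ident op_Delta n) = Ident D (fob (diag_obj D Z) n)" for n
    using functor_id[OF Z, of n] functor_id[OF Zn(3)[OF Delta_id], of n n] functor_obj[OF Zn(3)[OF Delta_id], of n n]
    by (simp add: diag_obj_simps(2)[OF Delta_id] cat_idl[OF D cat_id[OF D]])
  fix \<theta> x y assume "\<theta> \<in> hom op_Delta x y"
  then have t: "\<theta> \<in> hom Delta y x" by simp
  show "far (diag_obj D Z) \<theta> \<in> hom D (fob (diag_obj D Z) x) (fob (diag_obj D Z) y)"
    using cat_cmp[OF D Zn(4)[OF t] Zn(2)[OF t]] by (simp add: diag_obj_simps(2)[OF t])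
  fix \<phi> z assume "\<phi> \<in> hom op_Delta y z"
  then have p: "\<phi> \<in> hom Delta z y" by simp
  note tp = Delta_cmp[OF p t]
  have 1: "far Z (Cmp Delta \<theta> \<phi>) = Cmp (Simp D) (far Z \<phi>) (far Z \<theta>)"
    using functor_cmp[OF Z, of \<theta> x y \<phi> z] t p by simp
  have 2: "far (fob Z x) (Cmp Delta \<theta> \<phi>) = Cmp D (far (fob Z x) \<phi>) (far (fob Z x) \<theta>)"
    using functor_cmp[OF Zn(3)[OF t], of \<theta> x y \<phi> z x] t p by simp
  have 3: "Cmp D (ncomp (far Z \<theta>) z) (far (fob Z x) \<phi>) = Cmp D (far (fob Z y) \<phi>) (ncomp (far Z \<theta>) y)"
    using Fun_hom_nat[OF Zn(1)[OF t], of \<phi> y z] p by simp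
  note A = cat_assoc[OF D]
  have "far (diag_obj D Z) (Cmp Delta \<theta> \<phi>) =
     Cmp D (Cmp D (ncomp (far Z \<phi>) z) (ncomp (far Z \<theta>) z)) (Cmp D (far (fob Z x) \<phi>) (far (fob Z x) \<theta>))"
    by (simp add: diag_obj_simps(2)[OF tp] 1 2)
  also have "\<dots> = Cmp D (ncomp (far Z \<phi>) z) (Cmp D (Cmp D (ncomp (far Z \<theta>) z) (far (fob Z x) \<phi>)) (far (fob Z x) \<theta>))"
    using A[OF cat_cmp[OF D Zn(4)[OF t] Zn(4)[OF p]] Zn(2)[OF t] Zn(2)[OF p]] A[OF Zn(4)[OF t] Zn(4)[OF p] Zn(2)[OF t]]
    by simp
  also have "\<dots> = Cmp D (Cmp D (ncomp (far Z \<phi>) z) (far (fob Z y) \<phi>)) (Cmp D (ncomp (far Z \<theta>) y) (far (fob Z x) \<theta>))"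
    unfolding 3 using A[OF Zn(4)[OF t] Zn(2)[OF t] Zn(4)[OF p]] A[OF cat_cmp[OF D Zn(4)[OF t] Zn(2)[OF t]] Zn(4)[OF p] Zn(2)[OF p]]
    by simp
  finally show "far (diag_obj D Z) (Cmp op_Delta \<phi> \<theta>) = Cmp D (far (diag_obj D Z) \<phi>) (far (diag_obj D Z) \<theta>)"
    by (simp add: diag_obj_simps(2)[OF t] diag_obj_simps(2)[OF p])
qed

lemma diag_simps:
  "is_functor op_Delta (Simp D) Z \<Longrightarrow> fob (diag D) Z = diag_obj D Z"
  "\<phi> \<in> hom (Simp (Simp D)) Z Z' \<Longrightarrow> far (diag D) \<phi> = mk_nt op_Delta (diag_obj D Z) (diag_obj D Z') (\<lambda>n. ncomp (ncomp \<phi> n) n)"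
  by (auto simp: diag_def mk_nt_def hom_def)

lemma diag_hom:
  assumes D: "category D" and f: "\<phi> \<in> hom (Simp (Simp D)) Z Z'"
  shows "far (diag D) \<phi> \<in> hom (Simp D) (diag_obj D Z) (diag_obj D Z')"
  unfolding diag_simps(2)[OF f]
proof (rule mk_nt_hom[OF cat_op])
  note Z = Fun_homD(1)[OF f] and Z' = Fun_homD(2)[OF f]
  note Zn = bisimp_homs[OF Z] and Zn' = bisimp_homs[OF Z']
  show "is_functor op_Delta D (diag_obj D Z)" "is_functor op_Delta D (diag_obj D Z')"
    using Z Z' by (simp_all add: diag_obj_functor[OF D])
  have fn: "ncomp \<phi> n \<in> hom (Simp D) (fob Z n) (fob Z' n)" for n using Fun_hom_comp[OF f, of n] by simp
  have fnk: "ncomp (ncomp \<phi> n) k \<in> hom D (fob (fob Z n) k) (fob (fob Z' n) k)" for n k using Fun_hom_comp[OF fn, of k] by simp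
  show "ncomp (ncomp \<phi> n) n \<in> hom D (fob (diag_obj D Z) n) (fob (diag_obj D Z') n)" for n using fnk by simp
  fix \<theta> n m assume "\<theta> \<in> hom op_Delta n m"
  then have t: "\<theta> \<in> hom Delta m n" by simp
  have 1: "Cmp D (ncomp (ncomp \<phi> m) m) (ncomp (far Z \<theta>) m) = Cmp D (ncomp (far Z' \<theta>) m) (ncomp (ncomp \<phi> n) m)"
    using arg_cong[OF Fun_hom_nat[OF f, of \<theta> n m], of "\<lambda>a. ncomp a m"] t by simp
  have 2: "Cmp D (ncomp (ncomp \<phi> n) m) (far (fob Z n) \<theta>) = Cmp D (far (fob Z' n) \<theta>) (ncomp (ncomp \<phi> n) n)"
    using Fun_hom_nat[OF fn, of \<theta> n m n] t by simp
  show "Cmp D (ncomp (ncomp \<phi> m) m) (far (diag_obj D Z) \<theta>) = Cmp D (far (diag_obj D Z') \<theta>) (ncomp (ncomp \<phi> n) n)"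
    unfolding diag_obj_simps(2)[OF t]
    using cat_assoc[OF D Zn(4)[OF t] Zn(2)[OF t] fnk] cat_assoc[OF D Zn(4)[OF t] fnk Zn'(2)[OF t]]
      cat_assoc[OF D fnk Zn'(4)[OF t] Zn'(2)[OF t]] 1 2 by simp
qed

lemma ncomp_diag: "\<phi> \<in> hom (Simp (Simp D)) Z Z' \<Longrightarrow> ncomp (far (diag D) \<phi>) n = ncomp (ncomp \<phi> n) n"
  by (simp add: diag_simps)

lemma diag_times_Delta:
  assumes D: "category D" and X: "is_functor op_Delta D X"
  shows "diag_obj D (comp_fun op_Delta (const_simp D) X) = X"
proof (rule functor_eqI[OF diag_obj_functor[OF D comp_functor[OF cat_op X const_functor[OF cat_op D]]] X])
  show "fob (diag_obj D (comp_fun op_Delta (const_simp D) X)) n = fob X n" for n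
    using functor_obj[OF X, of n] by simp
  fix \<theta> n m assume t: "\<theta> \<in> hom op_Delta n m"
  then have t': "\<theta> \<in> hom Delta m n" by simp
  show "far (diag_obj D (comp_fun op_Delta (const_simp D) X)) \<theta> = far X \<theta>"
    using functor_obj[OF X, of n] hom_Arr[OF t'] functor_hom[OF X t]
    by (simp add: diag_obj_simps(2)[OF t'] const_fun_simps(2)[OF functor_hom[OF X t]] cat_idr[OF D])
qed

lemma diag_Delta_times:
  assumes D: "category D" and X: "is_functor op_Delta D X"
  shows "diag_obj D (const_obj op_Delta (Simp D) X) = X"
proof (rule functor_eqI[OF diag_obj_functor[OF D const_obj_functor[OF cat_op category_Simp[OF D]]] X])
  show "X \<in> Obj (Simp D)" using X by simp
  show "fob (diag_obj D (const_obj op_Delta (Simp D) X)) n = fob X n" for n by simp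
  fix \<theta> n m assume t: "\<theta> \<in> hom op_Delta n m"
  then have t': "\<theta> \<in> hom Delta m n" by simp
  show "far (diag_obj D (const_obj op_Delta (Simp D) X)) \<theta> = far X \<theta>"
    using hom_Arr[OF t'] functor_hom[OF X t]
    by (simp add: diag_obj_simps(2)[OF t'] cat_idl[OF D])
qed

section \<open>Coproducts and cylinders\<close>

text \<open>The arrow out of the coproduct \<open>P\<close> with components \<open>f\<close>.\<close>

definition cop_map :: "('o, 'a) cat \<Rightarrow> 'i set \<Rightarrow> 'o \<Rightarrow> ('i \<Rightarrow> 'a) \<Rightarrow> 'o \<Rightarrow> ('i \<Rightarrow> 'a) \<Rightarrow> 'a" where
  "cop_map C I P inc Q f = (THE u. u \<in> hom C P Q \<and> (\<forall>i \<in> I. Cmp C u (inc i) = f i))"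

lemma cop_inc: "is_coproduct C I A P inc \<Longrightarrow> i \<in> I \<Longrightarrow> inc i \<in> hom C (A i) P"
  by (simp add: is_coproduct_def)

lemma cop_map:
  assumes "is_coproduct C I A P inc" "Q \<in> Obj C" "\<And>i. i \<in> I \<Longrightarrow> f i \<in> hom C (A i) Q"
  shows "cop_map C I P inc Q f \<in> hom C P Q" "\<And>i. i \<in> I \<Longrightarrow> Cmp C (cop_map C I P inc Q f) (inc i) = f i"
proof -
  have "\<exists>!u. u \<in> hom C P Q \<and> (\<forall>i \<in> I. Cmp C u (inc i) = f i)"
    using assms unfolding is_coproduct_def by blast
  from theI'[OF this] show "cop_map C I P inc Q f \<in> hom C P Q"
     "\<And>i. i \<in> I \<Longrightarrow> Cmp C (cop_map C I P inc Q f) (inc i) = f i"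
    unfolding cop_map_def by blast+
qed

lemma cop_eqI:
  assumes C: "category C" and c: "is_coproduct C I A P inc" and u: "u \<in> hom C P Q" and v: "v \<in> hom C P Q"
    and e: "\<And>i. i \<in> I \<Longrightarrow> Cmp C u (inc i) = Cmp C v (inc i)"
  shows "u = v"
proof -
  have "Q \<in> Obj C" using cat_hom_obj[OF C u] by simp
  moreover have vi: "Cmp C v (inc i) \<in> hom C (A i) Q" if "i \<in> I" for i
    using cat_cmp[OF C cop_inc[OF c that] v] .
  ultimately have "\<exists>!w. w \<in> hom C P Q \<and> (\<forall>i \<in> I. Cmp C w (inc i) = Cmp C v (inc i))"
    using c[unfolded is_coproduct_def, THEN conjunct2, THEN conjunct2, rule_format, of Q "\<lambda>i. Cmp C v (inc i)"] by simp
  then show ?thesis using u v e by blast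
qed

lemma ex_coproduct:
  assumes "has_finite_coproducts C" "finite I" "\<And>i. i \<in> I \<Longrightarrow> A i \<in> Obj C"
  shows "\<exists>P inc. is_coproduct C I A P inc"
proof -
  obtain e :: "_ \<Rightarrow> nat" where e: "inj_on e I" using finite_imp_inj_to_nat_seg[OF assms(2)] by blast
  let ?B = "\<lambda>j. A (the_inv_into I e j)"
  have te: "the_inv_into I e (e i) = i" if "i \<in> I" for i using the_inv_into_f_f[OF e that] .
  have "finite (e ` I)" "?B ` (e ` I) \<subseteq> Obj C" using assms te by auto
  then obtain P inc where P: "is_coproduct C (e ` I) ?B P inc"
    using assms(1) unfolding has_finite_coproducts_def by blast
  have "is_coproduct C I A P (inc \<circ> e)"
    unfolding is_coproduct_def
  proof (intro conjI allI impI ballI)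
    show "P \<in> Obj C" using P by (simp add: is_coproduct_def)
    show "A i \<in> Obj C" if "i \<in> I" for i using assms(3) that .
    show "(inc \<circ> e) i \<in> hom C (A i) P" if "i \<in> I" for i using cop_inc[OF P, of "e i"] that te by simp
    fix Q f assume f: "Q \<in> Obj C \<and> (\<forall>i \<in> I. f i \<in> hom C (A i) Q)"
    then have "\<forall>j \<in> e ` I. f (the_inv_into I e j) \<in> hom C (?B j) Q" using te by auto
    then have "\<exists>!u. u \<in> hom C P Q \<and> (\<forall>j \<in> e ` I. Cmp C u (inc j) = f (the_inv_into I e j))"
      using f by (intro P[unfolded is_coproduct_def, THEN conjunct2, THEN conjunct2, rule_format]) auto
    then show "\<exists>!u. u \<in> hom C P Q \<and> (\<forall>i \<in> I. Cmp C u ((inc \<circ> e) i) = f i)" using te by simp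
  qed
  then show ?thesis by blast
qed

text \<open>A choice of the coproducts \<open>(A \<boxtimes> \<Delta>[1])\<^sub>n\<close> of copies of \<open>A\<close> indexed by the simplices \<open>[n] \<rightarrow> [1]\<close>, with
  \<open>cylP\<close> the object, \<open>cylI\<close> the inclusions and \<open>cyl_map\<close> the arrows out of it. They form the functor
  \<open>cyl_fun\<close> from \<open>D\<close> to simplicial objects, \<open>A \<mapsto> A \<boxtimes> \<Delta>[1]\<close>.\<close>

definition cyl_cop :: "('o, 'a) cat \<Rightarrow> 'o \<Rightarrow> nat \<Rightarrow> 'o \<times> (delta_arr \<Rightarrow> 'a)" where
  "cyl_cop D A n = (SOME c. is_coproduct D (hom Delta n 1) (\<lambda>_. A) (fst c) (snd c))"

abbreviation cylP :: "('o, 'a) cat \<Rightarrow> 'o \<Rightarrow> nat \<Rightarrow> 'o" where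
  "cylP D A n \<equiv> fst (cyl_cop D A n)"
abbreviation cylI :: "('o, 'a) cat \<Rightarrow> 'o \<Rightarrow> nat \<Rightarrow> delta_arr \<Rightarrow> 'a" where
  "cylI D A n \<equiv> snd (cyl_cop D A n)"
abbreviation cyl_map :: "('o, 'a) cat \<Rightarrow> 'o \<Rightarrow> nat \<Rightarrow> 'o \<Rightarrow> (delta_arr \<Rightarrow> 'a) \<Rightarrow> 'a" where
  "cyl_map D A n \<equiv> cop_map D (hom Delta n 1) (cylP D A n) (cylI D A n)"

definition cyl_obj :: "('o, 'a) cat \<Rightarrow> 'o \<Rightarrow> ('o, 'a) sobj" where
  "cyl_obj D A = \<lparr>fob = cylP D A, far = (\<lambda>\<theta> \<in> Arr Delta.
     cyl_map D A (Cod Delta \<theta>) (cylP D A (Dom Delta \<theta>)) (\<lambda>k. cylI D A (Dom Delta \<theta>) (Cmp Delta k \<theta>)))\<rparr>"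

definition cyl_arr :: "('o, 'a) cat \<Rightarrow> 'a \<Rightarrow> ('o, 'a) sarr" where
  "cyl_arr D f = mk_nt op_Delta (cyl_obj D (Dom D f)) (cyl_obj D (Cod D f))
     (\<lambda>n. cyl_map D (Dom D f) n (cylP D (Cod D f) n) (\<lambda>k. Cmp D (cylI D (Cod D f) n k) f))"

definition cyl_fun :: "('o, 'a) cat \<Rightarrow> ('o, 'a, ('o, 'a) sobj, ('o, 'a) sarr) fctr" where
  "cyl_fun D = \<lparr>fob = (\<lambda>A \<in> Obj D. cyl_obj D A), far = (\<lambda>f \<in> Arr D. cyl_arr D f)\<rparr>"

text \<open>The constant simplex \<open>[n] \<rightarrow> [1]\<close> at the vertex \<open>b \<le> 1\<close>; the inclusion \<open>A \<rightarrow> A \<boxtimes> \<Delta>[1]\<close> of the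
  corresponding end (for \<open>b = 1\<close> it is the map \<open>d\<^sub>0\<close>); and the projection \<open>A \<boxtimes> \<Delta>[1] \<rightarrow> A\<close>.\<close>

definition cyl_vertex :: "nat \<Rightarrow> nat \<Rightarrow> delta_arr" where
  "cyl_vertex b n = dmap n 1 (\<lambda>_. b)"

lemma cyl_vertex_hom: "b \<le> 1 \<Longrightarrow> cyl_vertex b n \<in> hom Delta n 1"
  by (simp add: cyl_vertex_def dmap_hom)

lemma cyl_vertex_cmp:
  assumes "b \<le> 1" "\<theta> \<in> hom Delta m n"
  shows "Cmp Delta (cyl_vertex b n) \<theta> = cyl_vertex b m"
  by (rule Delta_eqI[OF Delta_cmp[OF assms(2) cyl_vertex_hom] cyl_vertex_hom])
    (use assms hom_DeltaE(2)[OF assms(2)] in \<open>simp_all add: dfun_Cmp[OF assms(2) cyl_vertex_hom]\<close>, simp add: cyl_vertex_def)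

definition cyl_end :: "('o, 'a) cat \<Rightarrow> nat \<Rightarrow> ('o, 'a, ('o, 'a) sobj, ('o, 'a) sarr) ntrans" where
  "cyl_end D b = mk_nt D (const_simp D) (cyl_fun D)
     (\<lambda>A. mk_nt op_Delta (const_obj op_Delta D A) (cyl_obj D A) (\<lambda>n. cylI D A n (cyl_vertex b n)))"

definition cyl_proj :: "('o, 'a) cat \<Rightarrow> ('o, 'a, ('o, 'a) sobj, ('o, 'a) sarr) ntrans" where
  "cyl_proj D = mk_nt D (cyl_fun D) (const_simp D)
     (\<lambda>A. mk_nt op_Delta (cyl_obj D A) (const_obj op_Delta D A) (\<lambda>n. cyl_map D A n A (\<lambda>_. Ident D A)))"

text \<open>A category with finite coproducts.\<close>

locale coproduct_category = category D for D :: "('o, 'a) cat" +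
  assumes cops: "has_finite_coproducts D"
begin

lemma catD: "category D" by unfold_locales

lemma cyl_cop:
  assumes A: "A \<in> Obj D"
  shows "is_coproduct D (hom Delta n 1) (\<lambda>_. A) (cylP D A n) (cylI D A n)"
proof -
  have "\<exists>P inc. is_coproduct D (hom Delta n 1) (\<lambda>_. A) P inc"
    by (rule ex_coproduct[OF cops finite_hom_Delta]) (rule A)
  then have "\<exists>c. is_coproduct D (hom Delta n 1) (\<lambda>_. A) (fst c) (snd c)" by auto
  from someI_ex[OF this] show ?thesis unfolding cyl_cop_def .
qed

lemma cylP: "A \<in> Obj D \<Longrightarrow> cylP D A n \<in> Obj D"
  using cyl_cop[of A n] by (simp add: is_coproduct_def)

lemma cylI: "A \<in> Obj D \<Longrightarrow> k \<in> hom Delta n 1 \<Longrightarrow> cylI D A n k \<in> hom D A (cylP D A n)"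
  using cop_inc[OF cyl_cop[of A n]] by simp

lemmas cyl_map = cop_map[OF cyl_cop]
lemmas cyl_eqI = cop_eqI[OF catD cyl_cop]

lemma cyl_obj_far:
  assumes A: "A \<in> Obj D" and t: "\<theta> \<in> hom Delta m n"
  shows "far (cyl_obj D A) \<theta> \<in> hom D (cylP D A n) (cylP D A m)"
    "\<And>k. k \<in> hom Delta n 1 \<Longrightarrow> Cmp D (far (cyl_obj D A) \<theta>) (cylI D A n k) = cylI D A m (Cmp Delta k \<theta>)"
proof -
  have "cylI D A m (Cmp Delta k \<theta>) \<in> hom D A (cylP D A m)" if "k \<in> hom Delta n 1" for k
    using cylI[OF A Delta_cmp[OF t that]] .
  note * = cyl_map[OF A cylP[OF A] this]
  show "far (cyl_obj D A) \<theta> \<in> hom D (cylP D A n) (cylP D A m)"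
    "\<And>k. k \<in> hom Delta n 1 \<Longrightarrow> Cmp D (far (cyl_obj D A) \<theta>) (cylI D A n k) = cylI D A m (Cmp Delta k \<theta>)"
    using * t by (simp_all add: cyl_obj_def hom_Arr hom_Dom hom_Cod)
qed

lemma cyl_obj_functor:
  assumes A: "A \<in> Obj D"
  shows "is_functor op_Delta D (cyl_obj D A)"
proof (rule is_functorI)
  show "fob (cyl_obj D A) \<in> extensional (Obj op_Delta)" "far (cyl_obj D A) \<in> extensional (Arr op_Delta)"
    by (simp_all add: cyl_obj_def)
  have o [simp]: "fob (cyl_obj D A) n = cylP D A n" for n by (simp add: cyl_obj_def)
  show "fob (cyl_obj D A) n \<in> Obj D" for n using cylP[OF A] by simp
  note cf = cyl_obj_far[OF A]
  show "far (cyl_obj D A) (Ident op_Delta n) = Ident D (fob (cyl_obj D A) n)" for n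
  proof -
    have "far (cyl_obj D A) (Ident Delta n) = Ident D (cylP D A n)"
      by (rule cyl_eqI[OF A cf(1)[OF Delta_id] ident_hom[OF cylP[OF A]]])
       (simp add: cf(2)[OF Delta_id] cat_idr[OF category_Delta] ident_left[OF cylI[OF A]])
    then show ?thesis by simp
  qed
  fix \<theta> n m assume "\<theta> \<in> hom op_Delta n m"
  then have t: "\<theta> \<in> hom Delta m n" by simp
  show "far (cyl_obj D A) \<theta> \<in> hom D (fob (cyl_obj D A) n) (fob (cyl_obj D A) m)" using cf(1)[OF t] by simp
  fix \<phi> l assume "\<phi> \<in> hom op_Delta m l"
  then have p: "\<phi> \<in> hom Delta l m" by simp
  have "far (cyl_obj D A) (Cmp Delta \<theta> \<phi>) = Cmp D (far (cyl_obj D A) \<phi>) (far (cyl_obj D A) \<theta>)"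
    by (rule cyl_eqI[OF A cf(1)[OF Delta_cmp[OF p t]] cmp_hom[OF cf(1)[OF t] cf(1)[OF p]]])
      (simp add: cf(2)[OF Delta_cmp[OF p t]] cmp_assoc[OF cylI[OF A] cf(1)[OF t] cf(1)[OF p], symmetric]
        cf(2)[OF t] cf(2)[OF p Delta_cmp[OF t]] cat_assoc[OF category_Delta p t])
  then show "far (cyl_obj D A) (Cmp op_Delta \<phi> \<theta>) = Cmp D (far (cyl_obj D A) \<phi>) (far (cyl_obj D A) \<theta>)" by simp
qed

lemma fob_cyl_obj [simp]: "fob (cyl_obj D A) n = cylP D A n"
  by (simp add: cyl_obj_def)

lemma cyl_tensor:
  assumes A: "A \<in> Obj D"
  shows "is_tensor D (const_obj op_Delta D A) (std_simplex 1) (cyl_obj D A) (cylI D A)"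
  unfolding is_tensor_def
proof (intro conjI allI impI)
  show "const_obj op_Delta D A \<in> Obj (Simp D)" using const_obj_functor[OF cat_op catD A] by simp
  show "cyl_obj D A \<in> Obj (Simp D)" using cyl_obj_functor[OF A] by simp
  show "is_coproduct D (fob (std_simplex 1) n) (\<lambda>_. fob (const_obj op_Delta D A) n) (fob (cyl_obj D A) n) (cylI D A n)" for n
    using cyl_cop[OF A, of n] by (simp add: std_simplex_def)
  show "Cmp D (far (cyl_obj D A) \<theta>) (cylI D A n k) =
      Cmp D (cylI D A m (far (std_simplex 1) \<theta> k)) (far (const_obj op_Delta D A) \<theta>)"
    if "\<theta> \<in> hom Delta m n \<and> k \<in> fob (std_simplex 1) n" for m n \<theta> k
    using that cyl_obj_far(2)[OF A, of \<theta> m n k] ident_right[OF cylI[OF A Delta_cmp[of \<theta> m n k 1]]]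
    by (auto simp: std_simplex_def hom_Arr simp del: One_nat_def)
qed

lemma cyl_arr:
  assumes f: "f \<in> hom D A B"
  shows "cyl_arr D f \<in> hom (Simp D) (cyl_obj D A) (cyl_obj D B)"
    "\<And>k n. k \<in> hom Delta n 1 \<Longrightarrow> Cmp D (ncomp (cyl_arr D f) n) (cylI D A n k) = Cmp D (cylI D B n k) f"
proof -
  have A: "A \<in> Obj D" and B: "B \<in> Obj D" using hom_obj[OF f] by auto
  have m: "Cmp D (cylI D B n k) f \<in> hom D A (cylP D B n)" if "k \<in> hom Delta n 1" for n k
    using cmp_hom[OF f cylI[OF B that]] .
  let ?u = "\<lambda>n. cyl_map D A n (cylP D B n) (\<lambda>k. Cmp D (cylI D B n k) f)"
  have d: "cyl_arr D f = mk_nt op_Delta (cyl_obj D A) (cyl_obj D B) ?u"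
    using f by (simp add: cyl_arr_def hom_def)
  note u = cyl_map[OF A cylP[OF B] m]
  show "\<And>k n. k \<in> hom Delta n 1 \<Longrightarrow> Cmp D (ncomp (cyl_arr D f) n) (cylI D A n k) = Cmp D (cylI D B n k) f"
    using u(2) by (simp add: d)
  show "cyl_arr D f \<in> hom (Simp D) (cyl_obj D A) (cyl_obj D B)"
    unfolding d
  proof (rule mk_nt_hom[OF cat_op cyl_obj_functor[OF A] cyl_obj_functor[OF B]])
    show "?u n \<in> hom D (fob (cyl_obj D A) n) (fob (cyl_obj D B) n)" for n using u(1) by simp
    fix \<theta> n m assume "\<theta> \<in> hom op_Delta n m"
    then have t: "\<theta> \<in> hom Delta m n" by simp
    note ca = cyl_obj_far[OF A t] and cb = cyl_obj_far[OF B t]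
    show "Cmp D (?u m) (far (cyl_obj D A) \<theta>) = Cmp D (far (cyl_obj D B) \<theta>) (?u n)"
      by (rule cyl_eqI[OF A cmp_hom[OF ca(1) u(1)] cmp_hom[OF u(1) cb(1)]])
       (simp_all add: cmp_assoc[OF cylI[OF A] ca(1) u(1), symmetric] cmp_assoc[OF cylI[OF A] u(1) cb(1), symmetric]
         ca(2) u(2) Delta_cmp[OF t] cmp_assoc[OF f cylI[OF B] cb(1)] cb(2) del: One_nat_def)
  qed
qed

lemma cyl_functor: "is_functor D (Simp D) (cyl_fun D)"
proof (rule is_functorI)
  show "fob (cyl_fun D) \<in> extensional (Obj D)" "far (cyl_fun D) \<in> extensional (Arr D)"
    by (simp_all add: cyl_fun_def)
  show "fob (cyl_fun D) A \<in> Obj (Simp D)" if "A \<in> Obj D" for A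
    using that cyl_obj_functor by (simp add: cyl_fun_def)
  show "far (cyl_fun D) f \<in> hom (Simp D) (fob (cyl_fun D) A) (fob (cyl_fun D) B)" if "f \<in> hom D A B" for f A B
    using that cyl_arr(1) hom_obj[OF that] by (simp add: cyl_fun_def hom_Arr)
  note SD = category_Simp[OF catD]
  show "far (cyl_fun D) (Ident D A) = Ident (Simp D) (fob (cyl_fun D) A)" if A: "A \<in> Obj D" for A
  proof -
    have co: "cyl_obj D A \<in> Obj (Simp D)" using cyl_obj_functor[OF A] by simp
    note a = cyl_arr[OF ident_hom[OF A]]
    have "cyl_arr D (Ident D A) = Ident (Simp D) (cyl_obj D A)"
    proof (rule Fun_hom_eqI[OF a(1) cat_id[OF SD co]])
      fix n :: nat
      have an: "ncomp (cyl_arr D (Ident D A)) n \<in> hom D (cylP D A n) (cylP D A n)"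
        using Fun_hom_comp[OF a(1), of n] by simp
      show "ncomp (cyl_arr D (Ident D A)) n = ncomp (Ident (Simp D) (cyl_obj D A)) n"
        by (rule cyl_eqI[OF A an])
         (use a(2) ident_hom[OF cylP[OF A]] in \<open>simp_all add: ident_left[OF cylI[OF A]] ident_right[OF cylI[OF A]]\<close>)
    qed
    then show ?thesis using A ident_hom[OF A] by (simp add: cyl_fun_def hom_Arr)
  qed
  show "far (cyl_fun D) (Cmp D g f) = Cmp (Simp D) (far (cyl_fun D) g) (far (cyl_fun D) f)"
    if f: "f \<in> hom D A B" and g: "g \<in> hom D B B'" for f g A B B'
  proof -
    have A: "A \<in> Obj D" and B: "B \<in> Obj D" and B': "B' \<in> Obj D" using hom_obj[OF f] hom_obj[OF g] by auto
    note a = cyl_arr[OF f] and b = cyl_arr[OF g] and c = cyl_arr[OF cmp_hom[OF f g]]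
    have "cyl_arr D (Cmp D g f) = Cmp (Simp D) (cyl_arr D g) (cyl_arr D f)"
    proof (rule Fun_hom_eqI[OF c(1) cat_cmp[OF SD a(1) b(1)]])
      fix n :: nat
      have an: "ncomp (cyl_arr D f) n \<in> hom D (cylP D A n) (cylP D B n)"
        using Fun_hom_comp[OF a(1), of n] by simp
      have bn: "ncomp (cyl_arr D g) n \<in> hom D (cylP D B n) (cylP D B' n)"
        using Fun_hom_comp[OF b(1), of n] by simp
      have cn: "ncomp (cyl_arr D (Cmp D g f)) n \<in> hom D (cylP D A n) (cylP D B' n)"
        using Fun_hom_comp[OF c(1), of n] by simp
      have "ncomp (cyl_arr D (Cmp D g f)) n = Cmp D (ncomp (cyl_arr D g) n) (ncomp (cyl_arr D f) n)"
        by (rule cyl_eqI[OF A cn cmp_hom[OF an bn]])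
          (simp add: c(2) cmp_assoc[OF cylI[OF A] an bn, symmetric] a(2) cmp_assoc[OF f cylI[OF B] bn] b(2)
            cmp_assoc[OF f g cylI[OF B']])
      then show "ncomp (cyl_arr D (Cmp D g f)) n = ncomp (Cmp (Simp D) (cyl_arr D g) (cyl_arr D f)) n" by simp
    qed
    then show ?thesis using f g cmp_hom[OF f g] by (simp add: cyl_fun_def hom_Arr)
  qed
qed

lemma cyl_fun_simps [simp]: "A \<in> Obj D \<Longrightarrow> fob (cyl_fun D) A = cyl_obj D A"
  "f \<in> hom D A B \<Longrightarrow> far (cyl_fun D) f = cyl_arr D f"
  by (simp_all add: cyl_fun_def hom_Arr)

lemma cyl_end_comp:
  assumes A: "A \<in> Obj D" and b: "b \<le> 1"
  shows "mk_nt op_Delta (const_obj op_Delta D A) (cyl_obj D A) (\<lambda>n. cylI D A n (cyl_vertex b n)) \<in>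
      hom (Simp D) (const_obj op_Delta D A) (cyl_obj D A)"
proof (rule mk_nt_hom[OF cat_op const_obj_functor[OF cat_op catD A] cyl_obj_functor[OF A]])
  show "cylI D A n (cyl_vertex b n) \<in> hom D (fob (const_obj op_Delta D A) n) (fob (cyl_obj D A) n)" for n
    using cylI[OF A cyl_vertex_hom[OF b]] by simp
  fix \<theta> n m assume "\<theta> \<in> hom op_Delta n m"
  then have t: "\<theta> \<in> hom Delta m n" by simp
  show "Cmp D (cylI D A m (cyl_vertex b m)) (far (const_obj op_Delta D A) \<theta>) = Cmp D (far (cyl_obj D A) \<theta>) (cylI D A n (cyl_vertex b n))"
    using hom_Arr[OF t] cyl_obj_far(2)[OF A t cyl_vertex_hom[OF b]] cyl_vertex_cmp[OF b t] ident_right[OF cylI[OF A cyl_vertex_hom[OF b]]]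
    by simp
qed

lemma cyl_end_hom:
  assumes b: "b \<le> 1"
  shows "cyl_end D b \<in> hom (Fun D (Simp D)) (const_simp D) (cyl_fun D)"
  unfolding cyl_end_def
proof (rule mk_nt_hom[OF catD const_functor[OF cat_op catD] cyl_functor])
  let ?e = "\<lambda>A. mk_nt op_Delta (const_obj op_Delta D A) (cyl_obj D A) (\<lambda>n. cylI D A n (cyl_vertex b n))"
  note SD = category_Simp[OF catD]
  show "?e A \<in> hom (Simp D) (fob (const_simp D) A) (fob (cyl_fun D) A)" if "A \<in> Obj D" for A
    using cyl_end_comp[OF that b] that by simp
  fix f A B assume f: "f \<in> hom D A B"
  have A: "A \<in> Obj D" and B: "B \<in> Obj D" using hom_obj[OF f] by auto
  have cf: "far (const_simp D) f \<in> hom (Simp D) (const_obj op_Delta D A) (const_obj op_Delta D B)"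
    using functor_hom[OF const_functor[OF cat_op catD] f] A B by simp
  show "Cmp (Simp D) (?e B) (far (const_simp D) f) = Cmp (Simp D) (far (cyl_fun D) f) (?e A)"
    unfolding cyl_fun_simps(2)[OF f]
    by (rule Fun_hom_eqI[OF cat_cmp[OF SD cf cyl_end_comp[OF B b]] cat_cmp[OF SD cyl_end_comp[OF A b] cyl_arr(1)[OF f]]])
      (simp add: const_fun_simps(2)[OF f] cyl_arr(2)[OF f cyl_vertex_hom[OF b]])
qed

lemma cyl_proj_comp:
  assumes A: "A \<in> Obj D"
  shows "mk_nt op_Delta (cyl_obj D A) (const_obj op_Delta D A) (\<lambda>n. cyl_map D A n A (\<lambda>_. Ident D A)) \<in>
      hom (Simp D) (cyl_obj D A) (const_obj op_Delta D A)"
proof (rule mk_nt_hom[OF cat_op cyl_obj_functor[OF A] const_obj_functor[OF cat_op catD A]])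
  note u = cyl_map[OF A A ident_hom[OF A]]
  show "cyl_map D A n A (\<lambda>_. Ident D A) \<in> hom D (fob (cyl_obj D A) n) (fob (const_obj op_Delta D A) n)" for n
    using u(1) by simp
  fix \<theta> n m assume "\<theta> \<in> hom op_Delta n m"
  then have t: "\<theta> \<in> hom Delta m n" by simp
  note ca = cyl_obj_far[OF A t]
  have "Cmp D (cyl_map D A m A (\<lambda>_. Ident D A)) (far (cyl_obj D A) \<theta>) = cyl_map D A n A (\<lambda>_. Ident D A)"
    by (rule cyl_eqI[OF A cmp_hom[OF ca(1) u(1)] u(1)])
     (simp add: cmp_assoc[OF cylI[OF A] ca(1) u(1), symmetric] ca(2) u(2) Delta_cmp[OF t] del: One_nat_def)
  then show "Cmp D (cyl_map D A m A (\<lambda>_. Ident D A)) (far (cyl_obj D A) \<theta>) =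
      Cmp D (far (const_obj op_Delta D A) \<theta>) (cyl_map D A n A (\<lambda>_. Ident D A))"
    using hom_Arr[OF t] ident_left[OF u(1)] by simp
qed

lemma cyl_proj_hom: "cyl_proj D \<in> hom (Fun D (Simp D)) (cyl_fun D) (const_simp D)"
  unfolding cyl_proj_def
proof (rule mk_nt_hom[OF catD cyl_functor const_functor[OF cat_op catD]])
  let ?p = "\<lambda>A. mk_nt op_Delta (cyl_obj D A) (const_obj op_Delta D A) (\<lambda>n. cyl_map D A n A (\<lambda>_. Ident D A))"
  note SD = category_Simp[OF catD]
  show "?p A \<in> hom (Simp D) (fob (cyl_fun D) A) (fob (const_simp D) A)" if "A \<in> Obj D" for A
    using cyl_proj_comp[OF that] that by simp
  fix f A B assume f: "f \<in> hom D A B"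
  have A: "A \<in> Obj D" and B: "B \<in> Obj D" using hom_obj[OF f] by auto
  have cf: "far (const_simp D) f \<in> hom (Simp D) (const_obj op_Delta D A) (const_obj op_Delta D B)"
    using functor_hom[OF const_functor[OF cat_op catD] f] A B by simp
  note u = cyl_map[OF A A ident_hom[OF A]] and v = cyl_map[OF B B ident_hom[OF B]]
  show "Cmp (Simp D) (?p B) (far (cyl_fun D) f) = Cmp (Simp D) (far (const_simp D) f) (?p A)"
    unfolding cyl_fun_simps(2)[OF f]
  proof (rule Fun_hom_eqI[OF cat_cmp[OF SD cyl_arr(1)[OF f] cyl_proj_comp[OF B]] cat_cmp[OF SD cyl_proj_comp[OF A] cf]])
    fix n :: nat
    have fn: "ncomp (cyl_arr D f) n \<in> hom D (cylP D A n) (cylP D B n)"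
      using Fun_hom_comp[OF cyl_arr(1)[OF f], of n] by simp
    have "Cmp D (cyl_map D B n B (\<lambda>_. Ident D B)) (ncomp (cyl_arr D f) n) = Cmp D f (cyl_map D A n A (\<lambda>_. Ident D A))"
      by (rule cyl_eqI[OF A cmp_hom[OF fn v(1)] cmp_hom[OF u(1) f]])
        (simp add: cmp_assoc[OF cylI[OF A] fn v(1), symmetric] cmp_assoc[OF cylI[OF A] u(1) f, symmetric] u(2) cyl_arr(2)[OF f]
          cmp_assoc[OF f cylI[OF B] v(1)] v(2) ident_left[OF f] ident_right[OF f] del: One_nat_def)
    then show "ncomp (Cmp (Simp D) (?p B) (cyl_arr D f)) n = ncomp (Cmp (Simp D) (far (const_simp D) f) (?p A)) n"
      by (simp add: const_fun_simps(2)[OF f])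
  qed
qed

end

section \<open>Bifunctors on the simplex category\<close>

text \<open>A functor \<open>\<Delta> \<times> \<Delta> \<rightarrow> \<Delta>\<close>, given by its values \<open>jo\<close> on objects and \<open>ja\<close> on arrows. Its curried form
  \<open>rows\<close> is a functor on \<open>\<Delta>\<^sup>o\<^sup>p\<close>, whose value \<open>row n\<close> fixes the first argument.\<close>

locale Delta_bifunctor =
  fixes jo :: "nat \<Rightarrow> nat \<Rightarrow> nat" and ja :: "delta_arr \<Rightarrow> delta_arr \<Rightarrow> delta_arr"
  assumes ja_hom: "\<theta> \<in> hom Delta n n' \<Longrightarrow> \<psi> \<in> hom Delta m m' \<Longrightarrow> ja \<theta> \<psi> \<in> hom Delta (jo n m) (jo n' m')"
    and ja_id: "ja (Ident Delta n) (Ident Delta m) = Ident Delta (jo n m)"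
    and ja_cmp: "\<theta> \<in> hom Delta n n' \<Longrightarrow> \<theta>' \<in> hom Delta n' n'' \<Longrightarrow> \<psi> \<in> hom Delta m m' \<Longrightarrow> \<psi>' \<in> hom Delta m' m'' \<Longrightarrow>
      ja (Cmp Delta \<theta>' \<theta>) (Cmp Delta \<psi>' \<psi>) = Cmp Delta (ja \<theta>' \<psi>') (ja \<theta> \<psi>)"
begin

definition row :: "nat \<Rightarrow> (nat, delta_arr, nat, delta_arr) fctr" where
  "row n = \<lparr>fob = jo n, far = (\<lambda>\<psi> \<in> Arr Delta. ja (Ident Delta n) \<psi>)\<rparr>"

definition row_map :: "delta_arr \<Rightarrow> (nat, delta_arr, nat, delta_arr) ntrans" where
  "row_map \<theta> = mk_nt op_Delta (row (Cod Delta \<theta>)) (row (Dom Delta \<theta>)) (\<lambda>m. ja \<theta> (Ident Delta m))"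

definition rows :: "(nat, delta_arr, (nat, delta_arr, nat, delta_arr) fctr, (nat, delta_arr, nat, delta_arr) ntrans) fctr" where
  "rows = \<lparr>fob = row, far = (\<lambda>\<theta> \<in> Arr Delta. row_map \<theta>)\<rparr>"

lemma row_simps [simp]: "fob (row n) m = jo n m" "\<psi> \<in> Arr Delta \<Longrightarrow> far (row n) \<psi> = ja (Ident Delta n) \<psi>"
  by (simp_all add: row_def)

lemma rows_simps [simp]: "fob rows n = row n" "\<theta> \<in> Arr Delta \<Longrightarrow> far rows \<theta> = row_map \<theta>"
  by (simp_all add: rows_def)

lemma ja_interchange:
  assumes "\<theta> \<in> hom Delta n n'" "\<psi> \<in> hom Delta m m'"
  shows "Cmp Delta (ja \<theta> (Ident Delta m')) (ja (Ident Delta n) \<psi>) = ja \<theta> \<psi>"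
    "Cmp Delta (ja (Ident Delta n') \<psi>) (ja \<theta> (Ident Delta m)) = ja \<theta> \<psi>"
  using ja_cmp[OF Delta_id assms(1) assms(2) Delta_id] ja_cmp[OF assms(1) Delta_id Delta_id assms(2)]
    cat_idl[OF category_Delta assms(1)] cat_idr[OF category_Delta assms(1)]
    cat_idl[OF category_Delta assms(2)] cat_idr[OF category_Delta assms(2)] by simp_all

lemma row_functor: "is_functor op_Delta op_Delta (row n)"
proof (rule is_functorI)
  fix f g x y z assume "f \<in> hom op_Delta x y" "g \<in> hom op_Delta y z"
  then have f: "f \<in> hom Delta y x" and g: "g \<in> hom Delta z y" by simp_all
  show "far (row n) (Cmp op_Delta g f) = Cmp op_Delta (far (row n) g) (far (row n) f)"
    using ja_cmp[OF Delta_id Delta_id g f, of n] cat_idl[OF category_Delta Delta_id, of n] f g Delta_cmp[OF g f]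
    by (simp add: hom_Arr)
qed (use ja_hom[OF Delta_id] ja_id hom_Arr[OF Delta_id] in \<open>auto simp: row_def hom_Arr\<close>)

lemma row_map_hom:
  assumes t: "\<theta> \<in> hom Delta n n'"
  shows "row_map \<theta> \<in> hom (Fun op_Delta op_Delta) (row n') (row n)"
  unfolding row_map_def hom_Dom[OF t] hom_Cod[OF t]
proof (rule mk_nt_hom[OF cat_op row_functor row_functor])
  show "ja \<theta> (Ident Delta m) \<in> hom op_Delta (fob (row n') m) (fob (row n) m)" for m
    using ja_hom[OF t Delta_id] by simp
  fix f x y assume "f \<in> hom op_Delta x y"
  then have f: "f \<in> hom Delta y x" by simp
  show "Cmp op_Delta (ja \<theta> (Ident Delta y)) (far (row n') f) = Cmp op_Delta (far (row n) f) (ja \<theta> (Ident Delta x))"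
    using ja_interchange[OF t f] f by (simp add: hom_Arr)
qed

lemma ncomp_row_map [simp]: "ncomp (row_map \<theta>) m = ja \<theta> (Ident Delta m)"
  by (simp add: row_map_def)

lemma rows_functor: "is_functor op_Delta (Fun op_Delta op_Delta) rows"
proof (rule is_functorI)
  note FF = category_Fun[OF cat_op cat_op]
  show "fob rows \<in> extensional (Obj op_Delta)" "far rows \<in> extensional (Arr op_Delta)"
    by (simp_all add: rows_def)
  show "fob rows n \<in> Obj (Fun op_Delta op_Delta)" for n by (simp add: row_functor)
  show "far rows (Ident op_Delta n) = Ident (Fun op_Delta op_Delta) (fob rows n)" for n
    using hom_Arr[OF Delta_id, of n]
    by (simp, intro Fun_hom_eqI[OF row_map_hom[OF Delta_id] cat_id[OF FF]]) (auto simp: row_functor ja_id)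
  fix f x y assume "f \<in> hom op_Delta x y"
  then have f: "f \<in> hom Delta y x" by simp
  show "far rows f \<in> hom (Fun op_Delta op_Delta) (fob rows x) (fob rows y)"
    using row_map_hom[OF f] hom_Arr[OF f] by simp
  fix g z assume "g \<in> hom op_Delta y z"
  then have g: "g \<in> hom Delta z y" by simp
  show "far rows (Cmp op_Delta g f) = Cmp (Fun op_Delta op_Delta) (far rows g) (far rows f)"
    using hom_Arr[OF f] hom_Arr[OF g] hom_Arr[OF Delta_cmp[OF g f]]
    by (simp, intro Fun_hom_eqI[OF row_map_hom[OF Delta_cmp[OF g f]] cat_cmp[OF FF row_map_hom[OF f] row_map_hom[OF g]]])
      (use ja_cmp[OF g f Delta_id Delta_id] cat_idl[OF category_Delta Delta_id] in auto)
qed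

text \<open>The functor \<open>X \<mapsto> ((n, m) \<mapsto> X(jo n m))\<close> from simplicial to bisimplicial objects.\<close>

abbreviation bisimp :: "('o, 'a) cat \<Rightarrow> (('o, 'a) sobj, ('o, 'a) sarr,
    (('o, 'a) sobj, ('o, 'a) sarr) sobj, (('o, 'a) sobj, ('o, 'a) sarr) sarr) fctr" where
  "bisimp D \<equiv> res_fun op_Delta op_Delta op_Delta D rows"

lemma diag_bisimp:
  assumes D: "category D" and X: "is_functor op_Delta D X"
  shows "fob (diag_obj D (fob (bisimp D) X)) n = fob X (jo n n)"
    "\<theta> \<in> hom Delta m n \<Longrightarrow> far (diag_obj D (fob (bisimp D) X)) \<theta> = far X (ja \<theta> \<theta>)"
proof -
  show "fob (diag_obj D (fob (bisimp D) X)) n = fob X (jo n n)"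
    using X row_functor by (simp add: res_obj_def)
  assume t: "\<theta> \<in> hom Delta m n"
  have "Cmp D (far X (ja \<theta> (Ident Delta m))) (far X (ja (Ident Delta n) \<theta>)) = far X (ja \<theta> \<theta>)"
    using functor_cmp[OF X, of "ja (Ident Delta n) \<theta>" "jo n n" "jo n m" "ja \<theta> (Ident Delta m)" "jo m m"]
      ja_interchange(2)[OF t t] ja_hom[OF Delta_id t, of n] ja_hom[OF t Delta_id, of m] by simp
  then show "far (diag_obj D (fob (bisimp D) X)) \<theta> = far X (ja \<theta> \<theta>)"
    using X row_functor hom_Arr[OF t] Fun_homD(5)[OF row_map_hom[OF t]]
    by (simp add: res_obj_def diag_obj_simps(2)[OF t])
qed

end

subsection \<open>Contractible rows\<close>

text \<open>Each row of the bifunctor contracts naturally to its first argument: \<open>incl\<close> is natural in both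
  arguments, \<open>retr\<close> is a retraction of it that is natural along the row, and \<open>htp\<close> connects the identity
  to \<open>incl \<circ> retr\<close>. In degree \<open>m\<close> the homotopy assigns an endomorphism to each simplex
  \<open>k : [m] \<rightarrow> [1]\<close>. The number \<open>b\<close> is the end of \<open>\<Delta>[1]\<close> at which it is the identity, so that both
  directions of a homotopy are covered.\<close>

locale Delta_cone = Delta_bifunctor +
  fixes incl :: "nat \<Rightarrow> nat \<Rightarrow> delta_arr" and retr :: "nat \<Rightarrow> nat \<Rightarrow> delta_arr"
    and htp :: "nat \<Rightarrow> nat \<Rightarrow> delta_arr \<Rightarrow> delta_arr" and b :: nat
  assumes incl_hom: "incl n m \<in> hom Delta n (jo n m)"
    and incl_nat: "\<theta> \<in> hom Delta n n' \<Longrightarrow> \<psi> \<in> hom Delta m m' \<Longrightarrow> Cmp Delta (ja \<theta> \<psi>) (incl n m) = Cmp Delta (incl n' m') \<theta>"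
    and retr_hom: "retr n m \<in> hom Delta (jo n m) n"
    and retr_nat: "\<psi> \<in> hom Delta m m' \<Longrightarrow> Cmp Delta (retr n m') (ja (Ident Delta n) \<psi>) = retr n m"
    and retr_incl: "Cmp Delta (retr n m) (incl n m) = Ident Delta n"
    and b: "b \<le> 1"
    and htp_hom: "k \<in> hom Delta m 1 \<Longrightarrow> htp n m k \<in> hom Delta (jo n m) (jo n m)"
    and htp_nat: "\<psi> \<in> hom Delta m m' \<Longrightarrow> k \<in> hom Delta m' 1 \<Longrightarrow>
      Cmp Delta (ja (Ident Delta n) \<psi>) (htp n m (Cmp Delta k \<psi>)) = Cmp Delta (htp n m' k) (ja (Ident Delta n) \<psi>)"
    and htp_id: "htp n m (cyl_vertex b m) = Ident Delta (jo n m)"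
    and htp_incl_retr: "htp n m (cyl_vertex (1 - b) m) = Cmp Delta (incl n m) (retr n m)"
begin

text \<open>Restriction along \<open>incl\<close> is a natural map from \<open>bisimp\<close> to \<open>X \<mapsto> X \<times> \<Delta>\<close>.\<close>

definition row_pr :: "nat \<Rightarrow> (nat, delta_arr, nat, delta_arr) ntrans" where
  "row_pr n = mk_nt op_Delta (row n) (const_obj op_Delta op_Delta n) (incl n)"

definition rows_pr :: "(nat, delta_arr, (nat, delta_arr, nat, delta_arr) fctr, (nat, delta_arr, nat, delta_arr) ntrans) ntrans" where
  "rows_pr = mk_nt op_Delta rows (const_fun op_Delta op_Delta) row_pr"

lemma row_pr_hom: "row_pr n \<in> hom (Fun op_Delta op_Delta) (row n) (const_obj op_Delta op_Delta n)"
  unfolding row_pr_def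
proof (rule mk_nt_hom[OF cat_op row_functor const_obj_functor[OF cat_op cat_op]])
  show "n \<in> Obj op_Delta" by simp
  show "incl n m \<in> hom op_Delta (fob (row n) m) (fob (const_obj op_Delta op_Delta n) m)" for m
    using incl_hom[of n m] by simp
  fix f x y assume "f \<in> hom op_Delta x y"
  then have f: "f \<in> hom Delta y x" by simp
  show "Cmp op_Delta (incl n y) (far (row n) f) = Cmp op_Delta (far (const_obj op_Delta op_Delta n) f) (incl n x)"
    using incl_nat[OF Delta_id f, of n] hom_Arr[OF f] by simp
qed

lemma ncomp_row_pr [simp]: "ncomp (row_pr n) m = incl n m"
  by (simp add: row_pr_def)

lemma rows_pr_hom: "rows_pr \<in> hom (Fun op_Delta (Fun op_Delta op_Delta)) rows (const_fun op_Delta op_Delta)"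
  unfolding rows_pr_def
proof (rule mk_nt_hom[OF cat_op rows_functor const_functor[OF cat_op cat_op]])
  note FF = category_Fun[OF cat_op cat_op]
  show "row_pr n \<in> hom (Fun op_Delta op_Delta) (fob rows n) (fob (const_fun op_Delta op_Delta) n)" for n
    using row_pr_hom by simp
  fix f x y assume f': "f \<in> hom op_Delta x y"
  then have f: "f \<in> hom Delta y x" by simp
  have cf: "far (const_fun op_Delta op_Delta) f \<in> hom (Fun op_Delta op_Delta) (const_obj op_Delta op_Delta x) (const_obj op_Delta op_Delta y)"
    using functor_hom[OF const_functor[OF cat_op cat_op] f'] by simp
  have "Cmp (Fun op_Delta op_Delta) (row_pr y) (row_map f) = Cmp (Fun op_Delta op_Delta) (far (const_fun op_Delta op_Delta) f) (row_pr x)"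
    by (rule Fun_hom_eqI[OF cat_cmp[OF FF row_map_hom[OF f] row_pr_hom] cat_cmp[OF FF row_pr_hom cf]])
      (simp add: const_fun_simps(2)[OF f'] incl_nat[OF f Delta_id])
  then show "Cmp (Fun op_Delta op_Delta) (row_pr y) (far rows f) = Cmp (Fun op_Delta op_Delta) (far (const_fun op_Delta op_Delta) f) (row_pr x)"
    using hom_Arr[OF f] by simp
qed

lemma ncomp_rows_pr [simp]: "ncomp rows_pr n = row_pr n"
  by (simp add: rows_pr_def)

definition bisimp_pr where
  "bisimp_pr D = res_nt op_Delta op_Delta op_Delta D rows_pr"

lemma bisimp_pr_hom:
  assumes D: "category D"
  shows "bisimp_pr D \<in> hom (Fun (Simp D) (Simp (Simp D))) (bisimp D) (times_Delta D)"
  using res_nt_hom[OF cat_op cat_op cat_op D rows_pr_hom]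
  unfolding bisimp_pr_def res_const_fun[OF cat_op cat_op D] .

lemma bisimp_pr_comp:
  assumes D: "category D" and X: "is_functor op_Delta D X"
  shows "ncomp (ncomp (bisimp_pr D) X) n \<in> hom (Simp D) (comp_fun op_Delta X (row n)) (const_obj op_Delta D (fob X n))"
    "ncomp (ncomp (ncomp (bisimp_pr D) X) n) m = far X (incl n m)"
proof -
  have 1: "ncomp (ncomp (bisimp_pr D) X) n = whisker_left op_Delta X (row_pr n)"
    using X Fun_homD(5)[OF row_pr_hom] by (simp add: bisimp_pr_def)
  show "ncomp (ncomp (bisimp_pr D) X) n \<in> hom (Simp D) (comp_fun op_Delta X (row n)) (const_obj op_Delta D (fob X n))"
    using whisker_left_hom[OF cat_op X row_pr_hom, of n] comp_const[OF cat_op cat_op X, of n]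
    unfolding 1 by (simp add: D)
  show "ncomp (ncomp (ncomp (bisimp_pr D) X) n) m = far X (incl n m)"
    unfolding 1 by simp
qed

end

section \<open>Homotopies\<close>

context simplicial_descent
begin

lemma catD: "category D" and satE: "saturated D E"
  using relative by (auto simp: relative_category_def)

lemma copsD: "has_finite_coproducts D"
  using closed by (simp add: closed_by_finite_coproducts_def)

sublocale cyl: coproduct_category D
  by (intro coproduct_category.intro coproduct_category_axioms.intro catD copsD)

lemmas cSimp = category_Simp[OF catD]
lemmas cSimp2 = category_Simp[OF cSimp]

text \<open>The cylinder \<open>V \<boxtimes> \<Delta>[1]\<close> of a simplicial object, as the diagonal of \<open>n \<mapsto> V\<^sub>n \<boxtimes> \<Delta>[1]\<close>, with its ends
  and its projection to \<open>V\<close>.\<close>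

definition cyl_simp :: "('o, 'a) sobj \<Rightarrow> ('o, 'a) sobj" where
  "cyl_simp V = diag_obj D (comp_fun op_Delta (cyl_fun D) V)"

definition cyl_simp_end :: "('o, 'a) sobj \<Rightarrow> nat \<Rightarrow> ('o, 'a) sarr" where
  "cyl_simp_end V b = far (diag D) (whisker_right op_Delta (cyl_end D b) V)"

definition cyl_simp_proj :: "('o, 'a) sobj \<Rightarrow> ('o, 'a) sarr" where
  "cyl_simp_proj V = far (diag D) (whisker_right op_Delta (cyl_proj D) V)"

lemma cyl_simp_end_hom:
  assumes V: "is_functor op_Delta D V" and b: "b \<le> 1"
  shows "cyl_simp_end V b \<in> hom (Simp D) V (cyl_simp V)"
    "ncomp (cyl_simp_end V b) n = cylI D (fob V n) n (cyl_vertex b n)"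
proof -
  note w = whisker_right_hom[OF cat_op V cyl.cyl_end_hom[OF b]]
  show "cyl_simp_end V b \<in> hom (Simp D) V (cyl_simp V)"
    using diag_hom[OF catD w] by (simp add: cyl_simp_end_def cyl_simp_def diag_times_Delta[OF catD V])
  show "ncomp (cyl_simp_end V b) n = cylI D (fob V n) n (cyl_vertex b n)"
    unfolding cyl_simp_end_def ncomp_diag[OF w] using functor_obj[OF V, of n] by (simp add: cyl_end_def)
qed

lemma cyl_simp_proj_hom:
  assumes V: "is_functor op_Delta D V"
  shows "cyl_simp_proj V \<in> hom (Simp D) (cyl_simp V) V"
    "ncomp (cyl_simp_proj V) n = cyl_map D (fob V n) n (fob V n) (\<lambda>_. Ident D (fob V n))"
proof -
  note w = whisker_right_hom[OF cat_op V cyl.cyl_proj_hom]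
  show "cyl_simp_proj V \<in> hom (Simp D) (cyl_simp V) V"
    using diag_hom[OF catD w] by (simp add: cyl_simp_proj_def cyl_simp_def diag_times_Delta[OF catD V])
  show "ncomp (cyl_simp_proj V) n = cyl_map D (fob V n) n (fob V n) (\<lambda>_. Ident D (fob V n))"
    unfolding cyl_simp_proj_def ncomp_diag[OF w] using functor_obj[OF V, of n] by (simp add: cyl_proj_def)
qed

lemma cyl_proj_end:
  assumes V: "is_functor op_Delta D V" and b: "b \<le> 1"
  shows "Cmp (Simp D) (cyl_simp_proj V) (cyl_simp_end V b) = Ident (Simp D) V"
proof (rule Fun_hom_eqI[OF cat_cmp[OF cSimp cyl_simp_end_hom(1)[OF V b] cyl_simp_proj_hom(1)[OF V]] cat_id[OF cSimp]])
  show "V \<in> Obj (Simp D)" using V by simp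
  fix n
  have Vn: "fob V n \<in> Obj D" using functor_obj[OF V, of n] by simp
  show "ncomp (Cmp (Simp D) (cyl_simp_proj V) (cyl_simp_end V b)) n = ncomp (Ident (Simp D) V) n"
    using cyl.cyl_map(2)[OF Vn Vn cat_id[OF catD Vn] cyl_vertex_hom[OF b]]
    by (simp add: cyl_simp_end_hom(2)[OF V b] cyl_simp_proj_hom(2)[OF V] del: One_nat_def)
qed

text \<open>By \<open>\<mu>\<close>, the simple functor sends the diagonal of \<open>\<phi>\<close> to a weak equivalence if and only if
  the iterated simple functor sends \<open>\<phi>\<close> to one.\<close>

lemma diag_weq:
  assumes f: "\<phi> \<in> hom (Simp (Simp D)) Z Z'"
  shows "far s (far (diag D) \<phi>) \<in> E \<longleftrightarrow> far s (whisker_left op_Delta s \<phi>) \<in> E"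
  using weq_zigzag_transfer[OF cSimp2 catD satE f S2] f Fun_homD(5)[OF f]
  by (simp add: double_simple_def hom_Arr)

lemma levelwise_weq:
  assumes f: "\<phi> \<in> hom (Simp (Simp D)) Z Z'" and "\<And>n. far s (ncomp \<phi> n) \<in> E"
  shows "whisker_left op_Delta s \<phi> \<in> Simp_weqs D E"
  by (rule nat_weqsI[OF whisker_left_hom[OF cat_op S1_functor f]]) (use assms(2) in simp)

lemma diag_levelwise_weq:
  assumes f: "\<phi> \<in> hom (Simp (Simp D)) Z Z'" and "\<And>n. far s (ncomp \<phi> n) \<in> E"
  shows "far s (far (diag D) \<phi>) \<in> E"
  unfolding diag_weq[OF f] by (rule S4[OF levelwise_weq[OF assms]])

lemma cyl_end1_weq:
  assumes V: "is_functor op_Delta D V"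
  shows "far s (cyl_simp_end V 1) \<in> E"
  unfolding cyl_simp_end_def
proof (rule diag_levelwise_weq[OF whisker_right_hom[OF cat_op V cyl.cyl_end_hom]])
  fix n
  have Vn: "fob V n \<in> Obj D" using functor_obj[OF V, of n] by simp
  have k: "Cmp Delta coface0 (m, 0, \<lambda>i \<in> {0..m}. 0) = cyl_vertex 1 m" for m
  proof -
    have 1: "(m, 0, \<lambda>i \<in> {0..m}. 0) = dmap m 0 (\<lambda>_. 0)" "coface0 = dmap 0 1 (\<lambda>_. 1)"
      by (simp_all add: dmap_def coface0_def)
    have "dmap m 0 (\<lambda>_. 0) \<in> hom Delta m 0" "dmap 0 1 (\<lambda>_. 1) \<in> hom Delta 0 1" by (simp_all add: dmap_hom)
    then show ?thesis unfolding 1 by (auto simp: Cmp_Delta cyl_vertex_def dmap_def intro!: restrict_ext)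
  qed
  have "face_map (const_obj op_Delta D (fob V n)) (cyl_obj D (fob V n)) (cylI D (fob V n)) =
     mk_nt op_Delta (const_obj op_Delta D (fob V n)) (cyl_obj D (fob V n)) (\<lambda>m. cylI D (fob V n) m (cyl_vertex 1 m))"
    unfolding face_map_def mk_nt_def k by (simp add: restrict_def del: One_nat_def)
  then show "far s (ncomp (whisker_right op_Delta (cyl_end D 1) V) n) \<in> E"
    using S5[OF Vn, of "cyl_obj D (fob V n)" "cylI D (fob V n)"] cyl.cyl_tensor[OF Vn] Vn
    by (simp add: cyl_end_def del: One_nat_def)
qed simp

text \<open>The composite of \<open>s\<close> with the localization functor, on arrows.\<close>

abbreviation Ls where "Ls f \<equiv> loc_of D E (far s f)"

lemma Ls_hom: "f \<in> hom (Simp D) X Y \<Longrightarrow> Ls f \<in> hom (Loc D E) (fob s X) (fob s Y)"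
  by (rule loc_of_hom[OF catD functor_hom[OF S1_functor]])

lemma Ls_cmp: "f \<in> hom (Simp D) X Y \<Longrightarrow> g \<in> hom (Simp D) Y Z \<Longrightarrow> Ls (Cmp (Simp D) g f) = Cmp (Loc D E) (Ls g) (Ls f)"
  by (simp add: functor_cmp[OF S1_functor] loc_of_cmp[OF catD functor_hom[OF S1_functor] functor_hom[OF S1_functor]])

lemma Ls_id: "is_functor op_Delta D X \<Longrightarrow> Ls (Ident (Simp D) X) = Ident (Loc D E) (fob s X)"
  using functor_id[OF S1_functor, of X] functor_obj[OF S1_functor, of X] by (simp add: loc_of_id[OF catD])

text \<open>All ends are sections of the projection, and one of them becomes invertible, so they agree after
  localization.\<close>

lemma cyl_ends_eq:
  assumes V: "is_functor op_Delta D V" and b: "b \<le> 1" and c: "c \<le> 1"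
  shows "Ls (cyl_simp_end V b) = Ls (cyl_simp_end V c)"
proof -
  note L = category_Loc[OF catD, of E]
  note e = cyl_simp_end_hom(1)[OF V] and p = cyl_simp_proj_hom(1)[OF V]
  note Le = Ls_hom[OF e] and Lp = Ls_hom[OF p]
  have pe: "Cmp (Loc D E) (Ls (cyl_simp_proj V)) (Ls (cyl_simp_end V d)) = Ident (Loc D E) (fob s V)" if "d \<le> 1" for d
    using Ls_cmp[OF e[OF that] p] cyl_proj_end[OF V that] Ls_id[OF V] by simp
  have "is_iso (Loc D E) (Ls (cyl_simp_end V 1))"
    using saturated_iff[OF catD satE functor_hom[OF S1_functor e]] cyl_end1_weq[OF V] by blast
  then obtain q where q: "q \<in> hom (Loc D E) (fob s (cyl_simp V)) (fob s V)"
     "Cmp (Loc D E) q (Ls (cyl_simp_end V 1)) = Ident (Loc D E) (fob s V)"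
     "Cmp (Loc D E) (Ls (cyl_simp_end V 1)) q = Ident (Loc D E) (fob s (cyl_simp V))"
    using Le[of 1] by (auto elim: is_isoE)
  have "Ls (cyl_simp_proj V) = Cmp (Loc D E) (Cmp (Loc D E) (Ls (cyl_simp_proj V)) (Ls (cyl_simp_end V 1))) q"
    using cat_assoc[OF L q(1) Le Lp, of 1] q(3) cat_idr[OF L Lp] by simp
  then have "Ls (cyl_simp_proj V) = q" using pe[of 1] cat_idl[OF L q(1)] by simp
  then have "Cmp (Loc D E) (Ls (cyl_simp_end V 1)) (Ls (cyl_simp_proj V)) = Ident (Loc D E) (fob s (cyl_simp V))"
    using q by simp
  then have end1: "Ls (cyl_simp_end V d) = Ls (cyl_simp_end V 1)" if "d \<le> 1" for d
    using cat_assoc[OF L Le[OF that] Lp Le[of 1]] pe[OF that] cat_idl[OF L Le[OF that]] cat_idr[OF L Le[of 1]] by simp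
  show ?thesis unfolding end1[OF b] end1[OF c] ..
qed

text \<open>Here \<open>f\<close> has the section \<open>g\<close>, and \<open>h\<close> is a homotopy between the identity and \<open>g f\<close>, given by one
  endomorphism of \<open>V\<^sub>n\<close> for each simplex \<open>k : [n] \<rightarrow> [1]\<close>.\<close>

lemma homotopy_equiv_weq:
  assumes V: "is_functor op_Delta D V" and W: "is_functor op_Delta D W"
    and f: "f \<in> hom (Simp D) V W" and g: "g \<in> hom (Simp D) W V"
    and fg: "Cmp (Simp D) f g = Ident (Simp D) W"
    and h: "\<And>n k. k \<in> hom Delta n 1 \<Longrightarrow> h n k \<in> hom D (fob V n) (fob V n)"
    and hn: "\<And>\<theta> m n k. \<theta> \<in> hom Delta m n \<Longrightarrow> k \<in> hom Delta n 1 \<Longrightarrow>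
      Cmp D (far V \<theta>) (h n k) = Cmp D (h m (Cmp Delta k \<theta>)) (far V \<theta>)"
    and b: "b \<le> 1"
    and h0: "\<And>n. h n (cyl_vertex b n) = Ident D (fob V n)"
    and h1: "\<And>n. h n (cyl_vertex (1 - b) n) = Cmp D (ncomp g n) (ncomp f n)"
  shows "far s f \<in> E"
proof -
  note L = category_Loc[OF catD, of E]
  have b': "1 - b \<le> 1" by simp
  have Vn: "fob V n \<in> Obj D" for n using functor_obj[OF V, of n] by simp
  have Vh: "far V \<theta> \<in> hom D (fob V n) (fob V m)" if "\<theta> \<in> hom Delta m n" for \<theta> m n
    using functor_hom[OF V, of \<theta> n m] that by simp
  have u: "cyl_map D (fob V n) n (fob V n) (h n) \<in> hom D (cylP D (fob V n) n) (fob V n)"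
    "k \<in> hom Delta n 1 \<Longrightarrow> Cmp D (cyl_map D (fob V n) n (fob V n) (h n)) (cylI D (fob V n) n k) = h n k" for n k
    by (rule cyl.cyl_map[OF Vn Vn, where f = "h n"]; simp add: h del: One_nat_def)+
  \<comment> \<open>The homotopy as a map out of the cylinder.\<close>
  define H where "H = mk_nt op_Delta (cyl_simp V) V (\<lambda>n. cyl_map D (fob V n) n (fob V n) (h n))"
  have T: "is_functor op_Delta (Simp D) (comp_fun op_Delta (cyl_fun D) V)"
    by (rule comp_functor[OF cat_op V cyl.cyl_functor])
  have C: "is_functor op_Delta D (cyl_simp V)"
    unfolding cyl_simp_def by (rule diag_obj_functor[OF catD T])
  have Co: "fob (cyl_simp V) n = cylP D (fob V n) n" for n using Vn by (simp add: cyl_simp_def)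
  have H: "H \<in> hom (Simp D) (cyl_simp V) V"
    unfolding H_def
  proof (rule mk_nt_hom[OF cat_op C V])
    show "cyl_map D (fob V n) n (fob V n) (h n) \<in> hom D (fob (cyl_simp V) n) (fob V n)" for n
      using u(1) Co by simp
    fix \<theta> n m assume t': "\<theta> \<in> hom op_Delta n m"
    then have t: "\<theta> \<in> hom Delta m n" by simp
    note a = cyl.cyl_arr[OF Vh[OF t]] and c = cyl.cyl_obj_far[OF Vn[of n] t]
    have am: "ncomp (cyl_arr D (far V \<theta>)) m \<in> hom D (cylP D (fob V n) m) (cylP D (fob V m) m)"
      using Fun_hom_comp[OF a(1), of m] by simp
    have Cf: "far (cyl_simp V) \<theta> = Cmp D (ncomp (cyl_arr D (far V \<theta>)) m) (far (cyl_obj D (fob V n)) \<theta>)"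
      using Vn hom_Arr[OF t] cyl.cyl_fun_simps(2)[OF Vh[OF t]] by (simp add: cyl_simp_def diag_obj_simps(2)[OF t])
    show "Cmp D (cyl_map D (fob V m) m (fob V m) (h m)) (far (cyl_simp V) \<theta>) =
       Cmp D (far V \<theta>) (cyl_map D (fob V n) n (fob V n) (h n))"
      unfolding Cf
    proof (rule cyl.cyl_eqI[OF Vn cat_cmp[OF catD cat_cmp[OF catD c(1) am] u(1)] cat_cmp[OF catD u(1) Vh[OF t]]])
      fix k assume k: "k \<in> hom Delta n 1"
      note i = cyl.cylI[OF Vn[of n] k] and A = cat_assoc[OF catD]
      note kt = Delta_cmp[OF t k]
      have "Cmp D (Cmp D (cyl_map D (fob V m) m (fob V m) (h m)) (Cmp D (ncomp (cyl_arr D (far V \<theta>)) m) (far (cyl_obj D (fob V n)) \<theta>))) (cylI D (fob V n) n k)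
        = Cmp D (cyl_map D (fob V m) m (fob V m) (h m)) (Cmp D (ncomp (cyl_arr D (far V \<theta>)) m) (cylI D (fob V n) m (Cmp Delta k \<theta>)))"
        using A[OF i cat_cmp[OF catD c(1) am] u(1)] A[OF i c(1) am] c(2)[OF k] by simp
      also have "\<dots> = Cmp D (h m (Cmp Delta k \<theta>)) (far V \<theta>)"
        using a(2)[OF kt] A[OF Vh[OF t] cyl.cylI[OF Vn[of m] kt] u(1)] u(2)[OF kt] by simp
      also have "\<dots> = Cmp D (Cmp D (far V \<theta>) (cyl_map D (fob V n) n (fob V n) (h n))) (cylI D (fob V n) n k)"
        using hn[OF t k] A[OF i u(1) Vh[OF t]] u(2)[OF k] by simp
      finally show "Cmp D (Cmp D (cyl_map D (fob V m) m (fob V m) (h m)) (Cmp D (ncomp (cyl_arr D (far V \<theta>)) m) (far (cyl_obj D (fob V n)) \<theta>))) (cylI D (fob V n) n k)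
        = Cmp D (Cmp D (far V \<theta>) (cyl_map D (fob V n) n (fob V n) (h n))) (cylI D (fob V n) n k)" .
    qed
  qed
  have He: "ncomp (Cmp (Simp D) H (cyl_simp_end V d)) n = h n (cyl_vertex d n)" if "d \<le> 1" for d n
    using u(2)[OF cyl_vertex_hom[OF that], of n] by (simp add: H_def cyl_simp_end_hom(2)[OF V that])
  note e = cyl_simp_end_hom(1)[OF V]
  have 0: "Cmp (Simp D) H (cyl_simp_end V b) = Ident (Simp D) V"
    by (rule Fun_hom_eqI[OF cat_cmp[OF cSimp e[OF b] H] cat_id[OF cSimp]]) (use V He[OF b] h0 in simp_all)
  have 1: "Cmp (Simp D) H (cyl_simp_end V (1 - b)) = Cmp (Simp D) g f"
    by (rule Fun_hom_eqI[OF cat_cmp[OF cSimp e[OF b'] H] cat_cmp[OF cSimp f g]]) (use He[OF b'] h1 in simp_all)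
  have gf: "Cmp (Loc D E) (Ls g) (Ls f) = Ident (Loc D E) (fob s V)"
    using Ls_cmp[OF e[OF b] H] Ls_cmp[OF e[OF b'] H] cyl_ends_eq[OF V b b'] 0 1 Ls_id[OF V] Ls_cmp[OF f g] by simp
  have fg': "Cmp (Loc D E) (Ls f) (Ls g) = Ident (Loc D E) (fob s W)"
    using Ls_cmp[OF g f] fg Ls_id[OF W] by simp
  show ?thesis
    unfolding saturated_iff[OF catD satE functor_hom[OF S1_functor f]]
    by (rule is_isoI[OF Ls_hom[OF f] Ls_hom[OF g] gf fg'])
qed

end

section \<open>The join of ordinals\<close>

text \<open>The join of \<open>[n]\<close> and \<open>[m]\<close> is \<open>[n + m + 1]\<close>, written \<open>Suc (n + m)\<close>: first the elements of \<open>[n]\<close>, then those of \<open>[m]\<close>.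
  On arrows the sources and targets are read off from the triples.\<close>

definition join :: "delta_arr \<Rightarrow> delta_arr \<Rightarrow> delta_arr" where
  "join \<theta> \<psi> = dmap (Suc (fst \<theta> + fst \<psi>)) (Suc (fst (snd \<theta>) + fst (snd \<psi>)))
     (\<lambda>i. if i \<le> fst \<theta> then dfun \<theta> i else Suc (fst (snd \<theta>) + dfun \<psi> (i - Suc (fst \<theta>))))"

lemma hom_Delta_fst: "\<theta> \<in> hom Delta m n \<Longrightarrow> fst \<theta> = m" "\<theta> \<in> hom Delta m n \<Longrightarrow> fst (snd \<theta>) = n"
  by (auto simp: hom_def Delta_def)

lemma join_eq:
  assumes "\<theta> \<in> hom Delta n n'" "\<psi> \<in> hom Delta m m'"
  shows "join \<theta> \<psi> = dmap (Suc (n + m)) (Suc (n' + m')) (\<lambda>i. if i \<le> n then dfun \<theta> i else Suc (n' + dfun \<psi> (i - Suc n)))"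
  unfolding join_def hom_Delta_fst[OF assms(1)] hom_Delta_fst[OF assms(2)] ..

lemma join_hom:
  assumes t: "\<theta> \<in> hom Delta n n'" and p: "\<psi> \<in> hom Delta m m'"
  shows "join \<theta> \<psi> \<in> hom Delta (Suc (n + m)) (Suc (n' + m'))"
  unfolding join_eq[OF assms]
proof (rule dmap_hom)
  fix i assume "i \<le> Suc (n + m)"
  then show "(if i \<le> n then dfun \<theta> i else Suc (n' + dfun \<psi> (i - Suc n))) \<le> Suc (n' + m')"
    using hom_DeltaE(2)[OF t, of i] hom_DeltaE(2)[OF p, of "i - Suc n"] by auto
next
  fix i j assume "i \<le> j" "j \<le> Suc (n + m)"
  then show "(if i \<le> n then dfun \<theta> i else Suc (n' + dfun \<psi> (i - Suc n))) \<le>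
     (if j \<le> n then dfun \<theta> j else Suc (n' + dfun \<psi> (j - Suc n)))"
    using hom_DeltaE(2)[OF t, of i] hom_DeltaE(3)[OF t, of i j] hom_DeltaE(3)[OF p, of "i - Suc n" "j - Suc n"] by auto
qed

lemma dfun_join:
  assumes "\<theta> \<in> hom Delta n n'" "\<psi> \<in> hom Delta m m'" "i \<le> Suc (n + m)"
  shows "dfun (join \<theta> \<psi>) i = (if i \<le> n then dfun \<theta> i else Suc (n' + dfun \<psi> (i - Suc n)))"
  unfolding join_eq[OF assms(1,2)] using assms(3) by (rule dfun_dmap)

lemma join_bifunctor: "Delta_bifunctor (\<lambda>n m. Suc (n + m)) join"
proof
  show "join \<theta> \<psi> \<in> hom Delta (Suc (n + m)) (Suc (n' + m'))"
    if "\<theta> \<in> hom Delta n n'" "\<psi> \<in> hom Delta m m'" for \<theta> \<psi> n n' m m' by (rule join_hom[OF that])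
  show "join (Ident Delta n) (Ident Delta m) = Ident Delta (Suc (n + m))" for n m
    by (rule Delta_eqI[OF join_hom[OF Delta_id Delta_id] Delta_id])
      (auto simp: dfun_join[OF Delta_id Delta_id] simp del: One_nat_def)
  show "join (Cmp Delta \<theta>' \<theta>) (Cmp Delta \<psi>' \<psi>) = Cmp Delta (join \<theta>' \<psi>') (join \<theta> \<psi>)"
    if "\<theta> \<in> hom Delta n n'" "\<theta>' \<in> hom Delta n' n''" "\<psi> \<in> hom Delta m m'" "\<psi>' \<in> hom Delta m' m''"
    for \<theta> \<theta>' \<psi> \<psi>' n n' n'' m m' m''
  proof (rule Delta_eqI[OF join_hom[OF Delta_cmp[OF that(1,2)] Delta_cmp[OF that(3,4)]]
        Delta_cmp[OF join_hom[OF that(1,3)] join_hom[OF that(2,4)]]])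
    fix i assume i: "i \<le> Suc (n + m)"
    have j: "dfun (join \<theta> \<psi>) i \<le> Suc (n' + m')" by (rule hom_DeltaE(2)[OF join_hom[OF that(1,3)] i])
    show "dfun (join (Cmp Delta \<theta>' \<theta>) (Cmp Delta \<psi>' \<psi>)) i = dfun (Cmp Delta (join \<theta>' \<psi>') (join \<theta> \<psi>)) i"
      unfolding dfun_Cmp[OF join_hom[OF that(1,3)] join_hom[OF that(2,4)] i] dfun_join[OF Delta_cmp[OF that(1,2)] Delta_cmp[OF that(3,4)] i]
      unfolding dfun_join[OF that(2,4) j] unfolding dfun_join[OF that(1,3) i]
      using hom_DeltaE(2)[OF that(1), of i] i dfun_Cmp[OF that(1,2), of i] dfun_Cmp[OF that(3,4), of "i - Suc n"] by auto
  qed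
qed

text \<open>The inclusions of \<open>[n]\<close> as the left summand and of \<open>[m]\<close> as the right summand of the join of
  \<open>[n]\<close> and \<open>[m]\<close>. Each summand is a retract of the join; \<open>contrL\<close> and \<open>contrR\<close> are the homotopies
  that push the opposite summand, simplex by simplex, to the nearest vertex of the retract. A
  simplex \<open>k : [m] \<rightarrow> [1]\<close> cuts \<open>[m]\<close> in two, and only one of the two parts is moved.\<close>

definition inclL :: "nat \<Rightarrow> nat \<Rightarrow> delta_arr" where
  "inclL n m = dmap n (Suc (n + m)) (\<lambda>i. i)"

definition inclR :: "nat \<Rightarrow> nat \<Rightarrow> delta_arr" where
  "inclR m n = dmap m (Suc (n + m)) (\<lambda>i. Suc (n + i))"

definition retrL :: "nat \<Rightarrow> nat \<Rightarrow> delta_arr" where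
  "retrL n m = dmap (Suc (n + m)) n (\<lambda>i. min i n)"

definition retrR :: "nat \<Rightarrow> nat \<Rightarrow> delta_arr" where
  "retrR n m = dmap (Suc (m + n)) n (\<lambda>i. i - Suc m)"

definition contrL :: "nat \<Rightarrow> nat \<Rightarrow> delta_arr \<Rightarrow> delta_arr" where
  "contrL n m k = dmap (Suc (n + m)) (Suc (n + m)) (\<lambda>i. if i \<le> n \<or> dfun k (i - Suc n) = 1 then i else n)"

definition contrR :: "nat \<Rightarrow> nat \<Rightarrow> delta_arr \<Rightarrow> delta_arr" where
  "contrR n m k = dmap (Suc (m + n)) (Suc (m + n)) (\<lambda>i. if i \<le> m \<and> dfun k i = 1 then Suc m else i)"

lemma dfun_inclL: "i \<le> n \<Longrightarrow> dfun (inclL n m) i = i"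
  and dfun_inclR: "i \<le> m \<Longrightarrow> dfun (inclR m n) i = Suc (n + i)"
  and dfun_retrL: "i \<le> Suc (n + m) \<Longrightarrow> dfun (retrL n m) i = min i n"
  and dfun_retrR: "i \<le> Suc (m + n) \<Longrightarrow> dfun (retrR n m) i = i - Suc m"
  and dfun_contrL: "i \<le> Suc (n + m) \<Longrightarrow>
    dfun (contrL n m k) i = (if i \<le> n \<or> dfun k (i - Suc n) = 1 then i else n)"
  and dfun_contrR: "i \<le> Suc (m + n) \<Longrightarrow> dfun (contrR n m k) i = (if i \<le> m \<and> dfun k i = 1 then Suc m else i)"
  by (simp_all add: inclL_def inclR_def retrL_def retrR_def contrL_def contrR_def)

lemma inclL_hom: "inclL n m \<in> hom Delta n (Suc (n + m))"
  and inclR_hom: "inclR n m \<in> hom Delta n (Suc (m + n))"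
  and retrL_hom: "retrL n m \<in> hom Delta (Suc (n + m)) n"
  and retrR_hom: "retrR n m \<in> hom Delta (Suc (m + n)) n"
  unfolding inclL_def inclR_def retrL_def retrR_def by (auto intro!: dmap_hom)

lemma contrL_hom:
  assumes k: "k \<in> hom Delta m 1"
  shows "contrL n m k \<in> hom Delta (Suc (n + m)) (Suc (n + m))"
  unfolding contrL_def
proof (rule dmap_hom)
  fix i j assume ij: "i \<le> j" "j \<le> Suc (n + m)"
  then have "j - Suc n \<le> m" "i - Suc n \<le> j - Suc n" by auto
  then show "(if i \<le> n \<or> dfun k (i - Suc n) = 1 then i else n) \<le> (if j \<le> n \<or> dfun k (j - Suc n) = 1 then j else n)"
    using ij hom_DeltaE(2)[OF k, of "j - Suc n"] hom_DeltaE(3)[OF k, of "i - Suc n" "j - Suc n"] by auto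
qed auto

lemma contrR_hom:
  assumes k: "k \<in> hom Delta m 1"
  shows "contrR n m k \<in> hom Delta (Suc (m + n)) (Suc (m + n))"
  unfolding contrR_def
proof (rule dmap_hom)
  fix i j assume "i \<le> j" "j \<le> Suc (m + n)"
  then show "(if i \<le> m \<and> dfun k i = 1 then Suc m else i) \<le> (if j \<le> m \<and> dfun k j = 1 then Suc m else j)"
    using hom_DeltaE(2)[OF k, of j] hom_DeltaE(3)[OF k, of i j] by (cases "j \<le> m") auto
qed auto

text \<open>The rows of the join contract to the left summand, and those of the transposed join to the right
  summand. The homotopies run in opposite directions.\<close>

interpretation joinL: Delta_cone "\<lambda>n m. Suc (n + m)" join inclL retrL contrL 1
proof (intro Delta_cone.intro Delta_cone_axioms.intro join_bifunctor)
  show "inclL n m \<in> hom Delta n (Suc (n + m))" "retrL n m \<in> hom Delta (Suc (n + m)) n" for n m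
    by (rule inclL_hom, rule retrL_hom)
  show "contrL n m k \<in>
      hom Delta (Suc (n + m)) (Suc (n + m))" if "k \<in> hom Delta m 1" for n m k by (rule contrL_hom[OF that])
  show "Cmp Delta (join \<theta> \<psi>) (inclL n m) = Cmp Delta (inclL n' m') \<theta>"
    if t: "\<theta> \<in> hom Delta n n'" and p: "\<psi> \<in> hom Delta m m'" for \<theta> \<psi> n n' m m'
    by (rule Delta_eqI[OF Delta_cmp[OF inclL_hom join_hom[OF t p]] Delta_cmp[OF t inclL_hom]])
     (use hom_DeltaE(2)[OF t] in \<open>simp add: dfun_Cmp[OF inclL_hom join_hom[OF t p]] dfun_Cmp[OF t inclL_hom] dfun_inclL dfun_join[OF t p] dfun_retrL del: One_nat_def\<close>)
  show "Cmp Delta (retrL n m') (join (Ident Delta n) \<psi>) = retrL n m"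
    if p: "\<psi> \<in> hom Delta m m'" for \<psi> n m m'
    by (rule Delta_eqI[OF Delta_cmp[OF join_hom[OF Delta_id p] retrL_hom] retrL_hom])
     (use hom_DeltaE(2)[OF join_hom[OF Delta_id p]] in
      \<open>simp add: dfun_Cmp[OF join_hom[OF Delta_id p] retrL_hom] dfun_join[OF Delta_id p] dfun_retrL del: One_nat_def\<close>)
  show "Cmp Delta (retrL n m) (inclL n m) = Ident Delta n" for n m
    by (rule Delta_eqI[OF Delta_cmp[OF inclL_hom retrL_hom] Delta_id])
      (simp add: dfun_Cmp[OF inclL_hom retrL_hom] dfun_inclL dfun_retrL del: One_nat_def)
  show "Cmp Delta (join (Ident Delta n) \<psi>) (contrL n m (Cmp Delta k \<psi>)) =
    Cmp Delta (contrL n m' k) (join (Ident Delta n) \<psi>)"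
    if p: "\<psi> \<in> hom Delta m m'" and k: "k \<in> hom Delta m' 1" for \<psi> k n m m'
  proof (rule Delta_eqI[OF Delta_cmp[OF contrL_hom[OF Delta_cmp[OF p k]] join_hom[OF Delta_id p]] Delta_cmp[OF join_hom[OF Delta_id p] contrL_hom[OF k]]])
    fix i assume i: "i \<le> Suc (n + m)"
    have j: "dfun (join (Ident Delta n) \<psi>) i \<le> Suc (n + m')" by (rule hom_DeltaE(2)[OF join_hom[OF Delta_id p] i])
    show "dfun (Cmp Delta (join (Ident Delta n) \<psi>) (contrL n m (Cmp Delta k \<psi>))) i =
      dfun (Cmp Delta (contrL n m' k) (join (Ident Delta n) \<psi>)) i"
      unfolding dfun_Cmp[OF contrL_hom[OF Delta_cmp[OF p k]] join_hom[OF Delta_id p] i] dfun_Cmp[OF join_hom[OF Delta_id p] contrL_hom[OF k] i]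
        dfun_contrL[OF i] dfun_contrL[OF j]
      using i dfun_Cmp[OF p k, of "i - Suc n"] by (auto simp: dfun_join[OF Delta_id p] dfun_retrL dfun_contrL simp del: One_nat_def)
  qed
  show "contrL n m (cyl_vertex 1 m) = Ident Delta (Suc (n + m))" for n m
    by (rule Delta_eqI[OF contrL_hom[OF cyl_vertex_hom] Delta_id]) (auto simp: cyl_vertex_def dfun_retrL dfun_contrL simp del: One_nat_def)
  show "contrL n m (cyl_vertex (1 - 1) m) =
    Cmp Delta (inclL n m) (retrL n m)" for n m
    by (rule Delta_eqI[OF contrL_hom[OF cyl_vertex_hom] Delta_cmp[OF retrL_hom inclL_hom]])
      (auto simp: cyl_vertex_def dfun_Cmp[OF retrL_hom inclL_hom] dfun_inclL dfun_retrL dfun_contrL simp del: One_nat_def)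
qed simp

interpretation joinR: Delta_cone "\<lambda>n m. Suc (m + n)" "\<lambda>\<theta> \<psi>. join \<psi> \<theta>" inclR retrR contrR 0
proof (intro Delta_cone.intro Delta_cone_axioms.intro)
  show "Delta_bifunctor (\<lambda>n m. Suc (m + n)) (\<lambda>\<theta> \<psi>. join \<psi> \<theta>)"
    by unfold_locales (simp_all only: joinL.ja_hom joinL.ja_id joinL.ja_cmp)
  show "inclR n m \<in> hom Delta n (Suc (m + n))" "retrR n m \<in> hom Delta (Suc (m + n)) n" for n m
    by (rule inclR_hom, rule retrR_hom)
  show "contrR n m k \<in>
      hom Delta (Suc (m + n)) (Suc (m + n))" if "k \<in> hom Delta m 1" for n m k by (rule contrR_hom[OF that])
  show "Cmp Delta (join \<psi> \<theta>) (inclR n m) = Cmp Delta (inclR n' m') \<theta>"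
    if t: "\<theta> \<in> hom Delta n n'" and p: "\<psi> \<in> hom Delta m m'" for \<theta> \<psi> n n' m m'
    by (rule Delta_eqI[OF Delta_cmp[OF inclR_hom join_hom[OF p t]] Delta_cmp[OF t inclR_hom]])
     (use hom_DeltaE(2)[OF t] in \<open>simp add: dfun_Cmp[OF inclR_hom join_hom[OF p t]] dfun_Cmp[OF t inclR_hom] dfun_inclR dfun_join[OF p t] dfun_retrR del: One_nat_def\<close>)
  show "Cmp Delta (retrR n m') (join \<psi> (Ident Delta n)) = retrR n m"
    if p: "\<psi> \<in> hom Delta m m'" for \<psi> n m m'
  proof (rule Delta_eqI[OF Delta_cmp[OF join_hom[OF p Delta_id] retrR_hom] retrR_hom])
    fix i assume i: "i \<le> Suc (m + n)"
    have j: "dfun (join \<psi> (Ident Delta n)) i \<le> Suc (m' + n)" by (rule hom_DeltaE(2)[OF join_hom[OF p Delta_id] i])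
    show "dfun (Cmp Delta (retrR n m') (join \<psi> (Ident Delta n))) i = dfun (retrR n m) i"
      unfolding dfun_Cmp[OF join_hom[OF p Delta_id] retrR_hom i] dfun_retrR[OF i] dfun_retrR[OF j]
      unfolding dfun_join[OF p Delta_id i]
      using hom_DeltaE(2)[OF p, of i] i by auto
  qed
  show "Cmp Delta (retrR n m) (inclR n m) = Ident Delta n" for n m
    by (rule Delta_eqI[OF Delta_cmp[OF inclR_hom retrR_hom] Delta_id])
      (simp add: dfun_Cmp[OF inclR_hom retrR_hom] dfun_inclR dfun_retrR del: One_nat_def)
  show "Cmp Delta (join \<psi> (Ident Delta n)) (contrR n m (Cmp Delta k \<psi>)) =
    Cmp Delta (contrR n m' k) (join \<psi> (Ident Delta n))"
    if p: "\<psi> \<in> hom Delta m m'" and k: "k \<in> hom Delta m' 1" for \<psi> k n m m'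
  proof (rule Delta_eqI[OF Delta_cmp[OF contrR_hom[OF Delta_cmp[OF p k]] join_hom[OF p Delta_id]] Delta_cmp[OF join_hom[OF p Delta_id] contrR_hom[OF k]]])
    fix i assume i: "i \<le> Suc (m + n)"
    have j: "dfun (join \<psi> (Ident Delta n)) i \<le> Suc (m' + n)" by (rule hom_DeltaE(2)[OF join_hom[OF p Delta_id] i])
    show "dfun (Cmp Delta (join \<psi> (Ident Delta n)) (contrR n m (Cmp Delta k \<psi>))) i =
      dfun (Cmp Delta (contrR n m' k) (join \<psi> (Ident Delta n))) i"
      unfolding dfun_Cmp[OF contrR_hom[OF Delta_cmp[OF p k]] join_hom[OF p Delta_id] i] dfun_Cmp[OF join_hom[OF p Delta_id] contrR_hom[OF k] i]
        dfun_contrR[OF i] dfun_contrR[OF j]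
      using i dfun_Cmp[OF p k, of i] hom_DeltaE(2)[OF p, of i] by (auto simp: dfun_join[OF p Delta_id] dfun_retrR dfun_contrR simp del: One_nat_def)
  qed
  show "contrR n m (cyl_vertex 0 m) = Ident Delta (Suc (m + n))" for n m
    by (rule Delta_eqI[OF contrR_hom[OF cyl_vertex_hom] Delta_id]) (auto simp: cyl_vertex_def dfun_retrR dfun_contrR simp del: One_nat_def)
  show "contrR n m (cyl_vertex (1 - 0) m) =
    Cmp Delta (inclR n m) (retrR n m)" for n m
    by (rule Delta_eqI[OF contrR_hom[OF cyl_vertex_hom] Delta_cmp[OF retrR_hom inclR_hom]])
      (auto simp: cyl_vertex_def dfun_Cmp[OF retrR_hom inclR_hom] dfun_inclR dfun_retrR dfun_contrR simp del: One_nat_def)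
qed simp

text \<open>Restriction along the inclusion of the right summand is a natural map from \<open>joinL.bisimp\<close> to
  \<open>X \<mapsto> \<Delta> \<times> X\<close>.\<close>

definition row_pr2 :: "nat \<Rightarrow> (nat, delta_arr, nat, delta_arr) ntrans" where
  "row_pr2 n = mk_nt op_Delta (joinL.row n) (id_fun op_Delta) (\<lambda>m. inclR m n)"

definition rows_pr2 :: "(nat, delta_arr, (nat, delta_arr, nat, delta_arr) fctr, (nat, delta_arr, nat, delta_arr) ntrans) ntrans" where
  "rows_pr2 = mk_nt op_Delta joinL.rows (const_obj op_Delta (Fun op_Delta op_Delta) (id_fun op_Delta)) row_pr2"

lemma row_pr2_hom: "row_pr2 n \<in> hom (Fun op_Delta op_Delta) (joinL.row n) (id_fun op_Delta)"
  unfolding row_pr2_def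
proof (rule mk_nt_hom[OF cat_op joinL.row_functor id_functor[OF cat_op]])
  show "inclR m n \<in> hom op_Delta (fob (joinL.row n) m) (fob (id_fun op_Delta) m)" for m
    using joinR.incl_hom[of m n] by simp
  fix f x y assume "f \<in> hom op_Delta x y"
  then have f: "f \<in> hom Delta y x" by simp
  show "Cmp op_Delta (inclR y n) (far (joinL.row n) f) = Cmp op_Delta (far (id_fun op_Delta) f) (inclR x n)"
    using joinR.incl_nat[OF f Delta_id] hom_Arr[OF f] by simp
qed

lemma ncomp_row_pr2 [simp]: "ncomp (row_pr2 n) m = inclR m n"
  by (simp add: row_pr2_def)

lemma rows_pr2_hom: "rows_pr2 \<in> hom (Fun op_Delta (Fun op_Delta op_Delta)) joinL.rows
    (const_obj op_Delta (Fun op_Delta op_Delta) (id_fun op_Delta))"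
  unfolding rows_pr2_def
proof (rule mk_nt_hom[OF cat_op joinL.rows_functor const_obj_functor[OF cat_op category_Fun[OF cat_op cat_op]]])
  note FF = category_Fun[OF cat_op cat_op]
  show id: "id_fun op_Delta \<in> Obj (Fun op_Delta op_Delta)" using id_functor[OF cat_op] by simp
  show "row_pr2 n \<in> hom (Fun op_Delta op_Delta) (fob joinL.rows n) (fob (const_obj op_Delta (Fun op_Delta op_Delta) (id_fun op_Delta)) n)" for n
    using row_pr2_hom by simp
  fix f x y assume f': "f \<in> hom op_Delta x y"
  then have f: "f \<in> hom Delta y x" by simp
  have "Cmp (Fun op_Delta op_Delta) (row_pr2 y) (joinL.row_map f) = row_pr2 x"
    by (rule Fun_hom_eqI[OF cat_cmp[OF FF joinL.row_map_hom[OF f] row_pr2_hom] row_pr2_hom])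
      (use joinR.incl_nat[OF Delta_id f] cat_idr[OF category_Delta joinR.incl_hom] in simp)
  then show "Cmp (Fun op_Delta op_Delta) (row_pr2 y) (far joinL.rows f) =
     Cmp (Fun op_Delta op_Delta) (far (const_obj op_Delta (Fun op_Delta op_Delta) (id_fun op_Delta)) f) (row_pr2 x)"
    using hom_Arr[OF f] cat_idl[OF FF row_pr2_hom] by simp
qed

definition bisimp_pr2 where
  "bisimp_pr2 D = res_nt op_Delta op_Delta op_Delta D rows_pr2"

lemma bisimp_pr2_hom:
  assumes D: "category D"
  shows "bisimp_pr2 D \<in> hom (Fun (Simp D) (Simp (Simp D))) (joinL.bisimp D) (Delta_times D)"
  using res_nt_hom[OF cat_op cat_op cat_op D rows_pr2_hom]
  unfolding bisimp_pr2_def res_const_id[OF cat_op cat_op D] .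

lemma bisimp_pr2_comp:
  assumes D: "category D" and X: "is_functor op_Delta D X"
  shows "ncomp (ncomp (ncomp (bisimp_pr2 D) X) n) m = far X (inclR m n)"
proof -
  have "ncomp (ncomp (bisimp_pr2 D) X) n = whisker_left op_Delta X (row_pr2 n)"
    using X Fun_homD(5)[OF row_pr2_hom] by (simp add: bisimp_pr2_def rows_pr2_def)
  then show ?thesis by simp
qed

section \<open>The unit\<close>

context simplicial_descent
begin

text \<open>In a row with contraction the projection to the constant object is a homotopy equivalence.\<close>

lemma cone_pr_weq:
  assumes cone: "Delta_cone jo ja incl retr htp b" and X: "is_functor op_Delta D X"
  shows "far s (ncomp (ncomp (Delta_cone.bisimp_pr jo ja incl D) X) n) \<in> E"
proof -
  interpret Delta_cone jo ja incl retr htp b by (rule cone)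
  define V where "V = comp_fun op_Delta X (row n)"
  have V: "is_functor op_Delta D V"
    unfolding V_def by (rule comp_functor[OF cat_op row_functor X])
  have Vf: "far V \<theta> = far X (ja (Ident Delta n) \<theta>)" if "\<theta> \<in> hom Delta m m'" for \<theta> m m'
    using hom_Arr[OF that] by (simp add: V_def)
  have Vo: "fob V m = fob X (jo n m)" for m by (simp add: V_def)
  have Xn: "fob X m \<in> Obj D" for m using functor_obj[OF X, of m] by simp
  have Xh: "far X \<theta> \<in> hom D (fob X m') (fob X m)" if "\<theta> \<in> hom Delta m m'" for \<theta> m m'
    using functor_hom[OF X, of \<theta> m' m] that by simp
  have Xc: "Cmp D (far X \<theta>) (far X \<phi>) = far X (Cmp Delta \<phi> \<theta>)" if "\<theta> \<in> hom Delta m m'" "\<phi> \<in> hom Delta m' m''" for \<theta> \<phi> m m' m''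
    using functor_cmp[OF X, of \<phi> m'' m' \<theta> m] that by simp
  have Xi: "far X (Ident Delta m) = Ident D (fob X m)" for m using functor_id[OF X, of m] by simp
  let ?W = "const_obj op_Delta D (fob X n)"
  have W: "is_functor op_Delta D ?W" by (rule const_obj_functor[OF cat_op catD Xn])
  define g where "g = mk_nt op_Delta ?W V (\<lambda>m. far X (retr n m))"
  have g: "g \<in> hom (Simp D) ?W V"
    unfolding g_def
  proof (rule mk_nt_hom[OF cat_op W V])
    show "far X (retr n m) \<in> hom D (fob ?W m) (fob V m)" for m using Xh[OF retr_hom] by (simp add: Vo)
    fix \<theta> y x assume "\<theta> \<in> hom op_Delta y x"
    then have t: "\<theta> \<in> hom Delta x y" by simp
    show "Cmp D (far X (retr n x)) (far ?W \<theta>) = Cmp D (far V \<theta>) (far X (retr n y))"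
      using hom_Arr[OF t] Vf[OF t] Xc[OF ja_hom[OF Delta_id t] retr_hom] retr_nat[OF t] cat_idr[OF catD Xh[OF retr_hom]] by simp
  qed
  let ?f = "ncomp (ncomp (bisimp_pr D) X) n"
  note f = bisimp_pr_comp[OF catD X, of n, folded V_def]
  have fg: "Cmp (Simp D) ?f g = Ident (Simp D) ?W"
    by (rule Fun_hom_eqI[OF cat_cmp[OF cSimp g f(1)] cat_id[OF cSimp]])
      (use W Xc[OF incl_hom retr_hom] in \<open>simp_all add: f(2) g_def retr_incl Xi\<close>)
  show ?thesis
  proof (rule homotopy_equiv_weq[OF V W f(1) g fg, where h = "\<lambda>m k. far X (htp n m k)", OF _ _ b])
    show "far X (htp n m k) \<in> hom D (fob V m) (fob V m)" if "k \<in> hom Delta m 1" for m k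
      using Xh[OF htp_hom[OF that]] by (simp add: Vo)
    show "Cmp D (far V \<theta>) (far X (htp n m' k)) = Cmp D (far X (htp n m (Cmp Delta k \<theta>))) (far V \<theta>)"
      if t: "\<theta> \<in> hom Delta m m'" and k: "k \<in> hom Delta m' 1" for \<theta> m m' k
      using Xc[OF ja_hom[OF Delta_id t] htp_hom[OF k]] Xc[OF htp_hom[OF Delta_cmp[OF t k]] ja_hom[OF Delta_id t]]
        htp_nat[OF t k] Vf[OF t] by simp
    show "far X (htp n m (cyl_vertex b m)) = Ident D (fob V m)" for m by (simp add: htp_id Xi Vo)
    show "far X (htp n m (cyl_vertex (1 - b) m)) = Cmp D (ncomp g m) (ncomp ?f m)" for m
      using Xc[OF retr_hom incl_hom] unfolding htp_incl_retr f(2) g_def by simp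
  qed
qed

text \<open>The simple functor of each row: \<open>Z \<mapsto> (n \<mapsto> s(Z\<^sub>n))\<close>.\<close>

abbreviation s_levels where "s_levels \<equiv> post_simp (Simp D) s"

lemmas s_levels_functor = post_functor[OF cat_op cSimp S1_functor]

lemma pr_hom:
  assumes X: "is_functor op_Delta D X"
  shows "ncomp (joinL.bisimp_pr D) X \<in> hom (Simp (Simp D)) (fob (joinL.bisimp D) X) (comp_fun op_Delta (const_simp D) X)"
    "ncomp (joinR.bisimp_pr D) X \<in> hom (Simp (Simp D)) (fob (joinR.bisimp D) X) (comp_fun op_Delta (const_simp D) X)"
    "ncomp (bisimp_pr2 D) X \<in> hom (Simp (Simp D)) (fob (joinL.bisimp D) X) (const_obj op_Delta (Simp D) X)"
  using Fun_hom_comp[OF joinL.bisimp_pr_hom[OF catD], of X] Fun_hom_comp[OF joinR.bisimp_pr_hom[OF catD], of X]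
    Fun_hom_comp[OF bisimp_pr2_hom[OF catD], of X] X by simp_all

lemma pr1_weq:
  assumes X: "is_functor op_Delta D X"
  shows "whisker_left op_Delta s (ncomp (joinL.bisimp_pr D) X) \<in> Simp_weqs D E"
  by (rule levelwise_weq[OF pr_hom(1)[OF X] cone_pr_weq[OF joinL.Delta_cone_axioms X]])

text \<open>The join and its transpose have the same diagonal, and on it the projection to the right summand is
  the first projection of the transpose.\<close>

lemma diag_pr2:
  assumes X: "is_functor op_Delta D X"
  shows "far (diag D) (ncomp (bisimp_pr2 D) X) = far (diag D) (ncomp (joinR.bisimp_pr D) X)"
proof -
  have BL: "is_functor op_Delta (Simp D) (fob (joinL.bisimp D) X)" and BR: "is_functor op_Delta (Simp D) (fob (joinR.bisimp D) X)"
    using Fun_homD(1)[OF pr_hom(1)[OF X]] Fun_homD(1)[OF pr_hom(2)[OF X]] .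
  have d: "diag_obj D (fob (joinL.bisimp D) X) = diag_obj D (fob (joinR.bisimp D) X)"
  proof (rule functor_eqI[OF diag_obj_functor[OF catD BL] diag_obj_functor[OF catD BR]])
    show "fob (diag_obj D (fob (joinL.bisimp D) X)) n = fob (diag_obj D (fob (joinR.bisimp D) X)) n" for n
      unfolding joinL.diag_bisimp(1)[OF catD X] joinR.diag_bisimp(1)[OF catD X] ..
    fix \<theta> n m assume "\<theta> \<in> hom op_Delta n m"
    then have t: "\<theta> \<in> hom Delta m n" by simp
    show "far (diag_obj D (fob (joinL.bisimp D) X)) \<theta> = far (diag_obj D (fob (joinR.bisimp D) X)) \<theta>"
      unfolding joinL.diag_bisimp(2)[OF catD X t] joinR.diag_bisimp(2)[OF catD X t] ..
  qed
  note 1 = diag_hom[OF catD pr_hom(3)[OF X]] and 2 = diag_hom[OF catD pr_hom(2)[OF X]]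
  show ?thesis
  proof (rule Fun_hom_eqI[OF 1])
    show "far (diag D) (ncomp (joinR.bisimp_pr D) X) \<in> hom (Simp D) (diag_obj D (fob (joinL.bisimp D) X)) (diag_obj D (const_obj op_Delta (Simp D) X))"
      using 2 unfolding d diag_times_Delta[OF catD X] diag_Delta_times[OF catD X] .
    show "ncomp (far (diag D) (ncomp (bisimp_pr2 D) X)) n = ncomp (far (diag D) (ncomp (joinR.bisimp_pr D) X)) n" for n
      unfolding ncomp_diag[OF pr_hom(3)[OF X]] ncomp_diag[OF pr_hom(2)[OF X]] bisimp_pr2_comp[OF catD X] joinR.bisimp_pr_comp(2)[OF catD X] ..
  qed
qed

lemma pr2_weq:
  assumes X: "is_functor op_Delta D X"
  shows "far s (whisker_left op_Delta s (ncomp (bisimp_pr2 D) X)) \<in> E"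
  unfolding diag_weq[OF pr_hom(3)[OF X], symmetric] diag_pr2[OF X]
  by (rule diag_levelwise_weq[OF pr_hom(2)[OF X] cone_pr_weq[OF joinR.Delta_cone_axioms X]])

text \<open>The span \<open>(n \<mapsto> s c (X\<^sub>n)) \<leftarrow> (n \<mapsto> s(X\<^sub>n\<^sub>+\<^sub>\<bullet>\<^sub>+\<^sub>1)) \<rightarrow> c s X\<close>, natural in \<open>X\<close>; \<open>unit_mid\<close> is its middle.\<close>

definition unit_left where "unit_left = whisker_left (Simp D) s_levels (joinL.bisimp_pr D)"
definition unit_right where "unit_right = whisker_left (Simp D) s_levels (bisimp_pr2 D)"
definition unit_mid where "unit_mid = comp_fun (Simp D) s_levels (joinL.bisimp D)"

lemma unit_left_hom: "unit_left \<in> hom (Fun (Simp D) (Simp D)) unit_mid (post_simp D (comp_fun D s (const_simp D)))"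
  using whisker_left_hom[OF cSimp s_levels_functor joinL.bisimp_pr_hom[OF catD]]
  unfolding unit_left_def unit_mid_def post_comp[OF cat_op cSimp catD const_functor[OF cat_op catD] S1_functor] .

lemma unit_right_hom: "unit_right \<in> hom (Fun (Simp D) (Simp D)) unit_mid (comp_fun (Simp D) (const_simp D) s)"
  using whisker_left_hom[OF cSimp s_levels_functor bisimp_pr2_hom[OF catD]]
  unfolding unit_right_def unit_mid_def comp_fun_const_fun[OF cat_op cSimp catD S1_functor] .

lemma unit_comp:
  assumes X: "is_functor op_Delta D X"
  shows "ncomp unit_left X = whisker_left op_Delta s (ncomp (joinL.bisimp_pr D) X)"
    "ncomp unit_right X = whisker_left op_Delta s (ncomp (bisimp_pr2 D) X)"
  using X Fun_homD(5)[OF pr_hom(1)[OF X]] Fun_homD(5)[OF pr_hom(3)[OF X]] by (simp_all add: unit_left_def unit_right_def)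

lemma unit_left_weq: "unit_left \<in> nat_weqs (Simp D) (Simp D) (Simp_weqs D E)"
  by (rule nat_weqsI[OF unit_left_hom]) (simp add: unit_comp pr1_weq)

lemma Simp_weqs_simple: "Simp_weqs D E \<subseteq> simple_weqs D E s"
  using S4 by (auto simp: simple_weqs_def nat_weqs_def)

lemma unit_right_weq: "unit_right \<in> nat_weqs (Simp D) (Simp D) (simple_weqs D E s)"
proof (rule nat_weqsI[OF unit_right_hom])
  fix X assume "X \<in> Obj (Simp D)"
  then have X: "is_functor op_Delta D X" by simp
  then show "ncomp unit_right X \<in> simple_weqs D E s"
    using Fun_homD(5)[OF Fun_hom_comp[OF unit_right_hom], of X] by (simp add: simple_weqs_def unit_comp pr2_weq)
qed

end

section \<open>The adjunction and the equivalence\<close>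

context simplicial_descent
begin

abbreviation simple_const where "simple_const \<equiv> comp_fun D s (const_simp D)"
abbreviation const_simple where "const_simple \<equiv> comp_fun (Simp D) (const_simp D) s"

text \<open>The zigzag \<open>\<lambda>\<close> in each degree, from \<open>n \<mapsto> s c (X\<^sub>n)\<close> to \<open>X\<close>.\<close>

definition lam_levels where "lam_levels = map (map_step (post_ntrans op_Delta D)) lam"

lemma lam_levels: "weq_zigzag (Simp D) (Simp D) (Simp_weqs D E) (post_simp D simple_const) lam_levels (id_fun (Simp D))"
  using post_weq_zigzag[OF cat_op catD catD S3] unfolding lam_levels_def post_id[OF cat_op catD] .

text \<open>The zigzag from \<open>X\<close> to \<open>c s X\<close> representing the unit. Its backward steps lie in \<open>W\<close>.\<close>

definition unit_zz where
  "unit_zz = rev (map rev_step lam_levels) @ [Bwd unit_left, Fwd unit_right]"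

lemma unit_zz_zigzag:
  "zigzag (Fun (Simp D) (Simp D)) (nat_weqs (Simp D) (Simp D) (Simp_weqs D E)) (id_fun (Simp D)) unit_zz const_simple"
  unfolding unit_zz_def
proof (rule zigzag_append)
  show "zigzag (Fun (Simp D) (Simp D)) (nat_weqs (Simp D) (Simp D) (Simp_weqs D E)) (id_fun (Simp D))
      (rev (map rev_step lam_levels)) (post_simp D simple_const)"
    using lam_levels by (intro rev_zigzag[OF category_Fun[OF cSimp cSimp]]) (simp_all add: weq_zigzag_def)
  show "zigzag (Fun (Simp D) (Simp D)) (nat_weqs (Simp D) (Simp D) (Simp_weqs D E)) (post_simp D simple_const)
      [Bwd unit_left, Fwd unit_right] const_simple"
    using unit_left_hom unit_right_hom unit_left_weq Fun_homD[OF unit_left_hom] Fun_homD[OF unit_right_hom] by simp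
qed

lemma unit_zz_steps:
  assumes "\<alpha> \<in> set_step t" "t \<in> set unit_zz"
  shows "\<alpha> \<in> nat_weqs (Simp D) (Simp D) (Simp_weqs D E) \<or> \<alpha> = unit_right"
  using assms lam_levels unit_left_weq by (fastforce simp: unit_zz_def weq_zigzag_def)

lemma counit_zigzag:
  "weq_zigzag (Simp D) (Simp D) (simple_weqs D E s) const_simple ([Bwd unit_right, Fwd unit_left] @ lam_levels) (id_fun (Simp D))"
  using weq_zigzag_mono[OF Simp_weqs_simple lam_levels] Fun_homD[OF unit_left_hom] Fun_homD[OF unit_right_hom]
    unit_right_weq subsetD[OF nat_weqs_mono[OF Simp_weqs_simple] unit_left_weq] by simp

lemma const_weq: "f \<in> E \<Longrightarrow> far (const_simp D) f \<in> Simp_weqs D E"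
  using functor_hom[OF const_functor[OF cat_op catD] Arr_hom, of f] saturatedD(1)[OF satE]
    const_fun_simps(2)[OF Arr_hom, of f D op_Delta]
  by (auto intro!: nat_weqsI)

lemma rel_simple: "rel_functor (Simp D) (Simp_weqs D E) D E s"
  and rel_simple': "rel_functor (Simp D) (simple_weqs D E s) D E s"
  and rel_const: "rel_functor D E (Simp D) (Simp_weqs D E) (const_simp D)"
  and rel_const': "rel_functor D E (Simp D) (simple_weqs D E s) (const_simp D)"
  using S4 S1_functor const_functor[OF cat_op catD] const_weq Simp_weqs_simple
  by (auto simp: rel_functor_def simple_weqs_def)

lemma unit_simple_iso:
  assumes X: "is_functor op_Delta D X"
  shows "is_iso (Loc D E) (loc_class D E (fob s X) (map (map_step (far s)) (ev_zz X unit_zz)) (fob s (fob const_simple X)))"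
proof (rule zigzag_iso[OF catD rel_functor_zigzag[OF rel_simple]])
  have X': "X \<in> Obj (Simp D)" using X by simp
  show "zigzag (Simp D) (Simp_weqs D E) X (ev_zz X unit_zz) (fob const_simple X)"
    using ev_zigzag[OF X' unit_zz_zigzag] X' by simp
  have "\<forall>t \<in> set unit_zz. set_step t \<subseteq> nat_weqs (Simp D) (Simp D) (simple_weqs D E s)"
    using unit_zz_steps unit_right_weq nat_weqs_mono[OF Simp_weqs_simple, of "Simp D" "Simp D"] by blast
  from ev_zz_weqs[OF this X'] show "\<forall>t \<in> set (map (map_step (far s)) (ev_zz X unit_zz)). set_step t \<subseteq> E"
    by (fastforce simp: step.set_map simple_weqs_def)
qed

lemma unit_const_iso:
  assumes A: "A \<in> Obj D"
  shows "is_iso (Loc (Simp D) (Simp_weqs D E)) (loc_class (Simp D) (Simp_weqs D E) (const_obj op_Delta D A)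
     (ev_zz (const_obj op_Delta D A) unit_zz) (fob const_simple (const_obj op_Delta D A)))"
proof (rule zigzag_iso[OF cSimp])
  let ?X = "const_obj op_Delta D A"
  have X: "is_functor op_Delta D ?X" by (rule const_obj_functor[OF cat_op catD A])
  then have X': "?X \<in> Obj (Simp D)" by simp
  show "zigzag (Simp D) (Simp_weqs D E) ?X (ev_zz ?X unit_zz) (fob const_simple ?X)"
    using ev_zigzag[OF X' unit_zz_zigzag] X' by simp
  have "ncomp unit_right ?X \<in> Simp_weqs D E"
    unfolding unit_comp(2)[OF X]
  proof (rule levelwise_weq[OF pr_hom(3)[OF X] S4])
    fix n :: nat
    have h: "ncomp (ncomp (bisimp_pr2 D) ?X) n \<in> hom (Simp D) (fob (fob (joinL.bisimp D) ?X) n) ?X"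
      using Fun_hom_comp[OF pr_hom(3)[OF X], of n] by simp
    show "ncomp (ncomp (bisimp_pr2 D) ?X) n \<in> Simp_weqs D E"
      by (rule nat_weqsI[OF h])
        (use bisimp_pr2_comp[OF catD X] hom_Arr[OF joinR.incl_hom] saturated_id[OF catD satE A] in simp)
  qed
  then have "\<forall>\<alpha>. (\<exists>t \<in> set unit_zz. \<alpha> \<in> set_step t) \<longrightarrow> ncomp \<alpha> ?X \<in> Simp_weqs D E"
    using unit_zz_steps nat_weqs_comp[OF _ X'] by blast
  then show "\<forall>t \<in> set (ev_zz ?X unit_zz). set_step t \<subseteq> Simp_weqs D E"
    by (fastforce dest: set_ev_zz)
qed

theorem simple_left_adjoint:
  "left_adjoint (Loc (Simp D) (Simp_weqs D E)) (Loc D E)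
     (Loc_fun (Simp D) (Simp_weqs D E) D E s) (Loc_fun D E (Simp D) (Simp_weqs D E) (const_simp D))"
proof -
  let ?W = "Simp_weqs D E"
  let ?F = "Loc_fun (Simp D) ?W D E s" and ?G = "Loc_fun D E (Simp D) ?W (const_simp D)"
  let ?\<eta> = "loc_nt (Simp D) ?W (Simp D) ?W (id_fun (Simp D)) unit_zz const_simple"
  let ?\<epsilon> = "loc_nt D E D E simple_const lam (id_fun D)"
  have \<eta>: "?\<eta> \<in> hom (Fun (Loc (Simp D) ?W) (Loc (Simp D) ?W)) (id_fun (Loc (Simp D) ?W)) (comp_fun (Loc (Simp D) ?W) ?G ?F)"
    using loc_nt_hom[OF cSimp cSimp rel_functor_id[OF cSimp] rel_functor_comp[OF cSimp rel_simple rel_const] unit_zz_zigzag]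
    unfolding Loc_fun_id[OF cSimp] Loc_fun_comp[OF cSimp catD cSimp rel_simple rel_const] .
  have \<epsilon>: "?\<epsilon> \<in> hom (Fun (Loc D E) (Loc D E)) (comp_fun (Loc D E) ?F ?G) (id_fun (Loc D E))"
    using loc_nt_hom[OF catD catD rel_functor_comp[OF catD rel_const rel_simple] rel_functor_id[OF catD] weq_zigzagD[OF S3]]
    unfolding Loc_fun_id[OF catD] Loc_fun_comp[OF catD cSimp catD rel_const rel_simple] .
  have \<eta>c: "ncomp ?\<eta> X = loc_class (Simp D) ?W X (ev_zz X unit_zz) (fob const_simple X)" if "X \<in> Obj (Simp D)" for X
    using that by (simp add: loc_nt_def)
  show ?thesis
  proof (rule left_adjointI_iso[OF category_Loc[OF cSimp] category_Loc[OF catD]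
        Loc_functor[OF cSimp catD rel_simple] Loc_functor[OF catD cSimp rel_const] \<eta> \<epsilon>])
    show "is_iso (Loc D E) (ncomp ?\<epsilon> A)" if "A \<in> Obj (Loc D E)" for A
      using weq_zigzag_iso[OF catD S3] that by (simp add: loc_nt_def)
    show "is_iso (Loc D E) (far ?F (ncomp ?\<eta> X))" if "X \<in> Obj (Loc (Simp D) ?W)" for X
    proof -
      have X: "X \<in> Obj (Simp D)" using that by simp
      have z: "zigzag (Simp D) ?W X (ev_zz X unit_zz) (fob const_simple X)"
        using ev_zigzag[OF X unit_zz_zigzag] X by simp
      show ?thesis unfolding \<eta>c[OF X] Loc_fun_class[OF cSimp rel_simple z]
        using X by (intro unit_simple_iso) simp
    qed
    show "is_iso (Loc (Simp D) ?W) (ncomp ?\<eta> (fob ?G A))" if "A \<in> Obj (Loc D E)" for A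
    proof -
      have A: "A \<in> Obj D" using that by simp
      have "const_obj op_Delta D A \<in> Obj (Simp D)" using const_obj_functor[OF cat_op catD A] by simp
      from \<eta>c[OF this] show ?thesis using unit_const_iso[OF A] A by simp
    qed
  qed
qed

lemma saturated_simple_weqs: "saturated (Simp D) (simple_weqs D E s)"
  unfolding simple_weqs_def by (rule saturated_preimage[OF cSimp catD S1_functor satE])

theorem simple_homotopical_equivalence:
  "homotopical_equivalence (Simp D) (simple_weqs D E s) D E s (const_simp D)"
  unfolding homotopical_equivalence_def relative_category_def
proof (intro conjI exI)
  show "far s ` simple_weqs D E s \<subseteq> E" by (auto simp: simple_weqs_def)
  show "far (const_simp D) ` E \<subseteq> simple_weqs D E s" using const_weq Simp_weqs_simple by blast
qed (rule cSimp saturated_simple_weqs catD satE S1_functor const_functor[OF cat_op catD] S3 counit_zigzag)+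

theorem simple_equivalence:
  "is_equivalence (Loc (Simp D) (simple_weqs D E s)) (Loc D E) (Loc_fun (Simp D) (simple_weqs D E s) D E s)"
  unfolding is_equivalence_def
proof (intro conjI exI)
  let ?S = "simple_weqs D E s"
  let ?G = "Loc_fun D E (Simp D) ?S (const_simp D)"
  show "is_functor (Loc (Simp D) ?S) (Loc D E) (Loc_fun (Simp D) ?S D E s)"
    by (rule Loc_functor[OF cSimp catD rel_simple'])
  show "is_functor (Loc D E) (Loc (Simp D) ?S) ?G" by (rule Loc_functor[OF catD cSimp rel_const'])
  show "isomorphic (Fun (Loc (Simp D) ?S) (Loc (Simp D) ?S)) (comp_fun (Loc (Simp D) ?S) ?G (Loc_fun (Simp D) ?S D E s)) (id_fun (Loc (Simp D) ?S))"
    using weq_zigzag_isomorphic[OF cSimp cSimp rel_functor_comp[OF cSimp rel_simple' rel_const'] rel_functor_id[OF cSimp] counit_zigzag]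
    unfolding Loc_fun_id[OF cSimp] Loc_fun_comp[OF cSimp catD cSimp rel_simple' rel_const'] .
  show "isomorphic (Fun (Loc D E) (Loc D E)) (comp_fun (Loc D E) (Loc_fun (Simp D) ?S D E s) ?G) (id_fun (Loc D E))"
    using weq_zigzag_isomorphic[OF catD catD rel_functor_comp[OF catD rel_const' rel_simple'] rel_functor_id[OF catD] S3]
    unfolding Loc_fun_id[OF catD] Loc_fun_comp[OF catD cSimp catD rel_const' rel_simple'] .
qed

end

theorem theorem5p1:
  fixes D :: "('o, 'a) cat"
    and E :: "'a set"
    and s :: "(('o, 'a) sobj, ('o, 'a) sarr, 'o, 'a) fctr"
    and mu :: "((('o, 'a) sobj, ('o, 'a) sarr) sobj, (('o, 'a) sobj, ('o, 'a) sarr) sarr,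
                'o, 'a) ntrans step list"
    and lam :: "('o, 'a, 'o, 'a) ntrans step list"
  assumes "simplicial_descent D E s mu lam"
  shows
    "left_adjoint (Loc (Simp D) (Simp_weqs D E)) (Loc D E)
       (Loc_fun (Simp D) (Simp_weqs D E) D E s)
       (Loc_fun D E (Simp D) (Simp_weqs D E) (const_simp D))
     \<and> homotopical_equivalence (Simp D) (simple_weqs D E s) D E s (const_simp D)
     \<and> is_equivalence (Loc (Simp D) (simple_weqs D E s)) (Loc D E)
         (Loc_fun (Simp D) (simple_weqs D E s) D E s)"
  using simplicial_descent.simple_left_adjoint[OF assms]
    simplicial_descent.simple_homotopical_equivalence[OF assms]
    simplicial_descent.simple_equivalence[OF assms] by simp

end
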